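(* Let $\mathcal X,\mathcal Z$ be Banach spaces, $E\in\mathcal L(\mathcal X,\mathcal Z)$, $A\colon\mathcal D(A)\subseteq\mathcal X\to\mathcal Z$ closed, linear and densely defined, with $\rho(E,A)\neq\emptyset$. If the resolvent index $p_{\rm res}^{(E,A)}$, the chain index $p_{\rm chain}^{(E,A)}$, the radiality index $p_{\rm rad}^{(E,A)}$, the nilpotency index $p_{\rm nilp}^{(E,A)}$, the differentiation index $p_{\rm diff}^{(E,A)}$ and the perturbation index $p_{\rm pert}^{(E,A)}$ all exist, then $$p_{\rm rad}^{(E,A)}+1\ \ge\ p_{\rm res}^{(E,A)}\ \ge\ p_{\rm nilp}^{(E,A)}=p_{\rm diff}^{(E,A)}=p_{\rm chain}^{(E,A)}.$$ If in addition the operator $A_1$ in the Weierstraß form of $(E,A)$ generates a $C_0$-semigroup, then $$p_{\rm rad}^{(E,A)}+1\ \ge\ p_{\rm res}^{(E,A)}\ \ge\ p_{\rm nilp}^{(E,A)}=p_{\rm diff}^{(E,A)}=p_{\rm chain}^{(E,A)}=p_{\rm pert}^{(E,A)}.$$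
   Context: Setting: the differential-algebraic equation (DAE) is $\frac{d}{dt}Ex(t)=Ax(t)+f(t)$. $\rho(E,A)$ is the set of $\lambda\in\mathbb C$ for which $\lambda E-A\colon\mathcal D(A)\to\mathcal Z$ has an inverse $(\lambda E-A)^{-1}\in\mathcal L(\mathcal Z,\mathcal X)$. A solution means a classical solution: $x$ takes values in $\mathcal D(A)$, $Ex(\cdot)$ is continuously differentiable with values in $\mathcal Z$, and the equation holds for every $t$. Resolvent index: the smallest $p\in\mathbb N_0$ such that there are $\omega\in\mathbb R$, $C>0$ with $(\omega,\infty)\subseteq\rho(E,A)$ and $\|(\lambda E-A)^{-1}\|\le C|\lambda|^{p-1}$ for all $\lambda\in(\omega,\infty)$. Radiality index: the smallest $p\in\mathbb N_0$ such that there are $\omega\in\mathbb R$, $C>0$ with $(\omega,\infty)\subseteq\rho(E,A)$ and, for all $\lambda_0,\dots,\lambda_p>\omega$, both $\|(\lambda_0E-A)^{-1}E\cdots(\lambda_pE-A)^{-1}E\|$ and $\|E(\lambda_0E-A)^{-1}\cdots E(\lambda_pE-A)^{-1}\|$ are at most $C\prod_{k=0}^p\frac1{|\lambda_k-\omega|}$. Chain index: a chain of $(E,A)$ of length $p\in\mathbb N$ is a tuple $(x_1,\dots,x_p)\in\mathcal D(A)^{p-1}\times\mathcal X$ with $x_1\in\ker E\setminus\{0\}$, $x_k\notin\ker A$ for $k=1,\dots,p-1$, and $Ex_{k+1}=Ax_k$ for $k=1,\dots,p-1$. The chain index is the supremum of all chain lengths ($0$ if there are no chains); it exists only if this supremum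 is finite. Equivalence: $(E,A)\sim(\tilde E,\tilde A)$ (with $\tilde E\in\mathcal L(\tilde{\mathcal X},\tilde{\mathcal Z})$, $\tilde A$ from $\tilde{\mathcal X}$ to $\tilde{\mathcal Z}$) if there are bounded isomorphisms $P\colon\mathcal X\to\tilde{\mathcal X}$, $Q\colon\mathcal Z\to\tilde{\mathcal Z}$ with $E=Q^{-1}\tilde EP$, $A=Q^{-1}\tilde AP$. Weierstraß form: $(E,A)$ has a Weierstraß form if there is a Hilbert space $\mathcal Y=\mathcal Y^1\oplus\mathcal Y^2$ with $(E,A)\sim\left(\begin{bmatrix}I_{\mathcal Y^1}&0\\0&N\end{bmatrix},\begin{bmatrix}A_1&0\\0&I_{\mathcal Y^2}\end{bmatrix}\right)$, where $N\in\mathcal L(\mathcal Y^2)$ is nilpotent and $A_1\colon\mathcal D(A_1)\subseteq\mathcal Y^1\to\mathcal Y^1$ is linear. The degree of nilpotency of $N$ is the number $p$ with $N^p=0$ and $N^l\ne0$ for $l<p$. Nilpotency index: defined if $(E,A)$ has a Weierstraß form; it is the degree of nilpotency of $N$, and $0$ if $N$ is absent (i.e. $(E,A)\sim(I_{\mathcal Y^1},A_1)$). Differentiation index: for $\mu\in\mathbb N_0$ let $M_\mu\colon\mathcal D(A)^{\mu+1}\times\mathcal X\to\mathcal Z^{\mu+1}$, $M_\mu(x_0,\dots,x_{\mu+1})=(Ax_0-Ex_1,\ Ax_1-Ex_2,\ \dots,\ Ax_\mu-Ex_{\mu+1})$. The differentiation index is the smallest $\mu\in\mathbb N_0$ for which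 there exist a Banach space $\tilde{\mathcal X}$ densely embedded into $\mathcal X$ and a generator $(S,\mathcal D(S))$ of a strongly continuous semigroup on $\tilde{\mathcal X}$ such that $(x_0,\dots,x_{\mu+1})\in\ker M_\mu$ implies $x_0\in\mathcal D(S)$ and $x_1=Sx_0$. Perturbation index: consider $\frac{d}{dt}Ex(t)=Ax(t)+\delta(t)$ on $[0,T]$. The perturbation index is the smallest $p\in\mathbb N_0$ such that there is $c>0$ such that all solutions $x$ with $\delta\in C^{p-1}([0,T],\mathcal Z)$ (continuous $\delta$ if $p=0$) satisfy $\max_{0\le t\le T}\|x(t)\|_{\mathcal X}\le c\big(\|x(0)\|_{\mathcal X}+\sum_{i=0}^{p-1}\max_{0\le t\le T}\|\frac{d^i}{dt^i}\delta(t)\|_{\mathcal Z}\big)$ if $p>0$, and $\max_{0\le t\le T}\|x(t)\|_{\mathcal X}\le c\big(\|x(0)\|_{\mathcal X}+\int_0^T\|\delta(t)\|_{\mathcal Z}\,dt\big)$ if $p=0$. *)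

theory Defs
  imports "HOL-Analysis.Analysis"
begin

section \<open>Complex Banach and Hilbert spaces\<close>

class complex_vector = real_vector +
  fixes scaleC :: "complex \<Rightarrow> 'a \<Rightarrow> 'a"  (infixr "*\<^sub>C" 75)
  assumes scaleR_scaleC: "r *\<^sub>R x = complex_of_real r *\<^sub>C x"
    and scaleC_add_right: "a *\<^sub>C (x + y) = a *\<^sub>C x + a *\<^sub>C y"
    and scaleC_add_left: "(a + b) *\<^sub>C x = a *\<^sub>C x + b *\<^sub>C x"
    and scaleC_scaleC: "a *\<^sub>C b *\<^sub>C x = (a * b) *\<^sub>C x"
    and scaleC_one: "1 *\<^sub>C x = x"

class complex_normed_vector = complex_vector + real_normed_vector +
  assumes norm_scaleC: "norm (a *\<^sub>C x) = cmod a * norm x"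

class complex_banach = complex_normed_vector + banach

class complex_hilbert = complex_banach +
  fixes cinner :: "'a \<Rightarrow> 'a \<Rightarrow> complex"
  assumes cinner_commute: "cinner x y = cnj (cinner y x)"
    and cinner_add_right: "cinner x (y + z) = cinner x y + cinner x z"
    and cinner_scaleC_right: "cinner x (a *\<^sub>C y) = a * cinner x y"
    and cinner_norm: "cinner x x = complex_of_real ((norm x)\<^sup>2)"

text \<open>The direct sum of two spaces is the product type. The norm of the product type in the
  library is the Euclidean combination of the two norms, which is the Hilbert space norm.\<close>

instantiation prod :: (complex_vector, complex_vector) complex_vector
begin
definition scaleC_prod :: "complex \<Rightarrow> 'a \<times> 'b \<Rightarrow> 'a \<times> 'b" where
  "a *\<^sub>C p = (a *\<^sub>C fst p, a *\<^sub>C snd p)"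
instance
  by standard
    (simp_all add: scaleC_prod_def scaleR_prod_def scaleR_scaleC scaleC_add_right
      scaleC_add_left scaleC_scaleC scaleC_one)
end

instance prod :: (complex_normed_vector, complex_normed_vector) complex_normed_vector
proof
  fix a :: complex and p :: "'a \<times> 'b"
  have "(cmod a * norm (fst p))\<^sup>2 + (cmod a * norm (snd p))\<^sup>2
      = (cmod a)\<^sup>2 * ((norm (fst p))\<^sup>2 + (norm (snd p))\<^sup>2)"
    by (simp add: power_mult_distrib distrib_left)
  then show "norm (a *\<^sub>C p) = cmod a * norm p"
    by (simp add: scaleC_prod_def norm_prod_def norm_scaleC real_sqrt_mult)
qed

instance prod :: (complex_banach, complex_banach) complex_banach ..

instantiation prod :: (complex_hilbert, complex_hilbert) complex_hilbert
begin
definition cinner_prod :: "'a \<times> 'b \<Rightarrow> 'a \<times> 'b \<Rightarrow> complex" where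
  "cinner_prod p q = cinner (fst p) (fst q) + cinner (snd p) (snd q)"
instance
proof
  fix x y z :: "'a \<times> 'b" and a :: complex
  show "cinner x y = cnj (cinner y x)"
    unfolding cinner_prod_def
    by (metis cinner_commute complex_cnj_add)
  show "cinner x (y + z) = cinner x y + cinner x z"
    by (simp add: cinner_prod_def cinner_add_right)
  show "cinner x (a *\<^sub>C y) = a * cinner x y"
    by (simp add: cinner_prod_def scaleC_prod_def cinner_scaleC_right distrib_left)
  show "cinner x x = complex_of_real ((norm x)\<^sup>2)"
    by (simp add: cinner_prod_def cinner_norm norm_prod_def)
qed
end

section \<open>Linear operators\<close>

text \<open>An unbounded operator is a pair of a domain \<open>D\<close> and a total function \<open>A\<close>;
  the values of \<open>A\<close> outside of \<open>D\<close> are irrelevant.\<close>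

definition csubspace :: "'a::complex_vector set \<Rightarrow> bool" where
  "csubspace V \<longleftrightarrow>
     0 \<in> V \<and> (\<forall>x\<in>V. \<forall>y\<in>V. x + y \<in> V) \<and> (\<forall>c. \<forall>x\<in>V. c *\<^sub>C x \<in> V)"

definition clinear_on :: "'a::complex_vector set \<Rightarrow> ('a \<Rightarrow> 'b::complex_vector) \<Rightarrow> bool" where
  "clinear_on D A \<longleftrightarrow> csubspace D \<and>
     (\<forall>x\<in>D. \<forall>y\<in>D. A (x + y) = A x + A y) \<and> (\<forall>c. \<forall>x\<in>D. A (c *\<^sub>C x) = c *\<^sub>C A x)"

definition closed_operator ::
    "'a::complex_normed_vector set \<Rightarrow> ('a \<Rightarrow> 'b::complex_normed_vector) \<Rightarrow> bool" where
  "closed_operator D A \<longleftrightarrow> closed ((\<lambda>x. (x, A x)) ` D)"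

definition bounded_clinear ::
    "('a::complex_normed_vector \<Rightarrow> 'b::complex_normed_vector) \<Rightarrow> bool" where
  "bounded_clinear f \<longleftrightarrow> bounded_linear f \<and> (\<forall>c x. f (c *\<^sub>C x) = c *\<^sub>C f x)"

definition bounded_iso ::
    "('a::complex_normed_vector \<Rightarrow> 'b::complex_normed_vector) \<Rightarrow> bool" where
  "bounded_iso P \<longleftrightarrow> bij P \<and> bounded_clinear P \<and> bounded_clinear (inv P)"

section \<open>Strongly continuous semigroups\<close>

text \<open>The space carrying the semigroup is a subspace \<open>V\<close> of the ambient type with a norm
  \<open>nV\<close> of its own, since the differentiation index involves Banach spaces that are merely
  embedded into the ambient space.\<close>

definition banach_on :: "'a::complex_vector set \<Rightarrow> ('a \<Rightarrow> real) \<Rightarrow> bool" where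
  "banach_on V nV \<longleftrightarrow> csubspace V \<and>
     (\<forall>x\<in>V. 0 \<le> nV x \<and> (nV x = 0 \<longleftrightarrow> x = 0)) \<and>
     (\<forall>x\<in>V. \<forall>y\<in>V. nV (x + y) \<le> nV x + nV y) \<and>
     (\<forall>c. \<forall>x\<in>V. nV (c *\<^sub>C x) = cmod c * nV x) \<and>
     (\<forall>u. (\<forall>n. u n \<in> V) \<and> (\<forall>e>0. \<exists>M. \<forall>m\<ge>M. \<forall>n\<ge>M. nV (u m - u n) < e) \<longrightarrow>
        (\<exists>l\<in>V. (\<lambda>n. nV (u n - l)) \<longlonglongrightarrow> 0))"

definition C0_semigroup ::
    "'a::complex_vector set \<Rightarrow> ('a \<Rightarrow> real) \<Rightarrow> (real \<Rightarrow> 'a \<Rightarrow> 'a) \<Rightarrow> bool" where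
  "C0_semigroup V nV G \<longleftrightarrow>
     (\<forall>t\<ge>0. clinear_on V (G t) \<and> G t ` V \<subseteq> V \<and> (\<exists>K. \<forall>x\<in>V. nV (G t x) \<le> K * nV x)) \<and>
     (\<forall>x\<in>V. G 0 x = x) \<and>
     (\<forall>s\<ge>0. \<forall>t\<ge>0. \<forall>x\<in>V. G (s + t) x = G s (G t x)) \<and>
     (\<forall>x\<in>V. ((\<lambda>t. nV (G t x - x)) \<longlongrightarrow> 0) (at_right 0))"

definition generator_limit ::
    "('a::complex_vector \<Rightarrow> real) \<Rightarrow> (real \<Rightarrow> 'a \<Rightarrow> 'a) \<Rightarrow> 'a \<Rightarrow> 'a \<Rightarrow> bool" where
  "generator_limit nV G x y \<longleftrightarrow>
     ((\<lambda>h. nV ((1 / h) *\<^sub>R (G h x - x) - y)) \<longlongrightarrow> 0) (at_right 0)"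

definition generates_C0_semigroup ::
    "'a::complex_vector set \<Rightarrow> ('a \<Rightarrow> real) \<Rightarrow> 'a set \<Rightarrow> ('a \<Rightarrow> 'a) \<Rightarrow> bool" where
  "generates_C0_semigroup V nV D S \<longleftrightarrow> (\<exists>G. C0_semigroup V nV G \<and>
     D = {x \<in> V. \<exists>y\<in>V. generator_limit nV G x y} \<and>
     (\<forall>x\<in>D. S x \<in> V \<and> generator_limit nV G x (S x)))"

definition densely_embedded :: "'a::complex_normed_vector set \<Rightarrow> ('a \<Rightarrow> real) \<Rightarrow> bool" where
  "densely_embedded V nV \<longleftrightarrow> closure V = UNIV \<and> (\<exists>K. \<forall>x\<in>V. norm x \<le> K * nV x)"

section \<open>Resolvent, resolvent index and radiality index\<close>

definition resolvent ::
    "('x::complex_banach \<Rightarrow> 'z::complex_banach) \<Rightarrow> 'x set \<Rightarrow> ('x \<Rightarrow> 'z) \<Rightarrow> complex \<Rightarrow> 'z \<Rightarrow> 'x" where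
  "resolvent E D A l = inv_into D (\<lambda>x. l *\<^sub>C E x - A x)"

definition resolvent_set ::
    "('x::complex_banach \<Rightarrow> 'z::complex_banach) \<Rightarrow> 'x set \<Rightarrow> ('x \<Rightarrow> 'z) \<Rightarrow> complex set" where
  "resolvent_set E D A =
     {l. bij_betw (\<lambda>x. l *\<^sub>C E x - A x) D UNIV \<and> bounded_clinear (resolvent E D A l)}"

definition is_smallest :: "(nat \<Rightarrow> bool) \<Rightarrow> nat \<Rightarrow> bool" where
  "is_smallest \<Phi> p \<longleftrightarrow> \<Phi> p \<and> (\<forall>q<p. \<not> \<Phi> q)"

text \<open>The exponent \<open>p - 1\<close> is an integer, possibly \<open>-1\<close>. The convention
  \<open>0 powi (-1) = 0\<close> is harmless, because \<open>\<omega>\<close> may always be enlarged.\<close>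

definition resolvent_index ::
    "('x::complex_banach \<Rightarrow> 'z::complex_banach) \<Rightarrow> 'x set \<Rightarrow> ('x \<Rightarrow> 'z) \<Rightarrow> nat \<Rightarrow> bool" where
  "resolvent_index E D A = is_smallest (\<lambda>p. \<exists>\<omega>::real. \<exists>C>0.
     complex_of_real ` {\<omega><..} \<subseteq> resolvent_set E D A \<and>
     (\<forall>l>\<omega>. onorm (resolvent E D A (complex_of_real l)) \<le> C * \<bar>l\<bar> powi (int p - 1)))"

definition comp_list :: "('a \<Rightarrow> 'a) list \<Rightarrow> 'a \<Rightarrow> 'a" where
  "comp_list fs = foldr (\<circ>) fs id"

definition radiality_index ::
    "('x::complex_banach \<Rightarrow> 'z::complex_banach) \<Rightarrow> 'x set \<Rightarrow> ('x \<Rightarrow> 'z) \<Rightarrow> nat \<Rightarrow> bool" where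
  "radiality_index E D A = is_smallest (\<lambda>p. \<exists>\<omega>::real. \<exists>C>0.
     complex_of_real ` {\<omega><..} \<subseteq> resolvent_set E D A \<and>
     (\<forall>l :: nat \<Rightarrow> real. (\<forall>k\<le>p. l k > \<omega>) \<longrightarrow>
        onorm (comp_list (map (\<lambda>k. resolvent E D A (complex_of_real (l k)) \<circ> E) [0..<Suc p]))
          \<le> C * (\<Prod>k\<le>p. 1 / \<bar>l k - \<omega>\<bar>) \<and>
        onorm (comp_list (map (\<lambda>k. E \<circ> resolvent E D A (complex_of_real (l k))) [0..<Suc p]))
          \<le> C * (\<Prod>k\<le>p. 1 / \<bar>l k - \<omega>\<bar>)))"

section \<open>Chain index\<close>

definition is_chain ::
    "('x::complex_banach \<Rightarrow> 'z::complex_banach) \<Rightarrow> 'x set \<Rightarrow> ('x \<Rightarrow> 'z) \<Rightarrow> nat \<Rightarrow> (nat \<Rightarrow> 'x) \<Rightarrow> bool"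
  where
  "is_chain E D A p x \<longleftrightarrow> 1 \<le> p \<and> E (x 1) = 0 \<and> x 1 \<noteq> 0 \<and>
     (\<forall>k\<in>{1..<p}. x k \<in> D \<and> A (x k) \<noteq> 0 \<and> E (x (k + 1)) = A (x k))"

text \<open>On natural numbers \<open>Sup {} = 0\<close>, which is the value of the chain index without chains.\<close>

definition chain_index ::
    "('x::complex_banach \<Rightarrow> 'z::complex_banach) \<Rightarrow> 'x set \<Rightarrow> ('x \<Rightarrow> 'z) \<Rightarrow> nat \<Rightarrow> bool" where
  "chain_index E D A m \<longleftrightarrow>
     bdd_above {p. \<exists>x. is_chain E D A p x} \<and> m = Sup {p. \<exists>x. is_chain E D A p x}"

section \<open>Equivalence, Weierstrass form and nilpotency index\<close>

definition equivalent_pencils ::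
    "('x::complex_banach \<Rightarrow> 'z::complex_banach) \<Rightarrow> 'x set \<Rightarrow> ('x \<Rightarrow> 'z) \<Rightarrow>
     ('x'::complex_banach \<Rightarrow> 'z'::complex_banach) \<Rightarrow> 'x' set \<Rightarrow> ('x' \<Rightarrow> 'z') \<Rightarrow> bool" where
  "equivalent_pencils E D A E' D' A' \<longleftrightarrow> (\<exists>P Q. bounded_iso P \<and> bounded_iso Q \<and>
     E = inv Q \<circ> E' \<circ> P \<and>
     D = P -` D' \<and> (\<forall>x\<in>D. A x = inv Q (A' (P x))))"

text \<open>\<open>nilpotency_degree\<close> is \<open>0\<close> exactly if the space on which \<open>N\<close> acts is the zero
  space (where \<open>N ^^ 0 = id\<close> is the zero operator), that is, if \<open>N\<close> is absent from the
  Weierstrass form.\<close>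

definition nilpotency_degree :: "('a::complex_banach \<Rightarrow> 'a) \<Rightarrow> nat \<Rightarrow> bool" where
  "nilpotency_degree N p \<longleftrightarrow> N ^^ p = (\<lambda>_. 0) \<and> (\<forall>l<p. N ^^ l \<noteq> (\<lambda>_. 0))"

text \<open>The Hilbert spaces are types here. Either of \<open>'y1\<close> and \<open>'y2\<close> may be the zero space.\<close>

definition weierstrass_form ::
    "('x::complex_banach \<Rightarrow> 'z::complex_banach) \<Rightarrow> 'x set \<Rightarrow> ('x \<Rightarrow> 'z) \<Rightarrow>
     ('y2::complex_hilbert \<Rightarrow> 'y2) \<Rightarrow> 'y1::complex_hilbert set \<Rightarrow> ('y1 \<Rightarrow> 'y1) \<Rightarrow> bool" where
  "weierstrass_form E D A N D1 A1 \<longleftrightarrow>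
     bounded_clinear N \<and> (\<exists>p. N ^^ p = (\<lambda>_. 0)) \<and> clinear_on D1 A1 \<and>
     equivalent_pencils E D A
       (\<lambda>(u, v). (u, N v)) (D1 \<times> UNIV) (\<lambda>(u, v). (A1 u, v))"

text \<open>The nilpotency index of \<open>(E, A)\<close>, read off from a Weierstrass form with data
  \<open>N\<close>, \<open>D1\<close>, \<open>A1\<close>. HOL cannot quantify existentially over the types \<open>'y1\<close> and \<open>'y2\<close>;
  as an assumption for arbitrary types and data, this amounts to the existence of a form.\<close>

definition nilpotency_index_via ::
    "('x::complex_banach \<Rightarrow> 'z::complex_banach) \<Rightarrow> 'x set \<Rightarrow> ('x \<Rightarrow> 'z) \<Rightarrow>
     ('y2::complex_hilbert \<Rightarrow> 'y2) \<Rightarrow> 'y1::complex_hilbert set \<Rightarrow> ('y1 \<Rightarrow> 'y1) \<Rightarrow> nat \<Rightarrow> bool" where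
  "nilpotency_index_via E D A N D1 A1 p \<longleftrightarrow>
     weierstrass_form E D A N D1 A1 \<and> nilpotency_degree N p"

section \<open>Differentiation index\<close>

text \<open>A sequence stands for the tuple of its entries \<open>x 0, \<dots>, x (\<mu> + 1)\<close>.\<close>

definition ker_deriv_array ::
    "('x::complex_banach \<Rightarrow> 'z::complex_banach) \<Rightarrow> 'x set \<Rightarrow> ('x \<Rightarrow> 'z) \<Rightarrow> nat \<Rightarrow> (nat \<Rightarrow> 'x) set"
  where
  "ker_deriv_array E D A \<mu> =
     {x. (\<forall>i\<le>\<mu>. x i \<in> D) \<and> (\<forall>i\<le>\<mu>. A (x i) - E (x (i + 1)) = 0)}"

definition differentiation_index ::
    "('x::complex_banach \<Rightarrow> 'z::complex_banach) \<Rightarrow> 'x set \<Rightarrow> ('x \<Rightarrow> 'z) \<Rightarrow> nat \<Rightarrow> bool" where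
  "differentiation_index E D A = is_smallest (\<lambda>\<mu>. \<exists>V nV DS S.
     banach_on V nV \<and> densely_embedded V nV \<and> generates_C0_semigroup V nV DS S \<and>
     (\<forall>x \<in> ker_deriv_array E D A \<mu>. x 0 \<in> DS \<and> x 1 = S (x 0)))"

section \<open>Perturbation index\<close>

definition iter_deriv :: "real \<Rightarrow> nat \<Rightarrow> (real \<Rightarrow> 'z::real_normed_vector) \<Rightarrow> real \<Rightarrow> 'z" where
  "iter_deriv T i = (\<lambda>f t. vector_derivative f (at t within {0..T})) ^^ i"

definition C_k_on :: "real \<Rightarrow> nat \<Rightarrow> (real \<Rightarrow> 'z::real_normed_vector) \<Rightarrow> bool" where
  "C_k_on T k f \<longleftrightarrow>
     (\<forall>i<k. \<forall>t\<in>{0..T}. iter_deriv T i f differentiable (at t within {0..T})) \<and>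
     (\<forall>i\<le>k. continuous_on {0..T} (iter_deriv T i f))"

definition classical_solution ::
    "real \<Rightarrow> ('x::complex_banach \<Rightarrow> 'z::complex_banach) \<Rightarrow> 'x set \<Rightarrow> ('x \<Rightarrow> 'z) \<Rightarrow>
     (real \<Rightarrow> 'z) \<Rightarrow> (real \<Rightarrow> 'x) \<Rightarrow> bool" where
  "classical_solution T E D A f x \<longleftrightarrow>
     (\<forall>t\<in>{0..T}. x t \<in> D) \<and> C_k_on T 1 (\<lambda>t. E (x t)) \<and>
     (\<forall>t\<in>{0..T}. vector_derivative (\<lambda>s. E (x s)) (at t within {0..T}) = A (x t) + f t)"

text \<open>For \<open>p = 0\<close> the truncated difference \<open>p - 1\<close> is \<open>0\<close>, so that \<open>\<delta>\<close> is merely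
  continuous, as it should be.\<close>

definition perturbation_index ::
    "real \<Rightarrow> ('x::complex_banach \<Rightarrow> 'z::complex_banach) \<Rightarrow> 'x set \<Rightarrow> ('x \<Rightarrow> 'z) \<Rightarrow> nat \<Rightarrow> bool"
  where
  "perturbation_index T E D A = is_smallest (\<lambda>p. \<exists>c>0. \<forall>x \<delta>.
     C_k_on T (p - 1) \<delta> \<and> classical_solution T E D A \<delta> x \<longrightarrow>
     (\<forall>t\<in>{0..T}. norm (x t) \<le> c * (norm (x 0) +
        (if p = 0 then integral {0..T} (\<lambda>s. norm (\<delta> s))
         else (\<Sum>i<p. SUP s\<in>{0..T}. norm (iter_deriv T i \<delta> s))))))"

end

(*
Idea. In Weierstrass coordinates the nilpotent part is explicit: (l N - I)^-1 = - sum l^k N^k relates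
the nilpotency index to the growth of the resolvent, chains are chains of N, and v = - sum N^i delta^(i).
The function exp(l t) R(l) z is the solution for the perturbation exp(l t) z, hence the resolvent
index is at most the perturbation index; expanding R(l) in powers of R(m) E bounds the resolvent
index by the radiality index plus one.

The remaining estimates of the differentiation and perturbation index need that A1 generates a
semigroup on the whole space. This follows from the existence of both indices. The differentiation
index provides a generator on a smaller space V which extends A1 on the domain of a power of A1. By
the exponential formula its semigroup commutes with the resolvents of A1, so its orbits are
classical solutions of the homogeneous equation. The perturbation index then bounds these orbits in
the norm of the ambient space, and the semigroup extends by density.
*)

theory Submission
  imports Defs
begin

text \<open>The obstacle is that the semigroup granted by the differentiation index lives on a space
  \<open>V\<close> with a norm of its own, and that its generator is tied to \<open>A1\<close> only
  through tuples in the kernel of the derivative array: \<open>(J u, J (A1 u), ...)\<close>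
  qualifies only for \<open>u\<close> in the domain of the power \<open>\<mu> + 1\<close> of
  \<open>A1\<close>. Orbits in \<open>V\<close> might leave the first Weierstrass component, and
  their projections are not known to lie in the domain of \<open>A1\<close>. Both difficulties are
  met by the backward Euler steps \<open>(I - h A1)^-1\<close>: they are built from resolvents of
  \<open>A1\<close>, preserve the domain of every power and converge to the semigroup, so properties
  of the orbits are checked on the steps and passed to the limit. The convergence proof loses
  derivatives; therefore the orbits start in the domain of a sufficiently high power, which is still
  dense. The perturbation index is bounded from below by way of the resolvent index, which lies
  between it and the nilpotency index.\<close>

lemma scaleC_of_real: "complex_of_real r *\<^sub>C x = r *\<^sub>R x"
  by (simp add: scaleR_scaleC)

lemma csubspace_facts:
  assumes "csubspace V"
  shows csubspace_0: "0 \<in> V"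
    and csubspace_add: "\<And>x y. x \<in> V \<Longrightarrow> y \<in> V \<Longrightarrow> x + y \<in> V"
    and csubspace_scaleC: "\<And>c x. x \<in> V \<Longrightarrow> c *\<^sub>C x \<in> V"
    and csubspace_scaleR: "\<And>r x. x \<in> V \<Longrightarrow> r *\<^sub>R x \<in> V"
    and csubspace_diff: "\<And>x y. x \<in> V \<Longrightarrow> y \<in> V \<Longrightarrow> x - y \<in> V"
proof -
  show "0 \<in> V" and add: "\<And>x y. x \<in> V \<Longrightarrow> y \<in> V \<Longrightarrow> x + y \<in> V"
    and scale: "\<And>c x. x \<in> V \<Longrightarrow> c *\<^sub>C x \<in> V"
    using assms by (auto simp: csubspace_def)
  show scaleR: "\<And>r x. x \<in> V \<Longrightarrow> r *\<^sub>R x \<in> V"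
    by (simp add: scaleR_scaleC scale)
  show "x - y \<in> V" if "x \<in> V" "y \<in> V" for x y
    using add[OF that(1) scaleR[OF that(2), of "-1"]] by simp
qed

lemma clinear_on_facts:
  assumes "clinear_on V A"
  shows clinear_on_csubspace: "csubspace V"
    and clinear_on_add: "\<And>x y. x \<in> V \<Longrightarrow> y \<in> V \<Longrightarrow> A (x + y) = A x + A y"
    and clinear_on_scaleC: "\<And>c x. x \<in> V \<Longrightarrow> A (c *\<^sub>C x) = c *\<^sub>C A x"
    and clinear_on_scaleR: "\<And>r x. x \<in> V \<Longrightarrow> A (r *\<^sub>R x) = r *\<^sub>R A x"
    and clinear_on_0: "A 0 = 0"
    and clinear_on_diff: "\<And>x y. x \<in> V \<Longrightarrow> y \<in> V \<Longrightarrow> A (x - y) = A x - A y"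
proof -
  show V: "csubspace V" and add: "\<And>x y. x \<in> V \<Longrightarrow> y \<in> V \<Longrightarrow> A (x + y) = A x + A y"
    and scale: "\<And>c x. x \<in> V \<Longrightarrow> A (c *\<^sub>C x) = c *\<^sub>C A x"
    using assms by (auto simp: clinear_on_def)
  show scaleR: "\<And>r x. x \<in> V \<Longrightarrow> A (r *\<^sub>R x) = r *\<^sub>R A x"
    by (simp add: scaleR_scaleC scale)
  show "A 0 = 0"
    using scaleR[OF csubspace_0[OF V], of 0] by simp
  show "A (x - y) = A x - A y" if "x \<in> V" "y \<in> V" for x y
    using add[OF that(1) csubspace_scaleR[OF V that(2)], of "-1"] scaleR[OF that(2), of "-1"]
    by simp
qed

lemma bounded_clinearD:
  assumes "bounded_clinear f"
  shows bounded_clinear_linear: "bounded_linear f"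
    and bounded_clinear_scaleC: "f (c *\<^sub>C x) = c *\<^sub>C f x"
    and bounded_clinear_add: "f (x + y) = f x + f y"
    and bounded_clinear_diff: "f (x - y) = f x - f y"
    and bounded_clinear_scaleR: "f (r *\<^sub>R x) = r *\<^sub>R f x"
    and bounded_clinear_0: "f 0 = 0"
proof -
  show bl: "bounded_linear f" and "f (c *\<^sub>C x) = c *\<^sub>C f x"
    using assms by (auto simp: bounded_clinear_def)
  from bl show "f (x + y) = f x + f y" "f (x - y) = f x - f y" "f (r *\<^sub>R x) = r *\<^sub>R f x" "f 0 = 0"
    by (simp_all add: linear_simps)
qed

section \<open>Growth of semigroups\<close>

lemma banach_on_facts:
  assumes "banach_on V nV"
  shows banach_on_csubspace: "csubspace V"
    and banach_on_nonneg: "\<And>x. x \<in> V \<Longrightarrow> 0 \<le> nV x"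
    and banach_on_eq_0: "\<And>x. x \<in> V \<Longrightarrow> nV x = 0 \<longleftrightarrow> x = 0"
    and banach_on_add: "\<And>x y. x \<in> V \<Longrightarrow> y \<in> V \<Longrightarrow> nV (x + y) \<le> nV x + nV y"
    and banach_on_scaleR: "\<And>r x. x \<in> V \<Longrightarrow> nV (r *\<^sub>R x) = \<bar>r\<bar> * nV x"
    and banach_on_diff: "\<And>x y. x \<in> V \<Longrightarrow> y \<in> V \<Longrightarrow> nV (x - y) \<le> nV x + nV y"
    and banach_on_complete: "\<And>u. (\<And>n. u n \<in> V) \<Longrightarrow>
      (\<And>e. e > 0 \<Longrightarrow> \<exists>M. \<forall>m\<ge>M. \<forall>n\<ge>M. nV (u m - u n) < e) \<Longrightarrow>
      \<exists>l\<in>V. (\<lambda>n. nV (u n - l)) \<longlonglongrightarrow> 0"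
proof -
  show V: "csubspace V" and "\<And>x. x \<in> V \<Longrightarrow> 0 \<le> nV x"
    and "\<And>x. x \<in> V \<Longrightarrow> nV x = 0 \<longleftrightarrow> x = 0"
    and add: "\<And>x y. x \<in> V \<Longrightarrow> y \<in> V \<Longrightarrow> nV (x + y) \<le> nV x + nV y"
    and "\<And>u. (\<And>n. u n \<in> V) \<Longrightarrow>
      (\<And>e. e > 0 \<Longrightarrow> \<exists>M. \<forall>m\<ge>M. \<forall>n\<ge>M. nV (u m - u n) < e) \<Longrightarrow>
      \<exists>l\<in>V. (\<lambda>n. nV (u n - l)) \<longlonglongrightarrow> 0"
    using assms by (auto simp: banach_on_def)
  show scale: "\<And>r x. x \<in> V \<Longrightarrow> nV (r *\<^sub>R x) = \<bar>r\<bar> * nV x"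
    using assms by (simp add: scaleR_scaleC banach_on_def)
  show "nV (x - y) \<le> nV x + nV y" if "x \<in> V" "y \<in> V" for x y
    using add[OF that(1) csubspace_scaleR[OF V that(2)], of "-1"] scale[OF that(2), of "-1"]
    by simp
qed

lemma C0_semigroup_facts:
  assumes "C0_semigroup V nV G"
  shows C0_semigroup_clinear: "\<And>t. t \<ge> 0 \<Longrightarrow> clinear_on V (G t)"
    and C0_semigroup_in: "\<And>t x. t \<ge> 0 \<Longrightarrow> x \<in> V \<Longrightarrow> G t x \<in> V"
    and C0_semigroup_bound: "\<And>t. t \<ge> 0 \<Longrightarrow> \<exists>K. \<forall>x\<in>V. nV (G t x) \<le> K * nV x"
    and C0_semigroup_0: "\<And>x. x \<in> V \<Longrightarrow> G 0 x = x"
    and C0_semigroup_add: "\<And>s t x. s \<ge> 0 \<Longrightarrow> t \<ge> 0 \<Longrightarrow> x \<in> V \<Longrightarrow> G (s + t) x = G s (G t x)"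
    and C0_semigroup_lim: "\<And>x. x \<in> V \<Longrightarrow> ((\<lambda>t. nV (G t x - x)) \<longlongrightarrow> 0) (at_right 0)"
  using assms by (auto simp: C0_semigroup_def image_subset_iff)

text \<open>One step of the gliding hump, the uniform boundedness argument carried out directly for
  the norm \<open>nV\<close> on the subset \<open>V\<close>. As
  \<open>2 G t y = G t (x + y) - G t (x - y)\<close>, one of the two perturbations
  \<open>x + y\<close>, \<open>x - y\<close> of the centre has an image at least as large as that of
  \<open>y\<close>. The new radius \<open>r'\<close> is so small that later moves of total size
  \<open>2 * r'\<close> change the image by at most 1.\<close>

lemma gliding_hump_step:
  assumes ban: "banach_on V nV" and sg: "C0_semigroup V nV G"
    and unb: "\<And>\<eta> M. \<eta> > 0 \<Longrightarrow> \<exists>t\<in>{0..\<eta>}. \<exists>x\<in>V. M * nV x < nV (G t x)"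
    and x: "x \<in> V" and r: "r > 0"
  shows "\<exists>t x' r'. 0 \<le> t \<and> t \<le> 1 / real (Suc n) \<and> x' \<in> V \<and> nV (x' - x) \<le> r \<and>
    real n + 1 < nV (G t x') \<and> 0 < r' \<and> r' \<le> r / 2 \<and>
    (\<forall>z\<in>V. nV z \<le> 2 * r' \<longrightarrow> nV (G t z) \<le> 1)"
proof -
  note V = banach_on_csubspace[OF ban]
  obtain t z where t: "t \<in> {0..1 / real (Suc n)}" and z: "z \<in> V"
    and big: "((real n + 1) / r) * nV z < nV (G t z)"
    using unb[of "1 / real (Suc n)" "(real n + 1) / r"] by auto
  have t0: "t \<ge> 0" using t by simp
  note lin = C0_semigroup_clinear[OF sg t0]
  have zpos: "nV z > 0"
  proof (rule ccontr)
    assume "\<not> nV z > 0"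
    then have "z = 0" using banach_on_nonneg[OF ban z] banach_on_eq_0[OF ban z] by simp
    with clinear_on_0[OF lin] banach_on_eq_0[OF ban csubspace_0[OF V]] big show False by simp
  qed
  \<comment> \<open>Rescaling the witness \<open>z\<close> to norm exactly \<open>r\<close> turns
    the violated operator bound \<open>(n + 1) / r\<close> into an image of norm above
    \<open>n + 1\<close>.\<close>
  define y where "y = (r / nV z) *\<^sub>R z"
  have y: "y \<in> V" "nV y = r"
    using z zpos r by (simp_all add: y_def csubspace_scaleR[OF V] banach_on_scaleR[OF ban])
  have Gy: "real n + 1 < nV (G t y)"
  proof -
    have "nV (G t y) = (r / nV z) * nV (G t z)"
      using z zpos r C0_semigroup_in[OF sg t0 z]
      by (simp add: y_def clinear_on_scaleR[OF lin] banach_on_scaleR[OF ban])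
    moreover have "real n + 1 = (r / nV z) * (((real n + 1) / r) * nV z)"
      using zpos r by simp
    moreover have "(r / nV z) * (((real n + 1) / r) * nV z) < (r / nV z) * nV (G t z)"
      using big zpos r by (intro mult_strict_left_mono) simp_all
    ultimately show ?thesis by simp
  qed
  have xy: "x + y \<in> V" "x - y \<in> V"
    using x y by (simp_all add: csubspace_add[OF V] csubspace_diff[OF V])
  have "2 * nV (G t y) \<le> nV (G t (x + y)) + nV (G t (x - y))"
  proof -
    have "2 *\<^sub>R G t y = G t (x + y) - G t (x - y)"
      using x y by (simp add: clinear_on_add[OF lin] clinear_on_diff[OF lin] scaleR_2)
    then show ?thesis
      using banach_on_diff[OF ban C0_semigroup_in[OF sg t0 xy(1)] C0_semigroup_in[OF sg t0 xy(2)]]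
        banach_on_scaleR[OF ban C0_semigroup_in[OF sg t0 y(1)], of 2] by simp
  qed
  then have "real n + 1 < nV (G t (x + y)) \<or> real n + 1 < nV (G t (x - y))"
    using Gy by linarith
  moreover have "nV (x + y - x) \<le> r" "nV (x - y - x) \<le> r"
    using y banach_on_scaleR[OF ban y(1), of "-1"] by simp_all
  ultimately obtain x' where x': "x' \<in> V" "nV (x' - x) \<le> r" "real n + 1 < nV (G t x')"
    using xy by blast
  obtain K where K: "\<forall>x\<in>V. nV (G t x) \<le> K * nV x"
    using C0_semigroup_bound[OF sg t0] by blast
  define r' where "r' = min (r / 2) (1 / (2 * (\<bar>K\<bar> + 1)))"
  have "nV (G t z) \<le> 1" if z: "z \<in> V" "nV z \<le> 2 * r'" for z
  proof -
    have "nV (G t z) \<le> K * nV z" using K z by blast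
    also have "\<dots> \<le> (\<bar>K\<bar> + 1) * nV z"
      using banach_on_nonneg[OF ban z(1)] by (intro mult_right_mono) simp_all
    also have "\<dots> \<le> (\<bar>K\<bar> + 1) * (1 / (\<bar>K\<bar> + 1))"
    proof (rule mult_left_mono)
      have "2 * r' \<le> 2 * (1 / (2 * (\<bar>K\<bar> + 1)))"
        unfolding r'_def by (intro mult_left_mono) simp_all
      also have "\<dots> = 1 / (\<bar>K\<bar> + 1)" by (simp add: divide_simps)
      finally show "nV z \<le> 1 / (\<bar>K\<bar> + 1)" using z(2) by simp
    qed simp
    also have "\<dots> = 1" by simp
    finally show ?thesis .
  qed
  moreover have "0 < r'" "r' \<le> r / 2" using r by (simp_all add: r'_def)
  ultimately show ?thesis using t x' by fastforce
qed

text \<open>If boundedness failed on every interval \<open>{0..\<eta>}\<close>, the gliding hump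
  would yield times tending to 0 and a single point \<open>l\<close> whose images at these times are
  unbounded, against strong continuity at 0.\<close>

lemma C0_semigroup_locally_bounded:
  assumes ban: "banach_on V nV" and sg: "C0_semigroup V nV G"
  shows "\<exists>\<eta>>0. \<exists>M. \<forall>t\<in>{0..\<eta>}. \<forall>x\<in>V. nV (G t x) \<le> M * nV x"
proof (rule ccontr)
  note V = banach_on_csubspace[OF ban]
  assume "\<not> ?thesis"
  then have unb: "\<exists>t\<in>{0..\<eta>}. \<exists>x\<in>V. M * nV x < nV (G t x)" if "\<eta> > 0" for \<eta> M
    using that by (meson not_le)
  \<comment> \<open>A state is a triple of time, centre and radius, and \<open>Q n\<close> links
    consecutive states. The time of the initial state is a dummy.\<close>
  define Q where "Q n s s' \<longleftrightarrow> (case s of (t::real, x, r) \<Rightarrow> case s' of (t', x', r') \<Rightarrow>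
    0 \<le> t' \<and> t' \<le> 1 / real (Suc n) \<and> nV (x' - x) \<le> r \<and> real n + 1 < nV (G t' x') \<and>
    r' \<le> r / 2 \<and> (\<forall>z\<in>V. nV z \<le> 2 * r' \<longrightarrow> nV (G t' z) \<le> 1))" for n s s'
  have "\<exists>f. \<forall>n. (case f n of (t, x, r) \<Rightarrow> x \<in> V \<and> r > 0) \<and> Q n (f n) (f (Suc n))"
  proof (rule dependent_nat_choice)
    show "\<exists>s. case s of (t::real, x, r) \<Rightarrow> x \<in> V \<and> (r::real) > 0"
      using csubspace_0[OF V] by (intro exI[of _ "(0, 0, 1)"]) simp
    fix s :: "real \<times> 'a \<times> real" and n
    assume "case s of (t, x, r) \<Rightarrow> x \<in> V \<and> r > 0"
    moreover obtain t x r where s: "s = (t, x, r)" by (cases s)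
    ultimately have "x \<in> V" "r > 0" by simp_all
    from gliding_hump_step[OF ban sg unb this, of n]
    show "\<exists>s'. (case s' of (t, x, r) \<Rightarrow> x \<in> V \<and> r > 0) \<and> Q n s s'"
      by (auto simp: Q_def s)
  qed
  then obtain f where fQ:
    "\<forall>n. (case f n of (t, x, r) \<Rightarrow> x \<in> V \<and> r > 0) \<and> Q n (f n) (f (Suc n))" by (rule exE)
  have f: "case f n of (t, x, r) \<Rightarrow> x \<in> V \<and> r > 0" and Q: "Q n (f n) (f (Suc n))" for n
    using fQ[rule_format, of n] by (rule conjunct1, rule conjunct2)
  define t x r where "t n = fst (f n)" and "x n = fst (snd (f n))" and "r n = snd (snd (f n))" for n
  have x: "x n \<in> V" and r: "r n > 0" for n
    using f[of n] by (auto simp: x_def r_def split: prod.splits)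
  have t: "0 \<le> t (Suc n)" "t (Suc n) \<le> 1 / real (Suc n)"
    and dx: "nV (x (Suc n) - x n) \<le> r n" and big: "real n + 1 < nV (G (t (Suc n)) (x (Suc n)))"
    and r2: "r (Suc n) \<le> r n / 2"
    and small: "\<And>z. z \<in> V \<Longrightarrow> nV z \<le> 2 * r (Suc n) \<Longrightarrow> nV (G (t (Suc n)) z) \<le> 1" for n
    using Q[of n] by (auto simp: Q_def x_def r_def t_def split: prod.splits)
  \<comment> \<open>The radii at least halve, so the moves after \<open>n\<close> sum to at most
    \<open>2 * r n\<close>; the subtracted \<open>2 * r (n + k)\<close> is the slack that carries
    the induction.\<close>
  have dist: "nV (x (n + k) - x n) \<le> 2 * r n - r (n + k) - r (n + k)" for n k
  proof (induction k)
    case 0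
    then show ?case using banach_on_eq_0[OF ban csubspace_0[OF V]] by simp
  next
    case (Suc k)
    have "nV (x (n + Suc k) - x n) \<le> nV (x (Suc (n + k)) - x (n + k)) + nV (x (n + k) - x n)"
      using banach_on_add[OF ban csubspace_diff[OF V x x] csubspace_diff[OF V x x],
          of "Suc (n + k)" "n + k" "n + k" n] by simp
    then show ?case using Suc dx[of "n + k"] r2[of "n + k"] by simp
  qed
  have r_le: "r n \<le> r 0 / 2 ^ n" for n
  proof (induction n)
    case (Suc n)
    then show ?case using r2[of n] by simp
  qed simp
  have dist': "nV (x m - x n) \<le> 2 * r n" if "n \<le> m" for m n
    using dist[of n "m - n"] r[of m] that by simp
  have r0: "(\<lambda>n. r 0 / 2 ^ n) \<longlonglongrightarrow> 0"
    using LIMSEQ_divide_realpow_zero[of 2 "r 0"] by simp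
  have "\<exists>l\<in>V. (\<lambda>n. nV (x n - l)) \<longlonglongrightarrow> 0"
  proof (rule banach_on_complete[OF ban x])
    fix e :: real assume "e > 0"
    then obtain M where M: "r 0 / 2 ^ M < e / 4"
      using order_tendstoD(2)[OF r0, of "e / 4"] by (auto simp: eventually_sequentially)
    have "nV (x m - x n) < e" if "m \<ge> M" "n \<ge> M" for m n
    proof -
      have "nV (x m - x n) \<le> nV (x m - x M) + nV (x n - x M)"
        using banach_on_diff[OF ban csubspace_diff[OF V x x] csubspace_diff[OF V x x],
          of m M n M] by simp
      also have "\<dots> \<le> 4 * r M" using dist'[OF that(1)] dist'[OF that(2)] by simp
      also have "\<dots> < e" using r_le[of M] M by linarith
      finally show ?thesis .
    qed
    then show "\<exists>M. \<forall>m\<ge>M. \<forall>n\<ge>M. nV (x m - x n) < e" by blast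
  qed
  then obtain l where l: "l \<in> V" and lim: "(\<lambda>n. nV (x n - l)) \<longlonglongrightarrow> 0" by blast
  have dl: "nV (x n - l) \<le> 2 * r n" for n
  proof (rule field_le_epsilon)
    fix e :: real assume "e > 0"
    then obtain m where m: "m \<ge> n" "nV (x m - l) < e"
      using order_tendstoD(2)[OF lim, of e] unfolding eventually_sequentially
      by (meson nle_le)
    have "nV (x n - l) \<le> nV (x m - l) + nV (x m - x n)"
      using banach_on_diff[OF ban csubspace_diff[OF V x l] csubspace_diff[OF V x x],
          of m m n] by simp
    then show "nV (x n - l) \<le> 2 * r n + e" using m dist'[of n m] by simp
  qed
  \<comment> \<open>Passing from \<open>x (Suc n)\<close> to the limit \<open>l\<close> changes the
    image by at most 1, by the choice of the radius.\<close>
  have "real n \<le> nV (G (t (Suc n)) l)" for n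
  proof -
    let ?G = "G (t (Suc n))"
    note lin = C0_semigroup_clinear[OF sg t(1)]
    have d: "x (Suc n) - l \<in> V" using x l csubspace_diff[OF V] by blast
    have "nV (?G (x (Suc n))) \<le> nV (?G (x (Suc n) - l)) + nV (?G l)"
      using banach_on_add[OF ban C0_semigroup_in[OF sg t(1) d] C0_semigroup_in[OF sg t(1) l], of n n]
      by (simp add: clinear_on_diff[OF lin x l])
    moreover have "nV (?G (x (Suc n) - l)) \<le> 1"
      using small[OF d dl] .
    ultimately show ?thesis using big[of n] by simp
  qed
  then have n_le: "real n \<le> nV (G (t (Suc n)) l - l) + nV l" for n
    using banach_on_add[OF ban csubspace_diff[OF V C0_semigroup_in[OF sg t(1) l] l] l, of n]
    by (metis (no_types, lifting) diff_add_cancel order_trans)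
  obtain b where b: "b > 0" "\<And>s. 0 < s \<Longrightarrow> s < b \<Longrightarrow> nV (G s l - l) < 1"
    using order_tendstoD(2)[OF C0_semigroup_lim[OF sg l], of 1]
    by (auto simp: eventually_at_right_field)
  obtain n :: nat where n: "real n > 1 / b + nV l + 1" using reals_Archimedean2 by blast
  have "1 / b < real (Suc n)" using n banach_on_nonneg[OF ban l] by simp
  then have "1 / real (Suc n) < b" using b(1) by (simp add: field_simps)
  then have "t (Suc n) < b" using t(2)[of n] by linarith
  then have "nV (G (t (Suc n)) l - l) < 1"
    using b t(1)[of n] C0_semigroup_0[OF sg l] banach_on_eq_0[OF ban csubspace_0[OF V]]
    by (cases "t (Suc n) = 0") auto
  then have "real n < nV l + 1" using n_le[of n] by linarith
  then show False using n b(1) by (smt (verit) divide_pos_pos)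
qed

text \<open>Write \<open>t\<close> as \<open>k\<close> steps of length \<open>\<eta>\<close> and a
  remainder: each step and the remainder cost a factor \<open>M\<close>, and
  \<open>M ^ k \<le> exp (\<omega> * t)\<close> for \<open>\<omega> = ln M / \<eta>\<close>.\<close>

lemma C0_semigroup_growth_bound:
  assumes ban: "banach_on V nV" and sg: "C0_semigroup V nV G"
  shows "\<exists>M\<ge>1. \<exists>\<omega>\<ge>0. \<forall>t\<ge>0. \<forall>x\<in>V. nV (G t x) \<le> M * exp (\<omega> * t) * nV x"
proof -
  obtain \<eta> M0 where \<eta>: "\<eta> > 0" and M0: "\<And>t x. t \<in> {0..\<eta>} \<Longrightarrow> x \<in> V \<Longrightarrow> nV (G t x) \<le> M0 * nV x"
    using C0_semigroup_locally_bounded[OF assms] by blast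
  \<comment> \<open>With \<open>M \<ge> 1\<close> the logarithm is nonnegative, so that rounding
    \<open>t / \<eta>\<close> down is harmless and \<open>\<omega> \<ge> 0\<close>.\<close>
  define M where "M = max M0 1"
  have M1: "M \<ge> 1" by (simp add: M_def)
  have M: "nV (G t x) \<le> M * nV x" if "t \<in> {0..\<eta>}" "x \<in> V" for t x
    using M0[OF that] banach_on_nonneg[OF ban that(2)]
    by (smt (verit) M_def mult_right_mono)
  have pow: "nV (G (real k * \<eta>) x) \<le> M ^ k * nV x" if "x \<in> V" for k x
    using that
  proof (induction k)
    case 0
    then show ?case by (simp add: C0_semigroup_0[OF sg])
  next
    case (Suc k)
    have "G (real (Suc k) * \<eta>) x = G \<eta> (G (real k * \<eta>) x)"
      using C0_semigroup_add[OF sg, of \<eta> "real k * \<eta>" x] \<eta> Suc.prems by (simp add: algebra_simps)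
    also have "nV \<dots> \<le> M * nV (G (real k * \<eta>) x)"
      using \<eta> Suc.prems by (intro M) (auto intro!: C0_semigroup_in[OF sg])
    also have "\<dots> \<le> M * (M ^ k * nV x)" using Suc M1 by (intro mult_left_mono) auto
    finally show ?case by simp
  qed
  define \<omega> where "\<omega> = ln M / \<eta>"
  have "nV (G t x) \<le> M * exp (\<omega> * t) * nV x" if t: "t \<ge> 0" and x: "x \<in> V" for t x
  proof -
    define k where "k = nat \<lfloor>t / \<eta>\<rfloor>"
    have k: "real k \<le> t / \<eta>" "t / \<eta> < real k + 1"
      using t \<eta> by (simp_all add: k_def)
    then have k': "real k * \<eta> \<le> t" "t - real k * \<eta> \<le> \<eta>"
      using \<eta> by (simp_all add: field_simps)
    have "G t x = G (t - real k * \<eta>) (G (real k * \<eta>) x)"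
      using C0_semigroup_add[OF sg, of "t - real k * \<eta>" "real k * \<eta>" x] k' \<eta> x by simp
    also have "nV \<dots> \<le> M * nV (G (real k * \<eta>) x)"
      using k' \<eta> x by (intro M) (auto intro!: C0_semigroup_in[OF sg])
    also have "\<dots> \<le> M * (M ^ k * nV x)" using pow[OF x] M1 by (intro mult_left_mono) auto
    also have "\<dots> \<le> M * (exp (\<omega> * t) * nV x)"
    proof -
      have "M ^ k = exp (real k * ln M)" using M1 by (simp add: exp_of_nat_mult)
      also have "\<dots> \<le> exp (t / \<eta> * ln M)" using mult_right_mono[OF k(1), of "ln M"] M1 by simp
      also have "t / \<eta> * ln M = \<omega> * t" by (simp add: \<omega>_def)
      finally have "M ^ k \<le> exp (\<omega> * t)" .
      then show ?thesis using M1 banach_on_nonneg[OF ban x]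
        by (intro mult_left_mono mult_right_mono) auto
    qed
    finally show ?thesis by (simp add: mult.assoc)
  qed
  moreover have "\<omega> \<ge> 0" using M1 \<eta> by (simp add: \<omega>_def)
  ultimately show ?thesis using M1 by blast
qed

section \<open>Quasi-contractive semigroups\<close>

text \<open>After a change of norm, every strongly continuous semigroup satisfies
  \<open>q (G t x) \<le> exp (\<omega> * t) * q x\<close> without a constant. Everything about generators that is
  needed then follows from telescoping sums, without integrals.\<close>

locale quasi_contractive_semigroup =
  fixes V :: "'a::complex_vector set" and q :: "'a \<Rightarrow> real" and G :: "real \<Rightarrow> 'a \<Rightarrow> 'a" and \<omega> :: real
  assumes csubspace: "csubspace V"
    and q_nonneg: "\<And>x. x \<in> V \<Longrightarrow> 0 \<le> q x"
    and q_add: "\<And>x y. x \<in> V \<Longrightarrow> y \<in> V \<Longrightarrow> q (x + y) \<le> q x + q y"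
    and q_scaleR: "\<And>r x. x \<in> V \<Longrightarrow> q (r *\<^sub>R x) = \<bar>r\<bar> * q x"
    and G_clinear: "\<And>t. t \<ge> 0 \<Longrightarrow> clinear_on V (G t)"
    and G_in: "\<And>t x. t \<ge> 0 \<Longrightarrow> x \<in> V \<Longrightarrow> G t x \<in> V"
    and G_0: "\<And>x. x \<in> V \<Longrightarrow> G 0 x = x"
    and G_plus: "\<And>s t x. s \<ge> 0 \<Longrightarrow> t \<ge> 0 \<Longrightarrow> x \<in> V \<Longrightarrow> G (s + t) x = G s (G t x)"
    and q_G: "\<And>t x. t \<ge> 0 \<Longrightarrow> x \<in> V \<Longrightarrow> q (G t x) \<le> exp (\<omega> * t) * q x"
    and omega: "\<omega> \<ge> 0"
begin

lemmas V_0 = csubspace_0[OF csubspace]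
  and V_add = csubspace_add[OF csubspace]
  and V_diff = csubspace_diff[OF csubspace]
  and V_scaleR = csubspace_scaleR[OF csubspace]
  and G_diff = clinear_on_diff[OF G_clinear]
  and G_add = clinear_on_add[OF G_clinear]
  and G_scaleR = clinear_on_scaleR[OF G_clinear]

lemmas V_intros = V_0 V_add V_diff V_scaleR G_in

lemma q_0: "q 0 = 0"
  using q_scaleR[OF V_0, of 0] by simp

lemma q_diff: "x \<in> V \<Longrightarrow> y \<in> V \<Longrightarrow> q (x - y) \<le> q x + q y"
  using q_add[of x "(-1) *\<^sub>R y"] q_scaleR[of y "-1"] V_scaleR[of y "-1"] by simp

lemma q_diff_commute: "x \<in> V \<Longrightarrow> y \<in> V \<Longrightarrow> q (x - y) = q (y - x)"
  using q_scaleR[of "x - y" "-1"] V_diff[of x y] by simp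

lemma exp_omega_mono: "s \<le> t \<Longrightarrow> exp (\<omega> * s) \<le> exp (\<omega> * t)"
  using omega by (simp add: mult_left_mono)

lemma exp_omega_ge_1: "0 \<le> t \<Longrightarrow> 1 \<le> exp (\<omega> * t)"
  using exp_omega_mono[of 0 t] by simp

text \<open>The vector \<open>(l + 1 / h) x\<close> differs from
  \<open>(l x - y) + (1 / h) G h x\<close> by the error of the difference quotient,
  \<open>q (G h x)\<close> is at most \<open>exp (\<omega> * h) * q x\<close>, and
  \<open>(1 - exp (\<omega> * h)) / h\<close> tends to \<open>- \<omega>\<close>. This dissipativity
  replaces the Laplace transform: it bounds resolvents and makes \<open>l\<close> minus the
  generator injective.\<close>

lemma generator_dissipative:
  assumes lim: "generator_limit q G x y" and x: "x \<in> V" and y: "y \<in> V" and "l \<ge> 0"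
  shows "(l - \<omega>) * q x \<le> q (l *\<^sub>R x - y)"
proof -
  have "((\<lambda>h. (l + (1 - exp (\<omega> * h)) / h) * q x - q ((1 / h) *\<^sub>R (G h x - x) - y)) \<longlongrightarrow>
      (l + - \<omega>) * q x - 0) (at_right 0)"
  proof (intro tendsto_intros)
    have "((\<lambda>h. exp (\<omega> * h)) has_real_derivative \<omega>) (at 0)"
      by (auto intro!: derivative_eq_intros)
    then have "((\<lambda>h. (exp (\<omega> * h) - 1) / h) \<longlongrightarrow> \<omega>) (at_right 0)"
      unfolding has_field_derivative_iff
      by (simp add: filterlim_at_split)
    then have "((\<lambda>h. - ((exp (\<omega> * h) - 1) / h)) \<longlongrightarrow> - \<omega>) (at_right 0)"
      by (rule tendsto_minus)
    then show "((\<lambda>h. (1 - exp (\<omega> * h)) / h) \<longlongrightarrow> - \<omega>) (at_right 0)"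
      by (simp add: minus_divide_left)
  qed (use lim in \<open>simp add: generator_limit_def\<close>)
  moreover have "\<forall>\<^sub>F h in at_right 0. (l + (1 - exp (\<omega> * h)) / h) * q x
      - q ((1 / h) *\<^sub>R (G h x - x) - y) \<le> q (l *\<^sub>R x - y)"
    unfolding eventually_at_filter
  proof (intro always_eventually allI impI)
    fix h :: real assume "h \<in> {0<..}"
    then have h: "h > 0" by simp
    define d where "d = (1 / h) *\<^sub>R (G h x - x) - y"
    have d: "d \<in> V" using x y h by (simp add: d_def V_intros)
    have ly: "l *\<^sub>R x - y \<in> V" using x y by (simp add: V_intros)
    have "(l + 1 / h) *\<^sub>R x - (1 / h) *\<^sub>R G h x = (l *\<^sub>R x - y) - d"
      by (simp add: d_def algebra_simps)
    then have "q ((l + 1 / h) *\<^sub>R x - (1 / h) *\<^sub>R G h x) \<le> q (l *\<^sub>R x - y) + q d"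
      using q_diff[OF ly d] by simp
    moreover have "q ((l + 1 / h) *\<^sub>R x)
        \<le> q ((l + 1 / h) *\<^sub>R x - (1 / h) *\<^sub>R G h x) + q ((1 / h) *\<^sub>R G h x)"
      using q_add[of "(l + 1 / h) *\<^sub>R x - (1 / h) *\<^sub>R G h x" "(1 / h) *\<^sub>R G h x"] x h
      by (simp add: V_intros)
    moreover have "q ((l + 1 / h) *\<^sub>R x) = (l + 1 / h) * q x"
      using x h \<open>l \<ge> 0\<close> by (simp add: q_scaleR)
    moreover have "q ((1 / h) *\<^sub>R G h x) \<le> (1 / h) * (exp (\<omega> * h) * q x)"
      using x h q_G[of h x] by (simp add: q_scaleR V_intros divide_right_mono)
    ultimately have "(l + 1 / h) * q x - (1 / h) * (exp (\<omega> * h) * q x) - q d \<le> q (l *\<^sub>R x - y)"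
      by linarith
    moreover have "(l + (1 - exp (\<omega> * h)) / h) * q x
        = (l + 1 / h) * q x - (1 / h) * (exp (\<omega> * h) * q x)"
      by (simp add: algebra_simps diff_divide_distrib)
    ultimately show "(l + (1 - exp (\<omega> * h)) / h) * q x - q ((1 / h) *\<^sub>R (G h x - x) - y)
        \<le> q (l *\<^sub>R x - y)"
      by (simp add: d_def)
  qed
  ultimately show ?thesis
    using tendsto_upperbound[OF _ _ trivial_limit_at_right_real] by fastforce
qed

text \<open>Stands in for writing \<open>G h x - x\<close> as the integral of \<open>G s y\<close>.
  Cut \<open>{0..h}\<close> into \<open>n\<close> pieces of length \<open>d\<close>: each
  contributes the first order error of \<open>x\<close>, transported by the semigroup, and
  \<open>d\<close> times a deviation \<open>G s y - y\<close>. The former add up to a multiple of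
  \<open>n * a n\<close>, which tends to 0 because \<open>x\<close> lies in the domain of the
  generator.\<close>

lemma taylor_estimate_uniform:
  assumes lim: "generator_limit q G x y" and x: "x \<in> V" and y: "y \<in> V" and h: "h \<ge> 0"
    and K: "\<And>s. 0 \<le> s \<Longrightarrow> s \<le> h \<Longrightarrow> q (G s y - y) \<le> K"
  shows "q (G h x - x - h *\<^sub>R y) \<le> h * K"
proof (cases "h = 0")
  case True
  then show ?thesis using x by (simp add: G_0 q_0)
next
  case False
  with h have h: "h > 0" by simp
  define a where "a n = q (G (h / real n) x - x - (h / real n) *\<^sub>R y)" for n
  have bound: "q (G h x - x - h *\<^sub>R y) \<le> real n * exp (\<omega> * h) * a n + h * K" if n: "n > 0" for n
  proof -
    define d where "d = h / real n"
    have d: "d > 0" using h n by (simp add: d_def)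
    have "q (G (real k * d) x - x - (real k * d) *\<^sub>R y) \<le> real k * (exp (\<omega> * h) * a n + d * K)"
      if "k \<le> n" for k
      using that
    proof (induction k)
      case 0
      then show ?case using x by (simp add: G_0 q_0)
    next
      case (Suc k)
      have kd: "0 \<le> real k * d" "real k * d \<le> h"
        using Suc.prems d n h by (simp_all add: d_def field_simps)
      let ?k = "real k * d"
      have Vs: "G d x - x - d *\<^sub>R y \<in> V" "G ?k y - y \<in> V" "G ?k x - x - ?k *\<^sub>R y \<in> V"
        using x y kd d by (simp_all add: V_intros)
      have "G (real (Suc k) * d) x = G ?k (G d x)"
        using G_plus[of ?k d x] kd d x by (simp add: algebra_simps)
      then have eq: "G (real (Suc k) * d) x - x - (real (Suc k) * d) *\<^sub>R y =
          (G ?k (G d x - x - d *\<^sub>R y) + d *\<^sub>R (G ?k y - y)) + (G ?k x - x - ?k *\<^sub>R y)"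
        using kd d x y by (simp add: G_diff G_add G_scaleR V_intros algebra_simps)
      have "q (G (real (Suc k) * d) x - x - (real (Suc k) * d) *\<^sub>R y) \<le>
          q (G ?k (G d x - x - d *\<^sub>R y) + d *\<^sub>R (G ?k y - y)) + q (G ?k x - x - ?k *\<^sub>R y)"
        unfolding eq using Vs kd by (intro q_add) (simp_all add: V_intros)
      also have "q (G ?k (G d x - x - d *\<^sub>R y) + d *\<^sub>R (G ?k y - y)) \<le>
          q (G ?k (G d x - x - d *\<^sub>R y)) + q (d *\<^sub>R (G ?k y - y))"
        using Vs kd by (intro q_add) (simp_all add: V_intros)
      also have "q (G ?k (G d x - x - d *\<^sub>R y)) \<le> exp (\<omega> * ?k) * a n"
        using q_G[OF kd(1) Vs(1)] by (simp add: a_def d_def)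
      also have "exp (\<omega> * ?k) * a n \<le> exp (\<omega> * h) * a n"
        using kd Vs(1) by (intro mult_right_mono exp_omega_mono) (simp_all add: a_def q_nonneg d_def)
      also have "q (d *\<^sub>R (G ?k y - y)) \<le> d * K"
        using d K[OF kd] Vs(2) by (simp add: q_scaleR mult_left_mono)
      also have "q (G ?k x - x - ?k *\<^sub>R y) \<le> real k * (exp (\<omega> * h) * a n + d * K)"
        using Suc by simp
      finally show ?case by (simp add: algebra_simps)
    qed
    from this[of n] show ?thesis using n by (simp add: d_def algebra_simps)
  qed
  have lim_h: "filterlim (\<lambda>n. h / real n) (at_right 0) sequentially"
    unfolding filterlim_at
  proof
    show "(\<lambda>n. h / real n) \<longlonglongrightarrow> 0" by (rule lim_const_over_n)
    show "\<forall>\<^sub>F n in sequentially. h / real n \<in> {0<..} \<and> h / real n \<noteq> 0"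
      using eventually_gt_at_top[of 0] by eventually_elim (use h in auto)
  qed
  have "(\<lambda>n. q ((1 / (h / real n)) *\<^sub>R (G (h / real n) x - x) - y)) \<longlonglongrightarrow> 0"
    using filterlim_compose[OF lim[unfolded generator_limit_def] lim_h] .
  then have "(\<lambda>n. exp (\<omega> * h) * (h * q ((1 / (h / real n)) *\<^sub>R (G (h / real n) x - x) - y)) + h * K)
      \<longlonglongrightarrow> exp (\<omega> * h) * (h * 0) + h * K"
    by (intro tendsto_intros)
  moreover have "\<forall>\<^sub>F n in sequentially. q (G h x - x - h *\<^sub>R y) \<le>
      exp (\<omega> * h) * (h * q ((1 / (h / real n)) *\<^sub>R (G (h / real n) x - x) - y)) + h * K"
    using eventually_gt_at_top[of 0]
  proof eventually_elim
    fix n :: nat assume n: "n > 0"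
    have "G (h / real n) x - x - (h / real n) *\<^sub>R y =
        (h / real n) *\<^sub>R ((1 / (h / real n)) *\<^sub>R (G (h / real n) x - x) - y)"
      using n h by (simp add: scaleR_diff_right)
    then have "a n = (h / real n) * q ((1 / (h / real n)) *\<^sub>R (G (h / real n) x - x) - y)"
      unfolding a_def using n h x y by (simp add: q_scaleR V_intros del: scaleR_diff_right)
    then have "real n * a n = h * q ((1 / (h / real n)) *\<^sub>R (G (h / real n) x - x) - y)"
      using n by simp
    then show "q (G h x - x - h *\<^sub>R y) \<le>
        exp (\<omega> * h) * (h * q ((1 / (h / real n)) *\<^sub>R (G (h / real n) x - x) - y)) + h * K"
      using bound[OF n] by (metis mult.assoc mult.commute)
  qed
  ultimately show ?thesis
    using tendsto_lowerbound[OF _ _ sequentially_bot] by fastforce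
qed

text \<open>The crude bound \<open>(exp (\<omega> * h) + 1) * q z\<close> for
  \<open>G s z - z\<close> goes into the Taylor estimate; adding the linear term \<open>h z\<close>
  gives \<open>exp (\<omega> * h) + 2\<close>, which is rounded up to
  \<open>3 * exp (\<omega> * h)\<close>.\<close>

lemma increment_estimate:
  assumes lim: "generator_limit q G y z" and y: "y \<in> V" and z: "z \<in> V" and h: "h \<ge> 0"
  shows "q (G h y - y) \<le> h * (3 * exp (\<omega> * h) * q z)"
proof -
  have "q (G s z - z) \<le> (exp (\<omega> * h) + 1) * q z" if "0 \<le> s" "s \<le> h" for s
  proof -
    have "q (G s z - z) \<le> exp (\<omega> * s) * q z + q z"
      using q_diff[OF G_in[OF that(1) z] z] q_G[OF that(1) z] by simp
    also have "\<dots> \<le> exp (\<omega> * h) * q z + q z"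
      using mult_right_mono[OF exp_omega_mono[OF that(2)] q_nonneg[OF z]] by simp
    finally show ?thesis by (simp add: algebra_simps)
  qed
  then have "q (G h y - y - h *\<^sub>R z) \<le> h * ((exp (\<omega> * h) + 1) * q z)"
    by (rule taylor_estimate_uniform[OF assms])
  moreover have "q (G h y - y) \<le> q (G h y - y - h *\<^sub>R z) + q (h *\<^sub>R z)"
    using q_add[of "G h y - y - h *\<^sub>R z" "h *\<^sub>R z"] y z h by (simp add: V_intros)
  moreover have "q (h *\<^sub>R z) = h * q z" using z h by (simp add: q_scaleR)
  ultimately have "q (G h y - y) \<le> h * ((exp (\<omega> * h) + 2) * q z)" by (simp add: algebra_simps)
  also have "\<dots> \<le> h * ((3 * exp (\<omega> * h)) * q z)"
    using h exp_omega_ge_1[OF h] q_nonneg[OF z] by (intro mult_left_mono mult_right_mono) auto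
  finally show ?thesis .
qed

text \<open>The error becomes quadratic because the deviation of \<open>y\<close> is itself of order
  \<open>h\<close> once \<open>y\<close> lies in the domain of the generator.\<close>

lemma taylor_estimate:
  assumes x: "generator_limit q G x y" "x \<in> V" and y: "generator_limit q G y z" "y \<in> V"
    and z: "z \<in> V" and h: "h \<ge> 0"
  shows "q (G h x - x - h *\<^sub>R y) \<le> h\<^sup>2 * (3 * exp (\<omega> * h) * q z)"
proof -
  have "q (G s y - y) \<le> h * (3 * exp (\<omega> * h) * q z)" if "0 \<le> s" "s \<le> h" for s
  proof -
    have "q (G s y - y) \<le> s * (3 * exp (\<omega> * s) * q z)"
      by (rule increment_estimate[OF y z that(1)])
    also have "\<dots> \<le> h * (3 * exp (\<omega> * h) * q z)"
      using that q_nonneg[OF z] omega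
      by (intro mult_mono mult_right_mono) (auto simp: mult_left_mono)
    finally show ?thesis .
  qed
  then show ?thesis
    using taylor_estimate_uniform[OF x(1,2) y(2) h] by (simp add: power2_eq_square mult.assoc)
qed

text \<open>The increment over \<open>t - s\<close> is transported by \<open>G s\<close>, so two
  exponentials up to time \<open>\<tau>\<close> multiply; hence the exponent
  \<open>2 * \<omega> * \<tau>\<close>.\<close>

lemma orbit_lipschitz:
  assumes y: "generator_limit q G y z" "y \<in> V" and z: "z \<in> V"
    and st: "0 \<le> s" "s \<le> \<tau>" "0 \<le> t" "t \<le> \<tau>"
  shows "q (G t y - G s y) \<le> \<bar>t - s\<bar> * (3 * exp (2 * \<omega> * \<tau>) * q z)"
proof -
  have *: "q (G t y - G s y) \<le> (t - s) * (3 * exp (2 * \<omega> * \<tau>) * q z)"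
    if st: "0 \<le> s" "s \<le> t" "t \<le> \<tau>" for s t
  proof -
    have "G t y = G s (G (t - s) y)" using G_plus[of s "t - s" y] st y by simp
    then have "q (G t y - G s y) = q (G s (G (t - s) y - y))"
      using st y by (simp add: G_diff V_intros)
    also have "\<dots> \<le> exp (\<omega> * s) * q (G (t - s) y - y)"
      using st y by (intro q_G) (simp_all add: V_intros)
    also have "\<dots> \<le> exp (\<omega> * \<tau>) * ((t - s) * (3 * exp (\<omega> * \<tau>) * q z))"
    proof (intro mult_mono exp_omega_mono)
      have "q (G (t - s) y - y) \<le> (t - s) * (3 * exp (\<omega> * (t - s)) * q z)"
        using st by (intro increment_estimate[OF y z]) simp
      also have "\<dots> \<le> (t - s) * (3 * exp (\<omega> * \<tau>) * q z)"
        using st q_nonneg[OF z] by (intro mult_left_mono mult_right_mono exp_omega_mono) auto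
      finally show "q (G (t - s) y - y) \<le> (t - s) * (3 * exp (\<omega> * \<tau>) * q z)" .
    qed (use st y in \<open>simp_all add: q_nonneg V_intros\<close>)
    also have "\<dots> = (t - s) * (3 * (exp (\<omega> * \<tau>) * exp (\<omega> * \<tau>)) * q z)" by simp
    also have "exp (\<omega> * \<tau>) * exp (\<omega> * \<tau>) = exp (2 * \<omega> * \<tau>)"
      by (simp add: mult_exp_exp)
    finally show ?thesis .
  qed
  show ?thesis
  proof (cases "s \<le> t")
    case True
    then show ?thesis using *[of s t] st by simp
  next
    case False
    then show ?thesis using *[of t s] st q_diff_commute[of "G t y" "G s y"] y by (simp add: V_intros)
  qed
qed

text \<open>Two-sided, as is needed for derivatives within a closed interval. For
  \<open>t < s\<close> the expansion is made at \<open>t\<close>, and \<open>G t y\<close> is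
  exchanged for \<open>G s y\<close> at a Lipschitz cost, which doubles the constant 3 to 6.\<close>

lemma orbit_taylor:
  assumes x: "generator_limit q G x y" "x \<in> V" and y: "generator_limit q G y z" "y \<in> V"
    and z: "z \<in> V" and st: "0 \<le> s" "s \<le> \<tau>" "0 \<le> t" "t \<le> \<tau>"
  shows "q (G t x - G s x - (t - s) *\<^sub>R G s y) \<le> (t - s)\<^sup>2 * (6 * exp (2 * \<omega> * \<tau>) * q z)"
proof -
  have *: "q (G t x - G s x - (t - s) *\<^sub>R G s y) \<le> (t - s)\<^sup>2 * (3 * exp (2 * \<omega> * \<tau>) * q z)"
    if st: "0 \<le> s" "s \<le> t" "t \<le> \<tau>" for s t
  proof -
    have "G t x = G s (G (t - s) x)" using G_plus[of s "t - s" x] st x by simp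
    then have "q (G t x - G s x - (t - s) *\<^sub>R G s y) = q (G s (G (t - s) x - x - (t - s) *\<^sub>R y))"
      using st x y by (simp add: G_diff G_scaleR V_intros)
    also have "\<dots> \<le> exp (\<omega> * s) * q (G (t - s) x - x - (t - s) *\<^sub>R y)"
      using st x y by (intro q_G) (simp_all add: V_intros)
    also have "\<dots> \<le> exp (\<omega> * \<tau>) * ((t - s)\<^sup>2 * (3 * exp (\<omega> * \<tau>) * q z))"
    proof (intro mult_mono exp_omega_mono)
      have "q (G (t - s) x - x - (t - s) *\<^sub>R y) \<le> (t - s)\<^sup>2 * (3 * exp (\<omega> * (t - s)) * q z)"
        using st by (intro taylor_estimate[OF x y z]) simp
      also have "\<dots> \<le> (t - s)\<^sup>2 * (3 * exp (\<omega> * \<tau>) * q z)"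
        using st q_nonneg[OF z] by (intro mult_left_mono mult_right_mono exp_omega_mono) auto
      finally show "q (G (t - s) x - x - (t - s) *\<^sub>R y) \<le> (t - s)\<^sup>2 * (3 * exp (\<omega> * \<tau>) * q z)" .
    qed (use st x y in \<open>simp_all add: q_nonneg V_intros\<close>)
    also have "\<dots> = (t - s)\<^sup>2 * (3 * (exp (\<omega> * \<tau>) * exp (\<omega> * \<tau>)) * q z)" by simp
    also have "exp (\<omega> * \<tau>) * exp (\<omega> * \<tau>) = exp (2 * \<omega> * \<tau>)"
      by (simp add: mult_exp_exp)
    finally show ?thesis .
  qed
  show ?thesis
  proof (cases "s \<le> t")
    case True
    have "(t - s)\<^sup>2 * (3 * exp (2 * \<omega> * \<tau>) * q z) \<le> (t - s)\<^sup>2 * (6 * exp (2 * \<omega> * \<tau>) * q z)"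
      using q_nonneg[OF z] by (intro mult_left_mono mult_right_mono) auto
    then show ?thesis using *[of s t] True st by linarith
  next
    case False
    have Vs: "G s x - G t x - (s - t) *\<^sub>R G t y \<in> V" "(s - t) *\<^sub>R (G s y - G t y) \<in> V"
      using st x y by (simp_all add: V_intros)
    have eq: "G t x - G s x - (t - s) *\<^sub>R G s y =
        (s - t) *\<^sub>R (G s y - G t y) - (G s x - G t x - (s - t) *\<^sub>R G t y)"
      by (simp add: algebra_simps)
    have "q (G t x - G s x - (t - s) *\<^sub>R G s y) \<le>
        q ((s - t) *\<^sub>R (G s y - G t y)) + q (G s x - G t x - (s - t) *\<^sub>R G t y)"
      unfolding eq by (rule q_diff[OF Vs(2,1)])
    also have "q ((s - t) *\<^sub>R (G s y - G t y)) = (s - t) * q (G s y - G t y)"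
      using False st y by (subst q_scaleR) (simp_all add: V_intros)
    also have "\<dots> \<le> (s - t) * (\<bar>s - t\<bar> * (3 * exp (2 * \<omega> * \<tau>) * q z))"
      using False st by (intro mult_left_mono orbit_lipschitz[OF y z]) auto
    also have "\<dots> = (t - s)\<^sup>2 * (3 * exp (2 * \<omega> * \<tau>) * q z)"
      using False by (simp add: power2_eq_square algebra_simps)
    also have "q (G s x - G t x - (s - t) *\<^sub>R G t y) \<le> (t - s)\<^sup>2 * (3 * exp (2 * \<omega> * \<tau>) * q z)"
      using *[of t s] False st by (simp add: power2_commute)
    finally show ?thesis by linarith
  qed
qed

text \<open>The Taylor estimate for \<open>u n\<close> involves only \<open>G s (v n) - v n\<close>,
  hence it survives the limit and gives \<open>q (G h x - x - h y) \<le> h * K\<close>; strong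
  continuity at \<open>y\<close> makes \<open>K\<close> small for small \<open>h\<close>.\<close>

lemma generator_limit_closed:
  assumes x: "\<And>n. u n \<in> V" "x \<in> V" "(\<lambda>n. q (u n - x)) \<longlonglongrightarrow> 0"
    and y: "\<And>n. v n \<in> V" "y \<in> V" "(\<lambda>n. q (v n - y)) \<longlonglongrightarrow> 0"
    and lim: "\<And>n. generator_limit q G (u n) (v n)"
    and cont: "((\<lambda>h. q (G h y - y)) \<longlongrightarrow> 0) (at_right 0)"
  shows "generator_limit q G x y"
proof -
  have bound: "q (G h x - x - h *\<^sub>R y) \<le> h * K"
    if h: "h \<ge> 0" and K: "\<And>s. 0 \<le> s \<Longrightarrow> s \<le> h \<Longrightarrow> q (G s y - y) \<le> K" for h K
  proof -
    let ?e = "exp (\<omega> * h) + 1"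
    have Gdiff: "q (G s z - z) \<le> ?e * q z" if "0 \<le> s" "s \<le> h" "z \<in> V" for s z
    proof -
      have "q (G s z - z) \<le> exp (\<omega> * s) * q z + q z"
        using q_diff[OF G_in[OF that(1,3)] that(3)] q_G[OF that(1,3)] by simp
      also have "\<dots> \<le> exp (\<omega> * h) * q z + q z"
        using mult_right_mono[OF exp_omega_mono[OF that(2)] q_nonneg[OF that(3)]] by simp
      finally show ?thesis by (simp add: algebra_simps)
    qed
    have "q (G h x - x - h *\<^sub>R y) \<le> ?e * q (u n - x) + h * q (v n - y) + h * (?e * q (v n - y) + K)"
      for n
    proof -
      have Vs: "u n - x \<in> V" "v n - y \<in> V" using x y by (simp_all add: V_intros)
      have "q (G s (v n) - v n) \<le> ?e * q (v n - y) + K" if s: "0 \<le> s" "s \<le> h" for s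
      proof -
        have eq: "G s (v n) - v n = (G s (v n - y) - (v n - y)) + (G s y - y)"
          using s x y by (simp add: G_diff)
        have "q (G s (v n) - v n) \<le> q (G s (v n - y) - (v n - y)) + q (G s y - y)"
          unfolding eq using s x y by (intro q_add) (simp_all add: V_intros)
        then show ?thesis using Gdiff[OF s Vs(2)] K[OF s] by simp
      qed
      from taylor_estimate_uniform[OF lim x(1) y(1) h this]
      have 1: "q (G h (u n) - u n - h *\<^sub>R v n) \<le> h * (?e * q (v n - y) + K)" .
      have eq: "G h x - x - h *\<^sub>R y =
          (G h (u n) - u n - h *\<^sub>R v n) - ((G h (u n - x) - (u n - x)) - h *\<^sub>R (v n - y))"
        using h x y by (simp add: G_diff algebra_simps)
      have "q (G h x - x - h *\<^sub>R y) \<le>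
          q (G h (u n) - u n - h *\<^sub>R v n) + q ((G h (u n - x) - (u n - x)) - h *\<^sub>R (v n - y))"
        unfolding eq using h x y by (intro q_diff) (simp_all add: V_intros)
      moreover have "q ((G h (u n - x) - (u n - x)) - h *\<^sub>R (v n - y)) \<le>
          q (G h (u n - x) - (u n - x)) + q (h *\<^sub>R (v n - y))"
        using h Vs by (intro q_diff) (simp_all add: V_intros)
      moreover have "q (h *\<^sub>R (v n - y)) = h * q (v n - y)"
        using h Vs by (simp add: q_scaleR del: scaleR_diff_right)
      ultimately show ?thesis using 1 Gdiff[OF h order_refl Vs(1)] by linarith
    qed
    moreover have "(\<lambda>n. ?e * q (u n - x) + h * q (v n - y) + h * (?e * q (v n - y) + K))
        \<longlonglongrightarrow> ?e * 0 + h * 0 + h * (?e * 0 + K)"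
      by (intro tendsto_intros x(3) y(3))
    ultimately show ?thesis
      using LIMSEQ_le_const[of _ "?e * 0 + h * 0 + h * (?e * 0 + K)"] by fastforce
  qed
  show ?thesis
    unfolding generator_limit_def
  proof (rule tendstoI)
    fix e :: real assume "e > 0"
    then obtain b where b: "b > 0" "\<And>s. 0 < s \<Longrightarrow> s < b \<Longrightarrow> q (G s y - y) < e / 2"
      using order_tendstoD(2)[OF cont, of "e / 2"]
      by (auto simp: eventually_at_right_field)
    have "q ((1 / h) *\<^sub>R (G h x - x) - y) < e" if h: "0 < h" "h < b" for h
    proof -
      have "q (G s y - y) \<le> e / 2" if "0 \<le> s" "s \<le> h" for s
        using b(2)[of s] that h \<open>e > 0\<close> G_0[OF y(2)] q_0 by (cases "s = 0") auto
      then have "q (G h x - x - h *\<^sub>R y) \<le> h * (e / 2)" using h by (intro bound) auto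
      moreover have "(1 / h) *\<^sub>R (G h x - x) - y = (1 / h) *\<^sub>R (G h x - x - h *\<^sub>R y)"
        using h by (simp add: scaleR_diff_right)
      moreover have "q ((1 / h) *\<^sub>R (G h x - x - h *\<^sub>R y)) = (1 / h) * q (G h x - x - h *\<^sub>R y)"
        using h x y by (subst q_scaleR) (simp_all add: V_intros)
      ultimately have "q ((1 / h) *\<^sub>R (G h x - x) - y) \<le> (1 / h) * (h * (e / 2))"
        using h mult_left_mono[of "q (G h x - x - h *\<^sub>R y)" "h * (e / 2)" "1 / h"] by simp
      then show ?thesis using h \<open>e > 0\<close> by simp
    qed
    moreover have "0 \<le> q ((1 / h) *\<^sub>R (G h x - x) - y)" if "0 < h" for h
      using that x y by (intro q_nonneg) (simp add: V_intros)
    ultimately show "\<forall>\<^sub>F h in at_right 0. dist (q ((1 / h) *\<^sub>R (G h x - x) - y)) 0 < e"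
      using b(1) by (auto simp: eventually_at_right_field)
  qed
qed

text \<open>\<open>F h\<close> is the backward Euler step \<open>(I - h S)^-1\<close> for the
  generator \<open>S\<close> of \<open>G\<close>, on a set \<open>C\<close> where this is known;
  \<open>a\<close> and \<open>b\<close> play the roles of \<open>S w\<close> and
  \<open>S (S w)\<close>. Stability comes from dissipativity, the local error is of order
  \<open>h^2\<close> by the Taylor estimates, and \<open>n\<close> steps of size
  \<open>t / n\<close> accumulate to an error of order \<open>1 / n\<close>.\<close>

lemma exponential_formula:
  fixes F :: "real \<Rightarrow> 'a \<Rightarrow> 'a"
  assumes C: "C \<subseteq> V" and hmax: "hmax > 0"
    and F: "\<And>h v. 0 < h \<Longrightarrow> h < hmax \<Longrightarrow> v \<in> C \<Longrightarrow>
      F h v \<in> C \<and> generator_limit q G (F h v) ((1 / h) *\<^sub>R (F h v - v))"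
    and w: "w \<in> C" and a: "a \<in> C" and b: "b \<in> C"
    and Fw: "\<And>h j. 0 < h \<Longrightarrow> h < hmax \<Longrightarrow>
      (F h ^^ Suc j) w = (F h ^^ j) w + h *\<^sub>R (F h ^^ Suc j) a"
    and wa: "\<And>h j. 0 < h \<Longrightarrow> h < hmax \<Longrightarrow> generator_limit q G ((F h ^^ j) w) ((F h ^^ j) a)"
    and ab: "\<And>h j. 0 < h \<Longrightarrow> h < hmax \<Longrightarrow> generator_limit q G ((F h ^^ j) a) ((F h ^^ j) b)"
    and t: "t > 0"
  shows "(\<lambda>n. q ((F (t / real n) ^^ n) w - G t w)) \<longlonglongrightarrow> 0"
proof -
  have FC: "(F h ^^ j) v \<in> C" if "0 < h" "h < hmax" "v \<in> C" for h j v
    by (induction j) (use that F in auto)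
  \<comment> \<open>Dissipativity with \<open>l = 1 / h\<close> bounds the step by
    \<open>1 / (1 - h * \<omega>)\<close>, which is at most \<open>exp (2 * \<omega> * h)\<close> as
    long as \<open>h * \<omega> \<le> 1 / 2\<close>.\<close>
  have qF: "q (F h v) \<le> exp (2 * \<omega> * h) * q v"
    if h: "0 < h" "h < hmax" "h * \<omega> \<le> 1 / 2" and v: "v \<in> C" for h v
  proof -
    have Vs: "F h v \<in> V" "v \<in> V" using F[OF h(1,2) v] v C by auto
    have "(1 / h - \<omega>) * q (F h v) \<le> q ((1 / h) *\<^sub>R F h v - (1 / h) *\<^sub>R (F h v - v))"
      using F[OF h(1,2) v] Vs h by (intro generator_dissipative) (simp_all add: V_intros)
    also have "\<dots> = (1 / h) * q v"
      using Vs h by (simp add: scaleR_diff_right q_scaleR)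
    finally have "h * ((1 / h - \<omega>) * q (F h v)) \<le> h * ((1 / h) * q v)"
      using h by (intro mult_left_mono) auto
    then have "(1 - h * \<omega>) * q (F h v) \<le> q v" using h by (simp add: algebra_simps)
    moreover have "1 \<le> exp (2 * \<omega> * h) * (1 - h * \<omega>)"
    proof -
      have "h * \<omega> * (h * \<omega>) \<le> h * \<omega> * (1 / 2)"
        using h omega by (intro mult_left_mono) auto
      then have "1 \<le> (1 + 2 * \<omega> * h) * (1 - h * \<omega>)" by (simp add: algebra_simps)
      also have "\<dots> \<le> exp (2 * \<omega> * h) * (1 - h * \<omega>)"
        using h exp_ge_add_one_self[of "2 * \<omega> * h"] by (intro mult_right_mono) auto
      finally show ?thesis .
    qed
    ultimately have "q (F h v) \<le> exp (2 * \<omega> * h) * (1 - h * \<omega>) * q (F h v)"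
      "exp (2 * \<omega> * h) * ((1 - h * \<omega>) * q (F h v)) \<le> exp (2 * \<omega> * h) * q v"
      using q_nonneg[OF Vs(1)] mult_right_mono[of 1 _ "q (F h v)"] by auto
    then show ?thesis unfolding mult.assoc by (rule order_trans)
  qed
  have qFj: "q ((F h ^^ j) b) \<le> exp (2 * \<omega> * h * real j) * q b"
    if h: "0 < h" "h < hmax" "h * \<omega> \<le> 1 / 2" for h j
  proof (induction j)
    case (Suc j)
    have "q ((F h ^^ Suc j) b) \<le> exp (2 * \<omega> * h) * q ((F h ^^ j) b)"
      using qF[OF h FC[OF h(1,2) b]] by simp
    also have "\<dots> \<le> exp (2 * \<omega> * h) * (exp (2 * \<omega> * h * real j) * q b)"
      using Suc by simp
    also have "\<dots> = exp (2 * \<omega> * h * real (Suc j)) * q b"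
      by (simp add: mult_exp_exp algebra_simps)
    finally show ?case .
  qed simp
  \<comment> \<open>The exponent \<open>3 * \<omega>\<close> pays \<open>2 * \<omega>\<close> for
    the stability of the scheme and one more \<open>\<omega>\<close> for transport by the
    semigroup.\<close>
  have error: "q ((F h ^^ j) w - G (real j * h) w) \<le>
      6 * h\<^sup>2 * real j * (exp (3 * \<omega> * h * real j) * q b)"
    if h: "0 < h" "h < hmax" "h * \<omega> \<le> 1 / 2" for h j
  proof (induction j)
    case 0
    then show ?case using w C by (simp add: G_0 q_0 subset_iff)
  next
    case (Suc j)
    define v v' y z where "v = (F h ^^ j) w" and "v' = (F h ^^ Suc j) w"
      and "y = (F h ^^ Suc j) a" and "z = (F h ^^ Suc j) b"
    have Vs: "v \<in> V" "v' \<in> V" "y \<in> V" "z \<in> V" "w \<in> V"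
      using FC[OF h(1,2)] w a b C unfolding v_def v'_def y_def z_def by blast+
    have v': "v' = v + h *\<^sub>R y"
      unfolding v_def v'_def y_def by (rule Fw[OF h(1,2)])
    have gen: "generator_limit q G v' y" "generator_limit q G y z"
      unfolding v'_def y_def z_def by (rule wa[OF h(1,2)], rule ab[OF h(1,2)])
    let ?b = "h\<^sup>2 * (3 * exp (\<omega> * h) * q z)"
    have "G h v' = G h v + h *\<^sub>R G h y"
      unfolding v' using h Vs by (simp add: G_add G_scaleR V_intros)
    \<comment> \<open>The step is implicit, so the expansion is made at the new point
      \<open>v'\<close>, where \<open>v' - h y = v\<close>.\<close>
    then have eq: "v' - G h v = h *\<^sub>R (G h y - y) - (G h v' - v' - h *\<^sub>R y)"
      by (simp add: algebra_simps)
    have "q (v' - G h v) \<le> q (h *\<^sub>R (G h y - y)) + q (G h v' - v' - h *\<^sub>R y)"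
      unfolding eq using Vs h by (intro q_diff) (simp_all add: V_intros)
    also have "q (h *\<^sub>R (G h y - y)) = h * q (G h y - y)"
      using Vs h by (subst q_scaleR) (simp_all add: V_intros)
    also have "\<dots> \<le> h * (h * (3 * exp (\<omega> * h) * q z))"
      using h by (intro mult_left_mono increment_estimate[OF gen(2) Vs(3,4)]) auto
    also have "\<dots> = ?b" by (simp add: power2_eq_square)
    also have "q (G h v' - v' - h *\<^sub>R y) \<le> ?b"
      using h by (intro taylor_estimate[OF gen(1) Vs(2) gen(2) Vs(3,4)]) auto
    finally have "q (v' - G h v) \<le> 6 * h\<^sup>2 * exp (\<omega> * h) * q z" by (simp add: algebra_simps)
    also have "\<dots> \<le> 6 * h\<^sup>2 * exp (\<omega> * h) * (exp (2 * \<omega> * h * real (Suc j)) * q b)"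
      unfolding z_def by (intro mult_left_mono qFj h) simp
    also have "\<dots> = 6 * h\<^sup>2 * (exp (\<omega> * h + 2 * \<omega> * h * real (Suc j)) * q b)"
      by (simp add: exp_add)
    also have "\<dots> \<le> 6 * h\<^sup>2 * (exp (3 * \<omega> * h * real (Suc j)) * q b)"
      using omega h b C q_nonneg[of b]
      by (intro mult_left_mono mult_right_mono) (auto simp: algebra_simps)
    finally have 1: "q (v' - G h v) \<le> 6 * h\<^sup>2 * (exp (3 * \<omega> * h * real (Suc j)) * q b)" .
    have jh: "0 \<le> real j * h" using h by simp
    have "q (G h (v - G (real j * h) w)) \<le> exp (\<omega> * h) * q (v - G (real j * h) w)"
      using Vs h jh by (intro q_G) (simp_all add: V_intros)
    also have "\<dots> \<le> exp (\<omega> * h) * (6 * h\<^sup>2 * real j * (exp (3 * \<omega> * h * real j) * q b))"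
      using Suc by (intro mult_left_mono) (simp_all add: v_def)
    also have "\<dots> = 6 * h\<^sup>2 * real j * (exp (\<omega> * h + 3 * \<omega> * h * real j) * q b)"
      by (simp add: exp_add)
    also have "\<dots> \<le> 6 * h\<^sup>2 * real j * (exp (3 * \<omega> * h * real (Suc j)) * q b)"
      using omega h b C q_nonneg[of b]
      by (intro mult_left_mono mult_right_mono) (auto simp: algebra_simps)
    finally have 2: "q (G h (v - G (real j * h) w)) \<le>
        6 * h\<^sup>2 * real j * (exp (3 * \<omega> * h * real (Suc j)) * q b)" .
    have "G (real (Suc j) * h) w = G h (G (real j * h) w)"
      using G_plus[of h "real j * h" w] h jh Vs by (simp add: algebra_simps)
    then have eq: "v' - G (real (Suc j) * h) w = (v' - G h v) + G h (v - G (real j * h) w)"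
      using h jh Vs by (simp add: G_diff V_intros)
    have "q (v' - G (real (Suc j) * h) w) \<le> q (v' - G h v) + q (G h (v - G (real j * h) w))"
      unfolding eq using h jh Vs by (intro q_add) (simp_all add: V_intros)
    with 1 2 show ?case unfolding v'_def by (simp add: algebra_simps)
  qed
  have "\<forall>\<^sub>F n in sequentially. norm (q ((F (t / real n) ^^ n) w - G t w)) \<le>
      6 * t\<^sup>2 * (exp (3 * \<omega> * t) * q b) / real n"
  proof -
    have lim: "(\<lambda>n. t / real n) \<longlonglongrightarrow> 0" by (rule lim_const_over_n)
    have "\<forall>\<^sub>F n in sequentially. t / real n < min hmax (1 / (2 * (\<omega> + 1)))"
      using order_tendstoD(2)[OF lim, of "min hmax (1 / (2 * (\<omega> + 1)))"] hmax omega by simp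
    then show ?thesis using eventually_gt_at_top[of 0]
    proof eventually_elim
      fix n :: nat assume n: "t / real n < min hmax (1 / (2 * (\<omega> + 1)))" "0 < n"
      define h where "h = t / real n"
      have h: "0 < h" "h < hmax" using n t by (simp_all add: h_def)
      have "h * \<omega> \<le> 1 / (2 * (\<omega> + 1)) * \<omega>"
        using n omega unfolding h_def by (intro mult_right_mono) auto
      also have "\<dots> \<le> 1 / 2" using omega by (simp add: field_simps)
      finally have h2: "h * \<omega> \<le> 1 / 2" .
      have nh: "real n * h = t" using n by (simp add: h_def)
      have "q ((F h ^^ n) w - G t w) \<le> 6 * h\<^sup>2 * real n * (exp (3 * \<omega> * (h * real n)) * q b)"
        using error[OF h h2, of n] nh by (simp add: mult.assoc)
      also have "\<dots> = 6 * t\<^sup>2 * (exp (3 * \<omega> * t) * q b) / real n"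
        using n by (simp add: h_def power2_eq_square)
      moreover have "0 \<le> q ((F h ^^ n) w - G t w)"
        using FC[OF h w, of n] C w t by (intro q_nonneg V_diff G_in) auto
      ultimately show "norm (q ((F (t / real n) ^^ n) w - G t w)) \<le>
          6 * t\<^sup>2 * (exp (3 * \<omega> * t) * q b) / real n"
        by (simp add: h_def)
    qed
  qed
  then show ?thesis by (rule Lim_null_comparison) (rule lim_const_over_n)
qed

end

lemma generator_limit_comparison:
  assumes lim: "generator_limit n1 G x y"
    and V: "csubspace V" "x \<in> V" "y \<in> V" "\<And>h. h \<ge> 0 \<Longrightarrow> G h x \<in> V"
    and n2: "\<And>z. z \<in> V \<Longrightarrow> 0 \<le> n2 z" "\<And>z. z \<in> V \<Longrightarrow> n2 z \<le> M * n1 z"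
  shows "generator_limit n2 G x y"
  unfolding generator_limit_def
proof (rule Lim_null_comparison)
  show "((\<lambda>h. M * n1 ((1 / h) *\<^sub>R (G h x - x) - y)) \<longlongrightarrow> 0) (at_right 0)"
    using tendsto_mult_left[OF lim[unfolded generator_limit_def], of M] by simp
  show "\<forall>\<^sub>F h in at_right 0. norm (n2 ((1 / h) *\<^sub>R (G h x - x) - y)) \<le>
      M * n1 ((1 / h) *\<^sub>R (G h x - x) - y)"
    unfolding eventually_at_filter
  proof (intro always_eventually allI impI)
    fix h :: real assume "h \<in> {0<..}"
    then have "(1 / h) *\<^sub>R (G h x - x) - y \<in> V"
      using V by (intro csubspace_diff csubspace_scaleR) auto
    then show "norm (n2 ((1 / h) *\<^sub>R (G h x - x) - y)) \<le> M * n1 ((1 / h) *\<^sub>R (G h x - x) - y)"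
      using n2 by simp
  qed
qed

text \<open>The weighted supremum \<open>q x\<close> of
  \<open>exp (- \<omega> * t) * nV (G t x)\<close> over \<open>t \<ge> 0\<close> absorbs the
  constant of the growth bound, since replacing \<open>x\<close> by \<open>G t x\<close> only shifts
  the supremum. Taking \<open>t = 0\<close> gives \<open>nV x \<le> q x\<close>, the growth bound
  gives \<open>q x \<le> M * nV x\<close>, and equivalent norms have the same generator
  limits.\<close>

lemma C0_semigroup_renorming:
  assumes ban: "banach_on V nV" and sg: "C0_semigroup V nV G"
  obtains q and \<omega> M :: real where "quasi_contractive_semigroup V q G \<omega>"
    "\<And>x. x \<in> V \<Longrightarrow> nV x \<le> q x" "\<And>x. x \<in> V \<Longrightarrow> q x \<le> M * nV x" "M \<ge> 1"
    "\<And>x y. x \<in> V \<Longrightarrow> y \<in> V \<Longrightarrow> generator_limit q G x y \<longleftrightarrow> generator_limit nV G x y"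
    "\<And>x. x \<in> V \<Longrightarrow> ((\<lambda>t. q (G t x - x)) \<longlongrightarrow> 0) (at_right 0)"
proof -
  note V = banach_on_csubspace[OF ban]
  obtain M \<omega> where M: "M \<ge> 1" and \<omega>: "\<omega> \<ge> 0"
    and grow: "\<And>t x. t \<ge> 0 \<Longrightarrow> x \<in> V \<Longrightarrow> nV (G t x) \<le> M * exp (\<omega> * t) * nV x"
    using C0_semigroup_growth_bound[OF assms] by blast
  define q where "q x = (SUP t\<in>{0..}. exp (- \<omega> * t) * nV (G t x))" for x
  note Gin = C0_semigroup_in[OF sg]
  have term_le: "exp (- \<omega> * t) * nV (G t x) \<le> M * nV x" if "t \<ge> 0" "x \<in> V" for t x
  proof -
    have "exp (- \<omega> * t) * nV (G t x) \<le> exp (- \<omega> * t) * (M * exp (\<omega> * t) * nV x)"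
      using grow[OF that] by (intro mult_left_mono) auto
    also have "\<dots> = M * nV x" by (simp add: exp_minus)
    finally show ?thesis .
  qed
  have bdd: "bdd_above ((\<lambda>t. exp (- \<omega> * t) * nV (G t x)) ` {0..})" if "x \<in> V" for x
    using term_le[OF _ that] by (intro bdd_aboveI2[of _ _ "M * nV x"]) auto
  have ge: "exp (- \<omega> * t) * nV (G t x) \<le> q x" if "t \<ge> 0" "x \<in> V" for t x
    unfolding q_def using bdd[OF that(2)] that by (intro cSUP_upper) auto
  have le: "q x \<le> c" if "\<And>t. t \<ge> 0 \<Longrightarrow> exp (- \<omega> * t) * nV (G t x) \<le> c" for x c
    unfolding q_def using that by (intro cSUP_least) auto
  have n_q: "nV x \<le> q x" if "x \<in> V" for x
    using ge[of 0 x] that C0_semigroup_0[OF sg that] by simp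
  have q_n: "q x \<le> M * nV x" if "x \<in> V" for x
    using term_le[OF _ that] by (rule le)
  have q_nonneg: "0 \<le> q x" if "x \<in> V" for x
    using n_q[OF that] banach_on_nonneg[OF ban that] by simp
  have scale_le: "q (r *\<^sub>R x) \<le> \<bar>r\<bar> * q x" if "x \<in> V" for r x
  proof (rule le)
    fix t :: real assume t: "t \<ge> 0"
    have "exp (- \<omega> * t) * nV (G t (r *\<^sub>R x)) = \<bar>r\<bar> * (exp (- \<omega> * t) * nV (G t x))"
      using that by (simp add: clinear_on_scaleR[OF C0_semigroup_clinear[OF sg t]]
          banach_on_scaleR[OF ban Gin[OF t]])
    also have "\<dots> \<le> \<bar>r\<bar> * q x" using ge[OF t that] by (rule mult_left_mono) simp
    finally show "exp (- \<omega> * t) * nV (G t (r *\<^sub>R x)) \<le> \<bar>r\<bar> * q x" .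
  qed
  have qc: "quasi_contractive_semigroup V q G \<omega>"
  proof
    show "q (x + y) \<le> q x + q y" if "x \<in> V" "y \<in> V" for x y
    proof (rule le)
      fix t :: real assume t: "t \<ge> 0"
      have "exp (- \<omega> * t) * nV (G t (x + y)) \<le> exp (- \<omega> * t) * (nV (G t x) + nV (G t y))"
        using that t by (intro mult_left_mono)
          (auto simp: clinear_on_add[OF C0_semigroup_clinear[OF sg t]]
            intro!: banach_on_add[OF ban] Gin)
      also have "\<dots> \<le> q x + q y"
        using ge[OF t that(1)] ge[OF t that(2)] by (simp add: distrib_left)
      finally show "exp (- \<omega> * t) * nV (G t (x + y)) \<le> q x + q y" .
    qed
    show "q (r *\<^sub>R x) = \<bar>r\<bar> * q x" if "x \<in> V" for r x
    proof (cases "r = 0")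
      case True
      then show ?thesis
        using scale_le[OF that, of 0] q_nonneg[OF csubspace_0[OF V]] by simp
    next
      case False
      have "\<bar>r\<bar> * q x \<le> \<bar>r\<bar> * (\<bar>1 / r\<bar> * q (r *\<^sub>R x))"
        using scale_le[OF csubspace_scaleR[OF V that], of "1 / r" r] False
        by (intro mult_left_mono) simp_all
      also have "\<dots> = q (r *\<^sub>R x)" using False by simp
      finally show ?thesis using scale_le[OF that, of r] by simp
    qed
    show "q (G t x) \<le> exp (\<omega> * t) * q x" if t: "t \<ge> 0" and x: "x \<in> V" for t x
    proof (rule le)
      fix s :: real assume s: "s \<ge> 0"
      have "exp (- \<omega> * s) * nV (G s (G t x)) =
          exp (\<omega> * t) * (exp (- \<omega> * (s + t)) * nV (G (s + t) x))"
        using C0_semigroup_add[OF sg s t x] by (simp add: algebra_simps exp_diff exp_minus)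
      also have "\<dots> \<le> exp (\<omega> * t) * q x"
        using s t x by (intro mult_left_mono ge) auto
      finally show "exp (- \<omega> * s) * nV (G s (G t x)) \<le> exp (\<omega> * t) * q x" .
    qed
  qed (use V q_nonneg sg \<omega> in \<open>auto intro: C0_semigroup_clinear C0_semigroup_in C0_semigroup_0
      C0_semigroup_add\<close>)
  show thesis
  proof (rule that[OF qc n_q q_n M])
    fix x y assume xy: "x \<in> V" "y \<in> V"
    have "generator_limit nV G x y" if "generator_limit q G x y"
      using n_q xy by (intro generator_limit_comparison[where M = 1, OF that V])
        (auto intro: banach_on_nonneg[OF ban] Gin)
    moreover have "generator_limit q G x y" if "generator_limit nV G x y"
      using q_n xy by (intro generator_limit_comparison[where M = M, OF that V])
        (auto intro: q_nonneg Gin)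
    ultimately show "generator_limit q G x y \<longleftrightarrow> generator_limit nV G x y" by blast
  next
    fix x assume x: "x \<in> V"
    show "((\<lambda>t. q (G t x - x)) \<longlongrightarrow> 0) (at_right 0)"
    proof (rule Lim_null_comparison)
      show "((\<lambda>t. M * nV (G t x - x)) \<longlongrightarrow> 0) (at_right 0)"
        using tendsto_mult_left[OF C0_semigroup_lim[OF sg x], of M] by simp
      show "\<forall>\<^sub>F t in at_right 0. norm (q (G t x - x)) \<le> M * nV (G t x - x)"
        unfolding eventually_at_filter
        using x by (intro always_eventually allI impI)
          (simp add: q_nonneg q_n csubspace_diff[OF V] Gin)
    qed
  qed
qed

text \<open>A monotonicity criterion for one-sided information, which is what a generator limit
  provides. Continuous induction: the supremum \<open>m\<close> of the points up to which
  \<open>f\<close> stays below a line of slope \<open>e\<close> can be pushed further unless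
  \<open>m = b\<close>.\<close>

lemma dini_mono:
  fixes f :: "real \<Rightarrow> real"
  assumes ab: "a \<le> b" and cont: "continuous_on {a..b} f"
    and dini: "\<And>t e. a \<le> t \<Longrightarrow> t < b \<Longrightarrow> e > 0 \<Longrightarrow> \<forall>\<^sub>F s in at_right t. f s \<le> f t + e * (s - t)"
  shows "f b \<le> f a"
proof (rule field_le_epsilon)
  fix e0 :: real assume e0: "e0 > 0"
  \<comment> \<open>The summand 1 in the denominator covers \<open>a = b\<close>.\<close>
  define e where "e = e0 / (b - a + 1)"
  have e: "e > 0" using e0 ab by (simp add: e_def)
  define S where "S = {t \<in> {a..b}. \<forall>s\<in>{a..t}. f s \<le> f a + e * (s - a)}"
  have aS: "a \<in> S" using ab by (simp add: S_def)
  have bdd: "bdd_above S" by (rule bdd_aboveI[of _ b]) (simp add: S_def)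
  define m where "m = Sup S"
  have m: "a \<le> m" "m \<le> b"
    unfolding m_def using aS bdd by (auto intro!: cSup_upper cSup_least simp: S_def)
  have below: "f s \<le> f a + e * (s - a)" if "a \<le> s" "s < m" for s
    using less_cSupD[of S s] aS that unfolding m_def S_def by force
  have at_m: "f m \<le> f a + e * (m - a)"
  proof (cases "m = a")
    case False
    with m have am: "a < m" by simp
    have "continuous_on {a..m} f" using cont m by (auto intro: continuous_on_subset)
    then have "continuous_on {a..m} (\<lambda>s. f a + e * (s - a) - f s)"
      by (intro continuous_intros)
    then have "0 \<le> f a + e * (m - a) - f m"
      by (rule continuous_ge_on_Ioo[of a m _ 0 m]) (use am below in \<open>auto\<close>)
    then show ?thesis by simp
  qed simp
  have "m = b"
  proof (rule ccontr)
    assume "m \<noteq> b"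
    with m have mb: "m < b" by simp
    obtain c where c: "c > m" "\<And>s. m < s \<Longrightarrow> s < c \<Longrightarrow> f s \<le> f m + e * (s - m)"
      using dini[OF m(1) mb e] by (auto simp: eventually_at_right_field)
    define m' where "m' = min b ((m + c) / 2)"
    have m': "m < m'" "m' \<le> b" "m' < c" using c mb by (auto simp: m'_def min_def)
    have "f s \<le> f a + e * (s - a)" if "a \<le> s" "s \<le> m'" for s
    proof -
      consider "s < m" | "s = m" | "m < s" by linarith
      then show ?thesis
      proof cases
        case 3
        then have "f s \<le> f m + e * (s - m)" using c(2) that m' by simp
        then show ?thesis using at_m by (simp add: algebra_simps)
      qed (use below at_m that in auto)
    qed
    then have "m' \<in> S" using m m' by (simp add: S_def)
    then have "m' \<le> m" unfolding m_def using bdd by (rule cSup_upper)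
    with m' show False by simp
  qed
  with at_m have "f b \<le> f a + e * (b - a)" by simp
  also have "e * (b - a) \<le> e0" using e0 ab by (simp add: e_def field_simps)
  finally show "f b \<le> f a + e0" by simp
qed

lemma bounded_clinear_compose:
  "bounded_clinear f \<Longrightarrow> bounded_clinear g \<Longrightarrow> bounded_clinear (\<lambda>x. f (g x))"
  by (simp add: bounded_clinear_def bounded_linear_compose)

lemma bounded_linear_funpow:
  fixes f :: "'a::real_normed_vector \<Rightarrow> 'a"
  assumes "bounded_linear f"
  shows "bounded_linear (f ^^ k)"
proof (induction k)
  case 0
  then show ?case by (simp add: id_def bounded_linear_ident)
next
  case (Suc k)
  then show ?case using bounded_linear_compose[OF assms Suc] by (simp add: comp_def)
qed

section \<open>Resolvents\<close>

lemma resolvent_facts: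
  assumes "l \<in> resolvent_set E D A"
  shows resolvent_in: "resolvent E D A l z \<in> D"
    and resolvent_eq: "l *\<^sub>C E (resolvent E D A l z) - A (resolvent E D A l z) = z"
    and resolvent_unique: "x \<in> D \<Longrightarrow> l *\<^sub>C E x - A x = z \<Longrightarrow> x = resolvent E D A l z"
    and resolvent_bounded: "bounded_clinear (resolvent E D A l)"
proof -
  have bij: "bij_betw (\<lambda>x. l *\<^sub>C E x - A x) D UNIV"
    and "bounded_clinear (resolvent E D A l)"
    using assms by (auto simp: resolvent_set_def)
  then show "bounded_clinear (resolvent E D A l)" by blast
  show "resolvent E D A l z \<in> D"
    using bij unfolding resolvent_def bij_betw_def by (intro inv_into_into) auto
  show "l *\<^sub>C E (resolvent E D A l z) - A (resolvent E D A l z) = z"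
    using bij_betw_inv_into_right[OF bij, of z] by (simp add: resolvent_def)
  show "x = resolvent E D A l z" if "x \<in> D" "l *\<^sub>C E x - A x = z"
    using bij_betw_inv_into_left[OF bij that(1)] that(2) by (simp add: resolvent_def)
qed

text \<open>The estimates produce admissible exponents; minimality enters afterwards through
  \<open>is_smallest_le\<close>. The predicates for the other two indices are split off for the same
  reason.\<close>

definition resolvent_growth ::
    "('x::complex_banach \<Rightarrow> 'z::complex_banach) \<Rightarrow> 'x set \<Rightarrow> ('x \<Rightarrow> 'z) \<Rightarrow> nat \<Rightarrow> bool" where
  "resolvent_growth E D A p \<longleftrightarrow> (\<exists>\<omega>::real. \<exists>C>0.
     complex_of_real ` {\<omega><..} \<subseteq> resolvent_set E D A \<and>
     (\<forall>l>\<omega>. onorm (resolvent E D A (complex_of_real l)) \<le> C * \<bar>l\<bar> powi (int p - 1)))"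

lemma resolvent_index_iff: "resolvent_index E D A = is_smallest (resolvent_growth E D A)"
  by (simp add: resolvent_index_def resolvent_growth_def[abs_def])

lemma is_smallest_le: "is_smallest \<Phi> p \<Longrightarrow> \<Phi> q \<Longrightarrow> p \<le> q"
  by (force simp: is_smallest_def not_less[symmetric])

text \<open>For \<open>l \<ge> 1\<close> the quotient \<open>l ^ p / l\<close> stands for the
  integer power with exponent \<open>p - 1\<close>, also when \<open>p = 0\<close>. Since
  \<open>C\<close> may vanish, \<open>C + 1\<close> serves as the positive constant.\<close>

lemma resolvent_growthI:
  assumes res: "\<And>l. l > \<omega> \<Longrightarrow> complex_of_real l \<in> resolvent_set E D A"
    and bound: "\<And>l z. l > \<omega> \<Longrightarrow> l \<ge> 1 \<Longrightarrow>
      norm (resolvent E D A (complex_of_real l) z) \<le> C * (l ^ p / l) * norm z"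
    and C: "C \<ge> 0"
  shows "resolvent_growth E D A p"
  unfolding resolvent_growth_def
proof (rule exI[of _ "max \<omega> 1"], rule exI[of _ "C + 1"], intro conjI allI impI)
  show "complex_of_real ` {max \<omega> 1<..} \<subseteq> resolvent_set E D A" using res by auto
  fix l :: real assume l: "l > max \<omega> 1"
  have "onorm (resolvent E D A (complex_of_real l)) \<le> C * (l ^ p / l)"
    using l bound C by (intro onorm_bound) auto
  also have "\<dots> \<le> (C + 1) * (l ^ p / l)" using l by (intro mult_right_mono) auto
  also have "l ^ p / l = \<bar>l\<bar> powi (int p - 1)" using l by (simp add: power_int_diff)
  finally show "onorm (resolvent E D A (complex_of_real l)) \<le> (C + 1) * \<bar>l\<bar> powi (int p - 1)" .
qed (use C in simp)

lemma resolvent_growthD: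
  assumes "resolvent_growth E D A p"
  obtains \<omega> C where "\<omega> \<ge> 1" "C > 0"
    "\<And>l. l > \<omega> \<Longrightarrow> complex_of_real l \<in> resolvent_set E D A"
    "\<And>l z. l > \<omega> \<Longrightarrow> norm (resolvent E D A (complex_of_real l) z) \<le> C * (l ^ p / l) * norm z"
proof -
  obtain \<omega> C where C: "C > 0" and res: "complex_of_real ` {\<omega><..} \<subseteq> resolvent_set E D A"
    and bound: "\<And>l. l > \<omega> \<Longrightarrow> onorm (resolvent E D A (complex_of_real l)) \<le> C * \<bar>l\<bar> powi (int p - 1)"
    using assms by (auto simp: resolvent_growth_def)
  show thesis
  proof (rule that[of "max \<omega> 1" C])
    fix l :: real assume l: "l > max \<omega> 1"
    then show r: "complex_of_real l \<in> resolvent_set E D A" using res by auto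
    fix z
    have "norm (resolvent E D A (complex_of_real l) z) \<le>
        onorm (resolvent E D A (complex_of_real l)) * norm z"
      by (intro onorm bounded_clinear_linear resolvent_bounded r)
    also have "\<dots> \<le> C * \<bar>l\<bar> powi (int p - 1) * norm z"
      using l by (intro mult_right_mono bound) auto
    also have "\<bar>l\<bar> powi (int p - 1) = l ^ p / l" using l by (simp add: power_int_diff)
    finally show "norm (resolvent E D A (complex_of_real l) z) \<le> C * (l ^ p / l) * norm z" .
  qed (use C in auto)
qed

text \<open>Apply \<open>l E - A = (m E - A) + (l - m) E\<close> to \<open>R m z\<close> and invert
  the left-hand side.\<close>

lemma resolvent_identity:
  assumes l: "complex_of_real l \<in> resolvent_set E D A"
    and m: "complex_of_real m \<in> resolvent_set E D A"
  defines "R \<equiv> \<lambda>l. resolvent E D A (complex_of_real l)"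
  shows "R l z = R m z + (m - l) *\<^sub>R R l (E (R m z))"
proof -
  have "complex_of_real l *\<^sub>C E (R m z) - A (R m z) = z + (l - m) *\<^sub>R E (R m z)"
    using resolvent_eq[OF m, of z] by (simp add: R_def scaleC_of_real algebra_simps)
  then have "R m z = R l (z + (l - m) *\<^sub>R E (R m z))"
    unfolding R_def by (intro resolvent_unique[OF l] resolvent_in[OF m])
  also have "\<dots> = R l z + (l - m) *\<^sub>R R l (E (R m z))"
    using resolvent_bounded[OF l] by (simp add: R_def bounded_clinear_add bounded_clinear_scaleR)
  finally show ?thesis by (simp add: algebra_simps)
qed

text \<open>Applying the resolvent identity \<open>p + 1\<close> times leaves a polynomial of degree
  \<open>p\<close> in \<open>l\<close> and the remainder \<open>(m - l) ^ (p + 1)\<close> times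
  \<open>R l E (R m E)^p R m\<close>. The radiality bound for the tuple
  \<open>(l, m, ..., m)\<close> controls it by \<open>1 / (l - \<omega>)\<close>; one factor
  \<open>m - l\<close> cancels and growth \<open>l ^ p\<close> remains, which is the exponent
  \<open>(p + 1) - 1\<close>.\<close>

lemma radiality_imp_resolvent_growth:
  assumes E: "bounded_clinear E" and rad: "radiality_index E D A p"
  shows "resolvent_growth E D A (p + 1)"
proof -
  obtain \<omega> C where C: "C > 0" and sub: "complex_of_real ` {\<omega><..} \<subseteq> resolvent_set E D A"
    and rb: "\<And>l. (\<forall>k\<le>p. l k > \<omega>) \<Longrightarrow>
      onorm (comp_list (map (\<lambda>k. resolvent E D A (complex_of_real (l k)) \<circ> E) [0..<Suc p]))
        \<le> C * (\<Prod>k\<le>p. 1 / \<bar>l k - \<omega>\<bar>)"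
    using rad unfolding radiality_index_def is_smallest_def by blast
  define R where "R = (\<lambda>l. resolvent E D A (complex_of_real l))"
  \<comment> \<open>The point of expansion. Lying above both 0 and \<open>\<omega>\<close>, it
    satisfies \<open>\<bar>m - l\<bar> \<le> l\<close> and
    \<open>\<bar>m - l\<bar> \<le> l - \<omega>\<close> for \<open>l > m\<close>.\<close>
  define m where "m = max \<omega> 0 + 1"
  have m: "m > \<omega>" "m \<ge> 1" by (simp_all add: m_def)
  have res: "complex_of_real l \<in> resolvent_set E D A" if "l > \<omega>" for l
    using sub that by auto
  have blR: "bounded_linear (R l)" if "l > \<omega>" for l
    unfolding R_def by (intro bounded_clinear_linear resolvent_bounded res that)
  have blE: "bounded_linear E" using E by (rule bounded_clinear_linear)
  define S where "S = R m \<circ> E"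
  have blS: "bounded_linear (S ^^ k)" for k
    unfolding S_def comp_def
    by (intro bounded_linear_funpow bounded_linear_compose[OF blR[OF m(1)] blE])
  have expand: "R l z = (\<Sum>k\<le>n. (m - l) ^ k *\<^sub>R (S ^^ k) (R m z)) +
      (m - l) ^ Suc n *\<^sub>R R l (E ((S ^^ n) (R m z)))" if l: "l > \<omega>" for l z n
  proof (induction n)
    case 0
    then show ?case using resolvent_identity[OF res[OF l] res[OF m(1)], of z] by (simp add: R_def)
  next
    case (Suc n)
    let ?y = "(S ^^ n) (R m z)"
    have eq: "R l (E ?y) = S ?y + (m - l) *\<^sub>R R l (E (S ?y))"
      using resolvent_identity[OF res[OF l] res[OF m(1)], of "E ?y"] by (simp add: R_def S_def)
    show ?case using Suc unfolding eq by (simp add: scaleR_add_right mult_ac)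
  qed
  have rad_bound: "norm (R l (E ((S ^^ p) y))) \<le> C * (1 / (l - \<omega>)) * (1 / (m - \<omega>)) ^ p * norm y"
    if l: "l > \<omega>" for l y
  proof -
    define lk where "lk k = (if k = 0 then l else m)" for k :: nat
    have "map (\<lambda>k. R (lk k) \<circ> E) [0..<Suc p] = (R l \<circ> E) # map (\<lambda>k. R (lk k) \<circ> E) [1..<Suc p]"
      by (subst upt_conv_Cons) (simp_all add: lk_def)
    also have "map (\<lambda>k. R (lk k) \<circ> E) [1..<Suc p] = map (\<lambda>_. S) [1..<Suc p]"
      by (intro map_cong) (auto simp: lk_def S_def)
    also have "\<dots> = replicate p S" by (simp add: map_replicate_const)
    finally have list: "map (\<lambda>k. R (lk k) \<circ> E) [0..<Suc p] = (R l \<circ> E) # replicate p S" .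
    have "comp_list (map (\<lambda>k. R (lk k) \<circ> E) [0..<Suc p]) = R l \<circ> E \<circ> (S ^^ p)"
      unfolding comp_list_def list by (simp add: comp_funpow)
    moreover have "(\<Prod>k\<le>p. 1 / \<bar>lk k - \<omega>\<bar>) = (1 / (l - \<omega>)) * (1 / (m - \<omega>)) ^ p"
      using l m by (subst prod.atMost_shift) (simp add: lk_def power_one_over)
    ultimately have *: "onorm (R l \<circ> E \<circ> (S ^^ p)) \<le> C * ((1 / (l - \<omega>)) * (1 / (m - \<omega>)) ^ p)"
      using rb[of lk] l m by (simp add: lk_def R_def)
    have "bounded_linear (R l \<circ> E \<circ> (S ^^ p))"
      unfolding comp_def by (intro bounded_linear_compose[OF blR[OF l]] bounded_linear_compose[OF blE] blS)
    from onorm[OF this, of y]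
    have "norm (R l (E ((S ^^ p) y))) \<le> onorm (R l \<circ> E \<circ> (S ^^ p)) * norm y" by simp
    also have "\<dots> \<le> C * ((1 / (l - \<omega>)) * (1 / (m - \<omega>)) ^ p) * norm y"
      by (rule mult_right_mono[OF * norm_ge_zero])
    finally show ?thesis by (simp only: mult.assoc)
  qed
  define K where "K = (\<Sum>k\<le>p. onorm (\<lambda>z. (S ^^ k) (R m z))) + C * (1 / (m - \<omega>)) ^ p * onorm (R m)"
  have blSR: "bounded_linear (\<lambda>z. (S ^^ k) (R m z))" for k
    by (intro bounded_linear_compose[OF blS] blR m)
  have K: "K \<ge> 0" unfolding K_def using C m
    by (intro add_nonneg_nonneg sum_nonneg mult_nonneg_nonneg onorm_pos_le blSR blR) auto
  have bound: "norm (R l z) \<le> K * (l ^ (p + 1) / l) * norm z" if l: "l > m" for l z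
  proof -
    have lo: "l > \<omega>" "l \<ge> 1" "\<bar>m - l\<bar> \<le> l" "\<bar>m - l\<bar> \<le> l - \<omega>" using l m by auto
    have 1: "norm (\<Sum>k\<le>p. (m - l) ^ k *\<^sub>R (S ^^ k) (R m z)) \<le>
        (\<Sum>k\<le>p. l ^ p * (onorm (\<lambda>z. (S ^^ k) (R m z)) * norm z))"
    proof (rule sum_norm_le)
      fix k assume "k \<in> {..p}"
      then have "\<bar>m - l\<bar> ^ k \<le> l ^ p"
        using power_mono[OF lo(3), of k] power_increasing[of k p l] lo by auto
      then show "norm ((m - l) ^ k *\<^sub>R (S ^^ k) (R m z)) \<le>
          l ^ p * (onorm (\<lambda>z. (S ^^ k) (R m z)) * norm z)"
        unfolding norm_scaleR power_abs using lo
        by (intro mult_mono onorm[OF blSR]) auto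
    qed
    have "norm ((m - l) ^ Suc p *\<^sub>R R l (E ((S ^^ p) (R m z)))) \<le>
        \<bar>m - l\<bar> ^ Suc p * (C * (1 / (l - \<omega>)) * (1 / (m - \<omega>)) ^ p * norm (R m z))"
      unfolding norm_scaleR power_abs using rad_bound[OF lo(1)] by (intro mult_left_mono) auto
    also have "\<dots> = \<bar>m - l\<bar> ^ p * (\<bar>m - l\<bar> / (l - \<omega>)) * (C * (1 / (m - \<omega>)) ^ p * norm (R m z))"
      by simp
    also have "\<dots> \<le> l ^ p * 1 * (C * (1 / (m - \<omega>)) ^ p * (onorm (R m) * norm z))"
      using lo m C by (intro mult_mono power_mono mult_left_mono onorm blR) (auto simp: field_simps)
    finally have 2: "norm ((m - l) ^ Suc p *\<^sub>R R l (E ((S ^^ p) (R m z)))) \<le>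
        l ^ p * (C * (1 / (m - \<omega>)) ^ p * (onorm (R m) * norm z))" by simp
    have "norm (R l z) \<le> (\<Sum>k\<le>p. l ^ p * (onorm (\<lambda>z. (S ^^ k) (R m z)) * norm z)) +
        l ^ p * (C * (1 / (m - \<omega>)) ^ p * (onorm (R m) * norm z))"
      unfolding expand[OF lo(1), of z p] by (rule norm_triangle_mono[OF 1 2])
    also have "\<dots> = l ^ p * (K * norm z)"
      by (simp add: K_def sum_distrib_left[symmetric] sum_distrib_right[symmetric] algebra_simps)
    finally show ?thesis using lo by (simp add: mult_ac)
  qed
  show ?thesis
    using res bound K m unfolding R_def
    by (intro resolvent_growthI[of m _ _ _ K]) (auto simp del: power_add)
qed

section \<open>Iterated derivatives\<close>

text \<open>For \<open>T > 0\<close> every point of the closed interval is a limit point of it, so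
  derivatives within the interval are unique, also at its ends.\<close>

lemma vector_derivative_within_interval:
  assumes "T > 0" "t \<in> {0..T}" "(g has_vector_derivative d) (at t within {0..T})"
    and "\<And>s. s \<in> {0..T} \<Longrightarrow> f s = g s"
  shows "vector_derivative f (at t within {0..T}) = d"
proof -
  have "(f has_vector_derivative d) (at t within {0..T})"
    using has_vector_derivative_transform[OF assms(2,4,3)] .
  moreover have "at t within {0..T} \<noteq> bot"
    using assms(1,2) by (simp add: trivial_limit_within)
  ultimately show ?thesis by (intro vector_derivative_within)
qed

text \<open>\<open>g i\<close> is the guessed derivative of order \<open>i\<close>. Values on
  \<open>{0..T}\<close> suffice, because each derivative is taken within the interval.\<close>

lemma iter_deriv_eqI:
  assumes T: "T > 0"
    and g: "\<And>i t. i < k \<Longrightarrow> t \<in> {0..T} \<Longrightarrow> (g i has_vector_derivative g (Suc i) t) (at t within {0..T})"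
    and f: "\<And>t. t \<in> {0..T} \<Longrightarrow> f t = g 0 t" and "i \<le> k" "t \<in> {0..T}"
  shows "iter_deriv T i f t = g i t"
  using \<open>i \<le> k\<close> \<open>t \<in> {0..T}\<close>
proof (induction i arbitrary: t)
  case 0
  then show ?case using f by (simp add: iter_deriv_def)
next
  case (Suc i)
  have "iter_deriv T (Suc i) f t = vector_derivative (iter_deriv T i f) (at t within {0..T})"
    by (simp add: iter_deriv_def)
  also have "\<dots> = g (Suc i) t"
    using Suc by (intro vector_derivative_within_interval[OF T _ g]) auto
  finally show ?case .
qed

lemma C_k_onI:
  assumes T: "T > 0"
    and g: "\<And>i t. i < k \<Longrightarrow> t \<in> {0..T} \<Longrightarrow> (g i has_vector_derivative g (Suc i) t) (at t within {0..T})"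
    and cont: "\<And>i. i \<le> k \<Longrightarrow> continuous_on {0..T} (g i)"
    and f: "\<And>t. t \<in> {0..T} \<Longrightarrow> f t = g 0 t"
  shows "C_k_on T k f"
  unfolding C_k_on_def
proof (intro conjI allI impI ballI)
  have eq: "iter_deriv T i f t = g i t" if "i \<le> k" "t \<in> {0..T}" for i t
    by (rule iter_deriv_eqI[OF T g f that])
  fix i assume i: "i \<le> k"
  then show "continuous_on {0..T} (iter_deriv T i f)"
    using continuous_on_cong[of "{0..T}" "{0..T}" "iter_deriv T i f" "g i"] cont[OF i] eq[OF i]
    by simp
next
  have eq: "iter_deriv T i f t = g i t" if "i \<le> k" "t \<in> {0..T}" for i t
    by (rule iter_deriv_eqI[OF T g f that])
  fix i t assume i: "i < k" and t: "t \<in> {0..T}"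
  have "(iter_deriv T i f has_vector_derivative g (Suc i) t) (at t within {0..T})"
    using eq i t by (intro has_vector_derivative_transform[OF t _ g]) auto
  then show "iter_deriv T i f differentiable at t within {0..T}"
    by (rule differentiableI_vector)
qed

lemma C_k_onD:
  assumes "C_k_on T k f"
  shows C_k_on_continuous: "i \<le> k \<Longrightarrow> continuous_on {0..T} (iter_deriv T i f)"
    and C_k_on_deriv: "i < k \<Longrightarrow> t \<in> {0..T} \<Longrightarrow>
      (iter_deriv T i f has_vector_derivative iter_deriv T (Suc i) f t) (at t within {0..T})"
  using assms by (auto simp: C_k_on_def iter_deriv_def vector_derivative_works)

lemma iter_deriv_0: "iter_deriv T 0 f = f"
  by (simp add: iter_deriv_def)

lemma classical_solutionI:
  assumes "T > 0" "\<And>t. t \<in> {0..T} \<Longrightarrow> x t \<in> D"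
    and der: "\<And>t. t \<in> {0..T} \<Longrightarrow>
      ((\<lambda>s. E (x s)) has_vector_derivative A (x t) + f t) (at t within {0..T})"
    and cont: "continuous_on {0..T} (\<lambda>t. A (x t) + f t)"
  shows "classical_solution T E D A f x"
proof -
  define g where "g i = (if i = 0 then (\<lambda>s. E (x s)) else (\<lambda>t. A (x t) + f t))" for i :: nat
  have "continuous_on {0..T} (\<lambda>s. E (x s))"
    using der by (rule continuous_on_vector_derivative)
  then have "C_k_on T 1 (\<lambda>s. E (x s))"
    using assms by (intro C_k_onI[of T _ g]) (auto simp: g_def)
  then show ?thesis
    using assms(2) vector_derivative_within_interval[OF \<open>T > 0\<close> _ der]
    by (simp add: classical_solution_def)
qed

lemma classical_solutionD:
  assumes "classical_solution T E D A f x"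
  shows classical_solution_in: "t \<in> {0..T} \<Longrightarrow> x t \<in> D"
    and classical_solution_deriv: "t \<in> {0..T} \<Longrightarrow>
      ((\<lambda>s. E (x s)) has_vector_derivative A (x t) + f t) (at t within {0..T})"
  using assms C_k_on_deriv[of T 1 "\<lambda>s. E (x s)" 0 t]
  by (auto simp: classical_solution_def iter_deriv_def)

section \<open>The resolvent index is at most the perturbation index\<close>

definition perturbation_bound ::
    "real \<Rightarrow> ('x::complex_banach \<Rightarrow> 'z::complex_banach) \<Rightarrow> 'x set \<Rightarrow> ('x \<Rightarrow> 'z) \<Rightarrow> nat \<Rightarrow> bool"
  where
  "perturbation_bound T E D A p \<longleftrightarrow> (\<exists>c>0. \<forall>x \<delta>.
     C_k_on T (p - 1) \<delta> \<and> classical_solution T E D A \<delta> x \<longrightarrow>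
     (\<forall>t\<in>{0..T}. norm (x t) \<le> c * (norm (x 0) +
        (if p = 0 then integral {0..T} (\<lambda>s. norm (\<delta> s))
         else (\<Sum>i<p. SUP s\<in>{0..T}. norm (iter_deriv T i \<delta> s))))))"

lemma perturbation_index_iff:
  "perturbation_index T E D A = is_smallest (perturbation_bound T E D A)"
  by (simp add: perturbation_index_def perturbation_bound_def[abs_def])

text \<open>At \<open>t = T\<close> the exponential solution has norm
  \<open>exp (l * T) * norm r\<close>, while its initial value contributes
  \<open>c * norm r\<close>; for \<open>l * T > 2 * c\<close> the latter is at most half of the
  former and is absorbed. The factor \<open>exp (l * T)\<close> then cancels, and the derivatives of
  order below \<open>p\<close> leave the power \<open>l ^ p / l\<close>.\<close>

lemma perturbation_imp_resolvent_growth: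
  fixes E :: "'x::complex_banach \<Rightarrow> 'z::complex_banach"
  assumes T: "T > 0" and E: "bounded_clinear E" and A: "clinear_on D A"
    and res: "\<And>l. l > \<omega> \<Longrightarrow> complex_of_real l \<in> resolvent_set E D A"
    and pert: "perturbation_bound T E D A p"
  shows "resolvent_growth E D A p"
proof -
  obtain c where c: "c > 0" and
    bound: "\<And>x \<delta> t. C_k_on T (p - 1) \<delta> \<Longrightarrow> classical_solution T E D A \<delta> x \<Longrightarrow> t \<in> {0..T} \<Longrightarrow>
      norm (x t) \<le> c * (norm (x 0) +
        (if p = 0 then integral {0..T} (\<lambda>s. norm (\<delta> s))
         else (\<Sum>i<p. SUP s\<in>{0..T}. norm (iter_deriv T i \<delta> s))))"
    using pert unfolding perturbation_bound_def by blast
  \<comment> \<open>The bound \<open>2 * c / T\<close> secures the absorption, the bound 1 makes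
    powers of \<open>l\<close> increasing.\<close>
  define \<omega>' where "\<omega>' = max \<omega> (max 1 (2 * c / T))"
  have est: "norm (resolvent E D A (complex_of_real l) z) \<le> 2 * c * (real p + 1) * (l ^ p / l) * norm z"
    if l: "l > \<omega>'" for l z
  proof -
    define r where "r = resolvent E D A (complex_of_real l) z"
    have l': "l > \<omega>" "l > 1" "l * T > 2 * c"
      using l T by (auto simp: \<omega>'_def field_simps)
    define \<delta> :: "real \<Rightarrow> 'z" where "\<delta> t = exp (l * t) *\<^sub>R z" for t
    define x where "x t = exp (l * t) *\<^sub>R r" for t
    define g :: "nat \<Rightarrow> real \<Rightarrow> 'z" where "g i t = (l ^ i * exp (l * t)) *\<^sub>R z" for i t
    have g: "(g i has_vector_derivative g (Suc i) t) (at t within {0..T})" for i t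
    proof -
      have "((\<lambda>t. l ^ i * exp (l * t)) has_real_derivative l ^ Suc i * exp (l * t)) (at t within {0..T})"
        by (auto intro!: derivative_eq_intros)
      then show ?thesis unfolding g_def
        using has_vector_derivative_scaleR[of _ _ t "{0..T}" "\<lambda>_. z" 0] by simp
    qed
    have g0: "\<delta> t = g 0 t" for t by (simp add: g_def \<delta>_def)
    have Ck: "C_k_on T (p - 1) \<delta>"
      by (rule C_k_onI[OF T g _ g0]) (auto simp: g_def intro!: continuous_intros)
    have r: "r \<in> D" "l *\<^sub>R E r - A r = z"
      using resolvent_in[OF res[OF l'(1)]] resolvent_eq[OF res[OF l'(1)]]
      by (simp_all add: r_def scaleC_of_real)
    have Ax: "A (x t) + \<delta> t = (l * exp (l * t)) *\<^sub>R E r" for t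
    proof -
      have "A (x t) + \<delta> t = exp (l * t) *\<^sub>R (A r + z)"
        by (simp add: x_def \<delta>_def clinear_on_scaleR[OF A r(1)] scaleR_add_right)
      also have "A r + z = l *\<^sub>R E r" using r(2) by (simp add: algebra_simps)
      finally show ?thesis by (simp add: mult.commute)
    qed
    have sol: "classical_solution T E D A \<delta> x"
    proof (rule classical_solutionI[OF T])
      show "x t \<in> D" for t
        unfolding x_def by (rule csubspace_scaleR[OF clinear_on_csubspace[OF A] r(1)])
      have "((\<lambda>t. exp (l * t)) has_real_derivative l * exp (l * t)) (at t within {0..T})" for t
        by (auto intro!: derivative_eq_intros)
      then show "((\<lambda>s. E (x s)) has_vector_derivative A (x t) + \<delta> t) (at t within {0..T})" for t
        unfolding Ax unfolding x_def bounded_clinear_scaleR[OF E]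
        using has_vector_derivative_scaleR[of _ _ t "{0..T}" "\<lambda>_. E r" 0] by simp
      show "continuous_on {0..T} (\<lambda>t. A (x t) + \<delta> t)"
        unfolding Ax by (intro continuous_intros)
    qed
    \<comment> \<open>The factor \<open>real p + 1\<close> unifies both cases: the integral of
      \<open>exp (l * s)\<close> is at most \<open>exp (l * T) / l\<close>, and the sum has
      \<open>p\<close> terms.\<close>
    have rhs: "(if p = 0 then integral {0..T} (\<lambda>s. norm (\<delta> s))
         else (\<Sum>i<p. SUP s\<in>{0..T}. norm (iter_deriv T i \<delta> s))) \<le>
        exp (l * T) * ((real p + 1) * (l ^ p / l) * norm z)"
    proof (cases "p = 0")
      case True
      have "((\<lambda>s. exp (l * s) * norm z) has_integral
          (exp (l * T) / l * norm z - exp (l * 0) / l * norm z)) {0..T}"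
        using T l'
        by (intro fundamental_theorem_of_calculus)
          (auto simp flip: has_real_derivative_iff_has_vector_derivative
            intro!: derivative_eq_intros)
      from integral_unique[OF this]
      have "integral {0..T} (\<lambda>s. norm (\<delta> s)) = exp (l * T) / l * norm z - 1 / l * norm z"
        by (simp add: \<delta>_def del: integral_mult_left)
      also have "\<dots> \<le> exp (l * T) / l * norm z" using l' by simp
      finally show ?thesis using True by simp
    next
      case False
      have "(\<Sum>i<p. SUP s\<in>{0..T}. norm (iter_deriv T i \<delta> s)) \<le>
          (\<Sum>i<p. exp (l * T) * ((l ^ p / l) * norm z))"
      proof (intro sum_mono cSUP_least)
        fix i s assume i: "i \<in> {..<p}" and s: "s \<in> {0..T}"
        have "iter_deriv T i \<delta> s = g i s"
          by (rule iter_deriv_eqI[OF T g g0 order_refl s])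
        then have "norm (iter_deriv T i \<delta> s) = l ^ i * exp (l * s) * norm z"
          using l' by (simp add: g_def abs_mult)
        also have "\<dots> \<le> (l ^ p / l) * exp (l * T) * norm z"
        proof (intro mult_right_mono mult_mono)
          have "l ^ i \<le> l ^ (p - 1)" using i l' by (intro power_increasing) auto
          also have "\<dots> = l ^ p / l" using False l' by (cases p) auto
          finally show "l ^ i \<le> l ^ p / l" .
        qed (use s l' in auto)
        finally show "norm (iter_deriv T i \<delta> s) \<le> exp (l * T) * ((l ^ p / l) * norm z)"
          by (simp add: mult_ac)
      qed (use T in auto)
      also have "\<dots> = real p * (exp (l * T) * ((l ^ p / l) * norm z))" by simp
      also have "\<dots> \<le> (real p + 1) * (exp (l * T) * ((l ^ p / l) * norm z))"
        using l' by (intro mult_right_mono) auto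
      finally show ?thesis using False by (simp add: mult_ac)
    qed
    have "exp (l * T) * norm r = norm (x T)" by (simp add: x_def)
    also have "\<dots> \<le> c * (norm (x 0) + (if p = 0 then integral {0..T} (\<lambda>s. norm (\<delta> s))
         else (\<Sum>i<p. SUP s\<in>{0..T}. norm (iter_deriv T i \<delta> s))))"
      using T by (intro bound Ck sol) auto
    also have "\<dots> \<le> c * (norm (x 0) + exp (l * T) * ((real p + 1) * (l ^ p / l) * norm z))"
      using rhs c by (intro mult_left_mono add_left_mono) auto
    also have "\<dots> = c * norm r + exp (l * T) * (c * ((real p + 1) * (l ^ p / l) * norm z))"
      by (simp add: x_def algebra_simps)
    also have "c * norm r \<le> exp (l * T) / 2 * norm r"
    proof (rule mult_right_mono)
      show "c \<le> exp (l * T) / 2" using l'(3) exp_ge_add_one_self[of "l * T"] by linarith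
    qed simp
    finally have "exp (l * T) * norm r \<le>
        exp (l * T) * (norm r / 2 + c * ((real p + 1) * (l ^ p / l) * norm z))"
      by (simp add: algebra_simps)
    then have "norm r \<le> norm r / 2 + c * ((real p + 1) * (l ^ p / l) * norm z)" by simp
    then have "norm r \<le> 2 * (c * ((real p + 1) * (l ^ p / l) * norm z))" by linarith
    then show ?thesis unfolding r_def by (simp only: mult_ac)
  qed
  show ?thesis
    using est c res by (intro resolvent_growthI[of \<omega>' _ _ _ "2 * c * (real p + 1)"])
      (auto simp: \<omega>'_def)
qed

section \<open>Pencils in Weierstrass form\<close>

text \<open>The isomorphisms of the equivalence are fixed once, so that \<open>fst (P x)\<close> and
  \<open>snd (P x)\<close> are the Weierstrass coordinates \<open>u\<close> and \<open>v\<close> of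
  \<open>x\<close>. In them the equation decouples into \<open>u' = A1 u + f\<close> and
  \<open>(N v)' = v + g\<close>.\<close>

locale weierstrass_pencil =
  fixes E :: "'x::complex_banach \<Rightarrow> 'z::complex_banach" and D :: "'x set" and A :: "'x \<Rightarrow> 'z"
    and N :: "'y2::complex_hilbert \<Rightarrow> 'y2" and D1 :: "'y1::complex_hilbert set" and A1 :: "'y1 \<Rightarrow> 'y1"
    and P :: "'x \<Rightarrow> 'y1 \<times> 'y2" and Q :: "'z \<Rightarrow> 'y1 \<times> 'y2" and \<nu> :: nat
  assumes N: "bounded_clinear N" and degree: "nilpotency_degree N \<nu>"
    and A1: "clinear_on D1 A1" and P: "bounded_iso P" and Q: "bounded_iso Q"
    and E_eq: "E = inv Q \<circ> (\<lambda>(u, v). (u, N v)) \<circ> P"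
    and D_eq: "D = P -` (D1 \<times> UNIV)"
    and A_eq: "\<And>x. x \<in> D \<Longrightarrow> A x = inv Q ((\<lambda>(u, v). (A1 u, v)) (P x))"
begin

lemma bounded_P: "bounded_clinear P" and bounded_invP: "bounded_clinear (inv P)"
  and bounded_Q: "bounded_clinear Q" and bounded_invQ: "bounded_clinear (inv Q)"
  using P Q by (auto simp: bounded_iso_def)

lemma P_invP [simp]: "P (inv P y) = y" and invP_P [simp]: "inv P (P x) = x"
  and Q_invQ [simp]: "Q (inv Q y) = y" and invQ_Q [simp]: "inv Q (Q z) = z"
  using P Q by (auto simp: bounded_iso_def bij_def surj_f_inv_f)

lemma N_power_nilpotent: "\<nu> \<le> k \<Longrightarrow> (N ^^ k) v = 0"
proof -
  assume "\<nu> \<le> k"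
  then have "N ^^ k = N ^^ \<nu> \<circ> N ^^ (k - \<nu>)" by (simp flip: funpow_add)
  then show ?thesis using degree by (simp add: nilpotency_degree_def)
qed

lemma N_power_neq_0:
  assumes "l < \<nu>"
  obtains v where "(N ^^ l) v \<noteq> 0"
  using degree assms by (auto simp: nilpotency_degree_def fun_eq_iff)

lemma D1_0: "0 \<in> D1" and A1_0: "A1 0 = 0"
  using A1 clinear_on_csubspace csubspace_0 clinear_on_0 by blast+

lemma N_0: "N 0 = 0"
  by (rule bounded_clinear_0[OF N])

lemma invP_in_D [simp]: "inv P (u, v) \<in> D \<longleftrightarrow> u \<in> D1"
  by (simp add: D_eq)

lemma in_D_iff: "x \<in> D \<longleftrightarrow> fst (P x) \<in> D1"
  by (auto simp: D_eq mem_Times_iff)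

lemma E_invP: "E (inv P (u, v)) = inv Q (u, N v)"
  by (simp add: E_eq)

lemma A_invP: "u \<in> D1 \<Longrightarrow> A (inv P (u, v)) = inv Q (A1 u, v)"
  by (simp add: A_eq)

lemma Q_E: "Q (E x) = (fst (P x), N (snd (P x)))"
  by (simp add: E_eq case_prod_unfold)

lemma Q_A: "x \<in> D \<Longrightarrow> Q (A x) = (A1 (fst (P x)), snd (P x))"
  by (simp add: A_eq case_prod_unfold)

lemma inv_eq_0 [simp]: "inv P (0, 0) = 0" "inv Q (0, 0) = 0"
  using bounded_clinear_0[OF bounded_invP] bounded_clinear_0[OF bounded_invQ]
  by (simp_all add: zero_prod_def)

lemma invP_eq_0_iff [simp]: "inv P y = 0 \<longleftrightarrow> y = 0" and invQ_eq_0_iff [simp]: "inv Q y = 0 \<longleftrightarrow> y = 0"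
  by (metis P_invP bounded_P bounded_invP bounded_clinear_0)
    (metis Q_invQ bounded_Q bounded_invQ bounded_clinear_0)

section \<open>The degree of nilpotency and the growth of the resolvent\<close>

text \<open>Under \<open>l N - I\<close> the sum telescopes and its last term vanishes with
  \<open>N ^^ \<nu>\<close>; the first coordinate stays 0 because \<open>A1 0 = 0\<close>.\<close>

lemma resolvent_invQ_nilpotent:
  assumes l: "complex_of_real l \<in> resolvent_set E D A"
  shows "resolvent E D A (complex_of_real l) (inv Q (0, v)) = - inv P (0, \<Sum>k<\<nu>. l ^ k *\<^sub>R (N ^^ k) v)"
proof -
  define y where "y = (\<Sum>k<\<nu>. l ^ k *\<^sub>R (N ^^ k) v)"
  define f where "f k = l ^ k *\<^sub>R (N ^^ k) v" for k
  have "l *\<^sub>R N y = (\<Sum>k<\<nu>. f (Suc k))"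
    unfolding y_def f_def using bounded_clinear_linear[OF N]
    by (simp add: linear_sum bounded_linear.linear bounded_clinear_scaleR[OF N] scaleR_sum_right)
  then have "l *\<^sub>R N y - y = (\<Sum>k<\<nu>. f (Suc k) - f k)"
    by (simp add: y_def f_def sum_subtractf)
  also have "\<dots> = f \<nu> - f 0" by (rule sum_lessThan_telescope)
  also have "\<dots> = - v" by (simp add: f_def N_power_nilpotent)
  finally have ly: "l *\<^sub>R N y - y = - v" .
  have "- inv P (0, y) = inv P (0, - y)"
    using bounded_clinear_diff[OF bounded_invP, of 0 "(0, y)"] bounded_clinear_0[OF bounded_invP]
    by (simp add: zero_prod_def)
  moreover have "complex_of_real l *\<^sub>C E (inv P (0, - y)) - A (inv P (0, - y)) = inv Q (0, v)"
  proof -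
    have "complex_of_real l *\<^sub>C E (inv P (0, - y)) - A (inv P (0, - y)) =
        inv Q (l *\<^sub>R (0, N (- y)) - (0, - y))"
      by (simp only: E_invP A_invP[OF D1_0] A1_0 scaleC_of_real bounded_clinear_diff[OF bounded_invQ]
          bounded_clinear_scaleR[OF bounded_invQ])
    also have "l *\<^sub>R (0, N (- y)) - (0, - y) = (0, - (l *\<^sub>R N y - y))"
      using bounded_clinear_diff[OF N, of 0 y] by (simp add: N_0)
    finally show ?thesis by (simp add: ly)
  qed
  ultimately show ?thesis
    using resolvent_unique[OF l, of "inv P (0, - y)" "inv Q (0, v)"] D1_0 by (simp add: y_def)
qed

text \<open>On the nilpotent component the resolvent is a polynomial in \<open>l\<close> of degree
  \<open>m = \<nu> - 1\<close>. For \<open>p \<le> m\<close>, growth of order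
  \<open>l ^ p / l\<close> leaves no room for the top coefficient \<open>(N ^^ m) v\<close>: after
  division by \<open>l ^ m\<close> it is bounded by \<open>c / l\<close>, which tends to 0.\<close>

lemma nilpotency_le_resolvent_growth:
  assumes growth: "resolvent_growth E D A p"
  shows "\<nu> \<le> p"
proof (rule ccontr)
  assume "\<not> \<nu> \<le> p"
  then obtain m where m: "\<nu> = Suc m" "p \<le> m" by (cases \<nu>) auto
  obtain \<omega> C where \<omega>: "\<omega> \<ge> 1" and C: "C > 0"
    and res: "\<And>l. l > \<omega> \<Longrightarrow> complex_of_real l \<in> resolvent_set E D A"
    and bound: "\<And>l z. l > \<omega> \<Longrightarrow> norm (resolvent E D A (complex_of_real l) z) \<le> C * (l ^ p / l) * norm z"
    using resolvent_growthD[OF growth] by blast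
  obtain v where v: "(N ^^ m) v \<noteq> 0" using N_power_neq_0[of m] m by auto
  obtain K where K: "K > 0" "\<And>x. norm (P x) \<le> norm x * K"
    using bounded_linear.pos_bounded[OF bounded_clinear_linear[OF bounded_P]] by blast
  \<comment> \<open>\<open>c\<close> collects the resolvent bound and the lower coefficients, whose
    powers of \<open>l\<close> are all at most \<open>l ^ m / l\<close>.\<close>
  define c where "c = K * C * norm (inv Q (0, v)) + (\<Sum>k<m. norm ((N ^^ k) v))"
  have est: "norm ((N ^^ m) v) \<le> c / l" if l: "l > \<omega>" for l
  proof -
    have l1: "l > 1" using l \<omega> by simp
    define y where "y = (\<Sum>k<\<nu>. l ^ k *\<^sub>R (N ^^ k) v)"
    have mono: "l ^ k \<le> l ^ m / l" if "k < m" for k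
      using power_increasing[of "Suc k" m l] that l1 by (simp add: field_simps)
    have mono': "l ^ p / l \<le> l ^ m / l"
      using l1 m by (intro divide_right_mono power_increasing) auto
    let ?r = "resolvent E D A (complex_of_real l) (inv Q (0, v))"
    have "norm y = norm (P ?r)"
      using bounded_clinear_diff[OF bounded_P, of 0 "inv P (0, y)"] bounded_clinear_0[OF bounded_P]
      by (simp add: resolvent_invQ_nilpotent[OF res[OF l]] y_def norm_Pair)
    also have "\<dots> \<le> K * norm ?r" using K(2) by (simp add: mult.commute)
    also have "\<dots> \<le> K * (C * (l ^ p / l) * norm (inv Q (0, v)))"
      using bound[OF l] K(1) by (intro mult_left_mono) auto
    also have "\<dots> \<le> K * (C * (l ^ m / l) * norm (inv Q (0, v)))"
      using mono' K(1) C by (intro mult_left_mono mult_right_mono) auto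
    finally have 1: "norm y \<le> (l ^ m / l) * (K * C * norm (inv Q (0, v)))" by (simp add: mult_ac)
    have "l ^ m *\<^sub>R (N ^^ m) v = y - (\<Sum>k<m. l ^ k *\<^sub>R (N ^^ k) v)"
      by (simp add: y_def m)
    then have "norm (l ^ m *\<^sub>R (N ^^ m) v) \<le> norm y + norm (\<Sum>k<m. l ^ k *\<^sub>R (N ^^ k) v)"
      by (simp add: norm_triangle_ineq4)
    moreover have "norm (\<Sum>k<m. l ^ k *\<^sub>R (N ^^ k) v) \<le> (\<Sum>k<m. (l ^ m / l) * norm ((N ^^ k) v))"
      using mono l1 by (intro sum_norm_le) (simp add: mult_right_mono del: times_divide_eq_left)
    moreover have "norm (l ^ m *\<^sub>R (N ^^ m) v) = l ^ m * norm ((N ^^ m) v)" using l1 by simp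
    ultimately have "l ^ m * norm ((N ^^ m) v) \<le> (l ^ m / l) * c"
      using 1 unfolding c_def distrib_left sum_distrib_left by linarith
    then have "l ^ m * norm ((N ^^ m) v) \<le> l ^ m * (c / l)" by simp
    then show ?thesis using l1 by (simp only: mult_le_cancel_left_pos zero_less_power)
  qed
  have "((\<lambda>l. c / l) \<longlongrightarrow> 0) at_top"
    by (rule tendsto_divide_0[OF tendsto_const])
      (simp add: filterlim_at_top_imp_at_infinity filterlim_ident)
  moreover have "\<forall>\<^sub>F l in at_top. norm ((N ^^ m) v) \<le> c / l"
    using eventually_gt_at_top[of \<omega>] by eventually_elim (rule est)
  ultimately have "norm ((N ^^ m) v) \<le> 0"
    by (intro tendsto_lowerbound[of _ 0 at_top]) auto
  with v show False by simp
qed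

section \<open>Chains\<close>

text \<open>\<open>E (x 1) = 0\<close> kills the first coordinate of \<open>x 1\<close>, so the
  second one, \<open>v 1\<close>, is nonzero. The chain condition reads
  \<open>v k = N (v (k + 1))\<close>, hence \<open>v 1 = (N ^^ (p - 1)) (v p)\<close>.\<close>

lemma chain_length_le:
  assumes ch: "is_chain E D A p x"
  shows "p \<le> \<nu>"
proof -
  define u v where "u k = fst (P (x k))" and "v k = snd (P (x k))" for k
  have p: "1 \<le> p" and x1: "E (x 1) = 0" "x 1 \<noteq> 0"
    and xD: "\<And>k. 1 \<le> k \<Longrightarrow> k < p \<Longrightarrow> x k \<in> D"
    and xE: "\<And>k. 1 \<le> k \<Longrightarrow> k < p \<Longrightarrow> E (x (k + 1)) = A (x k)"
    using ch by (auto simp: is_chain_def)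
  have "u 1 = 0"
    using Q_E[of "x 1", unfolded x1(1)] bounded_clinear_0[OF bounded_Q]
    by (simp add: u_def zero_prod_def)
  moreover have "x 1 = inv P (u 1, v 1)" by (simp add: u_def v_def)
  ultimately have v1: "v 1 \<noteq> 0" using x1(2) by (auto simp: zero_prod_def)
  have vN: "v k = N (v (k + 1))" if "1 \<le> k" "k < p" for k
    using Q_E[of "x (k + 1)"] Q_A[OF xD[OF that]] xE[OF that] by (simp add: v_def)
  have "v 1 = (N ^^ k) (v (k + 1))" if "k < p" for k
    using that
  proof (induction k)
    case (Suc k)
    then have "v 1 = (N ^^ k) (v (Suc k))" by simp
    also have "v (Suc k) = N (v (Suc (Suc k)))" using vN[of "Suc k"] Suc.prems by simp
    finally show ?case by (simp add: funpow_swap1)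
  qed simp
  from this[of "p - 1"] p have "v 1 = (N ^^ (p - 1)) (v p)" by simp
  with v1 have "\<not> \<nu> \<le> p - 1" using N_power_nilpotent by metis
  then show ?thesis by simp
qed

text \<open>The orbit under \<open>N\<close> of a vector \<open>v\<close> with
  \<open>(N ^^ (\<nu> - 1)) v \<noteq> 0\<close>, read backwards and ending in \<open>v\<close>
  itself, is a chain of full length.\<close>

lemma chain_exists:
  assumes "\<nu> > 0"
  shows "\<exists>x. is_chain E D A \<nu> x"
proof -
  obtain v where v: "(N ^^ (\<nu> - 1)) v \<noteq> 0" using N_power_neq_0[of "\<nu> - 1"] assms by auto
  define x where "x k = inv P (0, (N ^^ (\<nu> - k)) v)" for k
  have N_step: "N ((N ^^ (\<nu> - Suc k)) v) = (N ^^ (\<nu> - k)) v" if "k < \<nu>" for k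
    using that by (metis Suc_diff_Suc comp_apply funpow.simps(2))
  have "is_chain E D A \<nu> x"
    unfolding is_chain_def
  proof (intro conjI ballI)
    show "E (x 1) = 0"
      using N_step[of 0] assms by (simp add: x_def E_invP N_power_nilpotent)
    show "x 1 \<noteq> 0" using v by (simp add: x_def zero_prod_def)
    fix k assume k: "k \<in> {1..<\<nu>}"
    show "x k \<in> D" by (simp add: x_def D1_0)
    have Ax: "A (x k) = inv Q (0, (N ^^ (\<nu> - k)) v)" by (simp add: x_def A_invP D1_0 A1_0)
    \<comment> \<open>A further \<open>k - 1\<close> applications of \<open>N\<close> lead to the
      nonzero end of the orbit, so the vector itself is nonzero.\<close>
    have "(N ^^ (\<nu> - 1)) v = (N ^^ (k - 1)) ((N ^^ (\<nu> - k)) v)"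
      using k by (simp flip: funpow_add comp_apply[of "N ^^ _"])
    then have "(N ^^ (\<nu> - k)) v \<noteq> 0"
      using v bounded_linear.linear[OF bounded_linear_funpow[OF bounded_clinear_linear[OF N]]]
      by (metis linear_0)
    then show "A (x k) \<noteq> 0" by (simp add: Ax zero_prod_def)
    show "E (x (k + 1)) = A (x k)"
      unfolding Ax using k N_step[of k] by (simp add: x_def E_invP)
  qed (use assms in simp)
  then show ?thesis by blast
qed

lemma chain_index_eq:
  assumes "chain_index E D A m"
  shows "m = \<nu>"
proof -
  let ?S = "{p. \<exists>x. is_chain E D A p x}"
  have m: "m = Sup ?S" using assms by (simp add: chain_index_def)
  show ?thesis
  proof (cases "\<nu> = 0")
    case True
    \<comment> \<open>A chain has length at least 1, so \<open>\<nu> = 0\<close> leaves none, and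
      \<open>Sup {} = 0\<close> on the natural numbers.\<close>
    then have "?S = {}" using chain_length_le by (fastforce simp: is_chain_def)
    then show ?thesis using m True by simp
  next
    case False
    then show ?thesis unfolding m
      using chain_exists chain_length_le by (intro cSup_eq_maximum) auto
  qed
qed

end

section \<open>The degree of nilpotency and the differentiation index\<close>

definition differentiation_property ::
    "('x::complex_banach \<Rightarrow> 'z::complex_banach) \<Rightarrow> 'x set \<Rightarrow> ('x \<Rightarrow> 'z) \<Rightarrow> nat \<Rightarrow> bool" where
  "differentiation_property E D A \<mu> \<longleftrightarrow> (\<exists>V nV DS S.
     banach_on V nV \<and> densely_embedded V nV \<and> generates_C0_semigroup V nV DS S \<and>
     (\<forall>x \<in> ker_deriv_array E D A \<mu>. x 0 \<in> DS \<and> x 1 = S (x 0)))"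

lemma differentiation_index_iff:
  "differentiation_index E D A = is_smallest (differentiation_property E D A)"
  by (simp add: differentiation_index_def differentiation_property_def[abs_def])

text \<open>For \<open>\<mu> < \<nu>\<close> the array does not determine \<open>x 1\<close> from
  \<open>x 0\<close>: a vector \<open>w\<close> killed by \<open>N ^^ (\<mu> + 1)\<close> but not by
  \<open>N ^^ \<mu>\<close> gives a kernel element with \<open>x 0 = 0\<close> and
  \<open>x 1 \<noteq> 0\<close>, whereas a generator maps 0 to 0.\<close>

lemma (in weierstrass_pencil) nilpotency_le_differentiation:
  assumes "differentiation_property E D A \<mu>"
  shows "\<nu> \<le> \<mu>"
proof (rule ccontr)
  assume "\<not> \<nu> \<le> \<mu>"
  then have \<mu>: "\<mu> < \<nu>" by simp
  obtain V nV DS S where ban: "banach_on V nV" and gen: "generates_C0_semigroup V nV DS S"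
    and ker: "\<And>x. x \<in> ker_deriv_array E D A \<mu> \<Longrightarrow> x 0 \<in> DS \<and> x 1 = S (x 0)"
    using assms unfolding differentiation_property_def by blast
  obtain G where G: "C0_semigroup V nV G"
    and S: "\<And>x. x \<in> DS \<Longrightarrow> S x \<in> V \<and> generator_limit nV G x (S x)"
    using gen unfolding generates_C0_semigroup_def by blast
  obtain v where v: "(N ^^ (\<nu> - 1)) v \<noteq> 0" using N_power_neq_0[of "\<nu> - 1"] \<mu> by auto
  define w where "w = (N ^^ (\<nu> - 1 - \<mu>)) v"
  have w: "(N ^^ \<mu>) w \<noteq> 0" "(N ^^ (\<mu> + 1)) w = 0"
    using v \<mu> N_power_nilpotent[of \<nu> v]
    by (simp_all add: w_def flip: funpow_add comp_apply[of "N ^^ _"] comp_apply[of N] funpow.simps(2))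
  define x where "x i = inv P (0, (N ^^ (\<mu> + 1 - i)) w)" for i
  have "x \<in> ker_deriv_array E D A \<mu>"
  proof -
    have "N ((N ^^ (\<mu> - i)) w) = (N ^^ (\<mu> + 1 - i)) w" if "i \<le> \<mu>" for i
      using that by (simp add: Suc_diff_le)
    then show ?thesis
      by (auto simp: ker_deriv_array_def x_def D1_0 A_invP A1_0 E_invP)
  qed
  then have "x 0 \<in> DS" "x 1 = S (x 0)" using ker by blast+
  then have 0: "0 \<in> DS" "x 1 = S 0" using w(2) by (simp_all add: x_def)
  \<comment> \<open>\<open>S\<close> is pinned down by the limit relation alone, so
    \<open>S 0 = 0\<close> is read off from the difference quotient of the orbit of 0, which is
    constant.\<close>
  have S0: "S 0 \<in> V" "generator_limit nV G 0 (S 0)" using S[OF 0(1)] by auto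
  have "\<forall>\<^sub>F h in at_right 0. nV ((1 / h) *\<^sub>R (G h 0 - 0) - S 0) = nV (- S 0)"
    unfolding eventually_at_filter
    by (intro always_eventually) (simp add: clinear_on_0[OF C0_semigroup_clinear[OF G]])
  then have "((\<lambda>h::real. nV (- S 0)) \<longlongrightarrow> 0) (at_right 0)"
    using tendsto_cong S0(2)[unfolded generator_limit_def] by fastforce
  then have "nV (- S 0) = 0" by (simp add: tendsto_const_iff)
  then have "S 0 = 0"
    using banach_on_eq_0[OF ban] banach_on_scaleR[OF ban S0(1), of "-1"] S0(1) by simp
  with 0(2) w(1) show False by (simp add: x_def zero_prod_def)
qed

section \<open>Extension of operators from dense subspaces\<close>

lemma bounded_clinear_eq_on_dense:
  assumes f: "bounded_clinear f" and g: "bounded_clinear g"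
    and U: "closure U = UNIV" and eq: "\<And>x. x \<in> U \<Longrightarrow> f x = g x"
  shows "f x = g x"
proof -
  have "x \<in> closure U" using U by simp
  then obtain u where u: "\<And>n. u n \<in> U" "u \<longlonglongrightarrow> x" unfolding closure_sequential by blast
  have "(\<lambda>n. f (u n)) \<longlonglongrightarrow> f x" "(\<lambda>n. g (u n)) \<longlonglongrightarrow> g x"
    using u(2) f g bounded_linear.tendsto bounded_clinear_linear by blast+
  then show ?thesis using eq u(1) LIMSEQ_unique by fastforce
qed

lemma extension_from_dense_subspace:
  fixes f :: "'a::complex_banach \<Rightarrow> 'b::complex_banach"
  assumes lin: "clinear_on U f" and dense: "closure U = UNIV"
    and bound: "\<And>x. x \<in> U \<Longrightarrow> norm (f x) \<le> c * norm x" and c: "c \<ge> 0"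
  obtains g where "bounded_clinear g" "\<And>x. x \<in> U \<Longrightarrow> g x = f x" "\<And>x. norm (g x) \<le> c * norm x"
proof -
  note U = clinear_on_csubspace[OF lin]
  have "\<exists>u. (\<forall>n. u n \<in> U) \<and> u \<longlonglongrightarrow> x" for x
    using dense closure_sequential[of x U] by auto
  then obtain u where u: "\<And>x n. u x n \<in> U" "\<And>x. u x \<longlonglongrightarrow> x" by metis
  have conv: "(\<lambda>n. f (u x n)) \<longlonglongrightarrow> lim (\<lambda>n. f (u x n))" for x
  proof -
    have "Cauchy (\<lambda>n. f (u x n))"
      unfolding Cauchy_def
    proof (intro allI impI)
      fix e :: real assume "e > 0"
      then have "e / (c + 1) > 0" using c by simp
      then obtain M where M: "\<And>m n. m \<ge> M \<Longrightarrow> n \<ge> M \<Longrightarrow> dist (u x m) (u x n) < e / (c + 1)"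
        using LIMSEQ_imp_Cauchy[OF u(2)[of x]] unfolding Cauchy_def by blast
      have "dist (f (u x m)) (f (u x n)) < e" if "m \<ge> M" "n \<ge> M" for m n
      proof -
        have "dist (f (u x m)) (f (u x n)) = norm (f (u x m - u x n))"
          by (simp add: dist_norm clinear_on_diff[OF lin] u)
        also have "\<dots> \<le> c * norm (u x m - u x n)"
          by (intro bound csubspace_diff[OF U] u)
        also have "\<dots> \<le> (c + 1) * dist (u x m) (u x n)"
          by (simp add: dist_norm mult_right_mono)
        also have "\<dots> < (c + 1) * (e / (c + 1))"
          using M[OF that] c by (intro mult_strict_left_mono) auto
        finally show ?thesis using c by simp
      qed
      then show "\<exists>M. \<forall>m\<ge>M. \<forall>n\<ge>M. dist (f (u x m)) (f (u x n)) < e" by blast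
    qed
    then show ?thesis by (simp add: Cauchy_convergent_iff convergent_LIMSEQ_iff)
  qed
  define g where "g x = lim (\<lambda>n. f (u x n))" for x
  have g: "(\<lambda>n. f (v n)) \<longlonglongrightarrow> g x" if v: "\<And>n. v n \<in> U" "v \<longlonglongrightarrow> x" for v x
  proof -
    have "(\<lambda>n. c * norm (v n - u x n)) \<longlonglongrightarrow> c * norm (x - x)"
      by (intro tendsto_intros v u)
    then have lim0: "(\<lambda>n. c * norm (v n - u x n)) \<longlonglongrightarrow> 0" by simp
    have "(\<lambda>n. f (v n) - f (u x n)) \<longlonglongrightarrow> 0"
    proof (rule Lim_null_comparison[OF _ lim0])
      show "\<forall>\<^sub>F n in sequentially. norm (f (v n) - f (u x n)) \<le> c * norm (v n - u x n)"
        using bound[OF csubspace_diff[OF U v(1) u(1)]]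
        by (simp add: clinear_on_diff[OF lin] v u)
    qed
    from tendsto_add[OF this conv[of x]] show ?thesis by (simp add: g_def)
  qed
  have eq: "g x = f x" if "x \<in> U" for x
    using g[of "\<lambda>_. x" x] that by (simp add: LIMSEQ_const_iff)
  have g_bound: "norm (g x) \<le> c * norm x" for x
  proof (rule LIMSEQ_le)
    show "(\<lambda>n. norm (f (u x n))) \<longlonglongrightarrow> norm (g x)" by (intro tendsto_intros g u)
    show "(\<lambda>n. c * norm (u x n)) \<longlonglongrightarrow> c * norm x" by (intro tendsto_intros u)
  qed (use bound u in auto)
  have g_add: "g (x + y) = g x + g y" for x y
  proof (rule LIMSEQ_unique)
    show "(\<lambda>n. f (u x n + u y n)) \<longlonglongrightarrow> g (x + y)"
      by (intro g tendsto_intros u csubspace_add[OF U])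
    show "(\<lambda>n. f (u x n + u y n)) \<longlonglongrightarrow> g x + g y"
      unfolding clinear_on_add[OF lin u(1) u(1)] by (intro tendsto_intros g u)
  qed
  have blC: "bounded_linear (\<lambda>y :: 'd::complex_banach. a *\<^sub>C y)" for a
    by (rule bounded_linear_intro[of _ "cmod a"])
      (simp_all add: scaleC_add_right scaleR_scaleC scaleC_scaleC mult.commute norm_scaleC)
  have g_scale: "g (a *\<^sub>C x) = a *\<^sub>C g x" for a x
  proof (rule LIMSEQ_unique)
    show "(\<lambda>n. f (a *\<^sub>C u x n)) \<longlonglongrightarrow> g (a *\<^sub>C x)"
      by (intro g csubspace_scaleC[OF U] bounded_linear.tendsto[OF blC] u)
    show "(\<lambda>n. f (a *\<^sub>C u x n)) \<longlonglongrightarrow> a *\<^sub>C g x"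
      unfolding clinear_on_scaleC[OF lin u(1)] by (intro bounded_linear.tendsto[OF blC] g u)
  qed
  have "bounded_linear g"
    using g_add g_bound g_scale
    by (intro bounded_linear_intro[of _ c]) (simp_all add: scaleR_scaleC mult.commute)
  then have "bounded_clinear g" using g_scale by (simp add: bounded_clinear_def)
  then show thesis using eq g_bound that by blast
qed

section \<open>Domains of powers\<close>

locale resolvent_family =
  fixes D1 :: "'y::complex_banach set" and A1 :: "'y \<Rightarrow> 'y" and R :: "real \<Rightarrow> 'y \<Rightarrow> 'y" and \<omega>0 :: real
  assumes A1: "clinear_on D1 A1"
    and R_in: "\<And>l y. l > \<omega>0 \<Longrightarrow> R l y \<in> D1"
    and R_right: "\<And>l y. l > \<omega>0 \<Longrightarrow> l *\<^sub>R R l y - A1 (R l y) = y"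
    and R_left: "\<And>l u. l > \<omega>0 \<Longrightarrow> u \<in> D1 \<Longrightarrow> R l (l *\<^sub>R u - A1 u) = u"
    and R_bounded: "\<And>l. l > \<omega>0 \<Longrightarrow> bounded_clinear (R l)"
    and omega0: "\<omega>0 \<ge> 0"
    and dense: "closure D1 = UNIV"
begin

definition l0 :: real where "l0 = \<omega>0 + 1"

text \<open>The domain of \<open>A1 ^^ k\<close>, written as a range: its elements come with
  preimages under \<open>R l0\<close>, and it is invariant under whatever commutes with
  \<open>R l0\<close>.\<close>

definition dom :: "nat \<Rightarrow> 'y set" where "dom k = range (R l0 ^^ k)"

lemma l0: "l0 > \<omega>0"
  by (simp add: l0_def)

lemmas R_diff = bounded_clinear_diff[OF R_bounded]
  and R_scaleR = bounded_clinear_scaleR[OF R_bounded]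

lemma A1_R: "l > \<omega>0 \<Longrightarrow> A1 (R l y) = l *\<^sub>R R l y - y"
  using R_right[of l y] by (simp add: algebra_simps)

lemma A1_R_commute: "l > \<omega>0 \<Longrightarrow> u \<in> D1 \<Longrightarrow> A1 (R l u) = R l (A1 u)"
  using R_left[of l u] A1_R[of l u] by (simp add: R_diff R_scaleR algebra_simps)

lemma R_commute:
  assumes l: "l > \<omega>0" and m: "m > \<omega>0"
  shows "R l (R m y) = R m (R l y)"
proof -
  have "l *\<^sub>R R m (R l y) - A1 (R m (R l y)) = R m (l *\<^sub>R R l y - A1 (R l y))"
    using R_in[OF l] m by (simp add: A1_R_commute R_diff R_scaleR)
  then have "l *\<^sub>R R m (R l y) - A1 (R m (R l y)) = R m y" using R_right[OF l] by simp
  then show ?thesis using R_left[OF l R_in[OF m], of "R l y"] by simp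
qed

lemma R_power_commute: "l > \<omega>0 \<Longrightarrow> R l ((R l0 ^^ k) y) = (R l0 ^^ k) (R l y)"
  by (induction k) (simp_all add: R_commute[OF _ l0])

lemma R_power_bounded: "bounded_clinear (R l0 ^^ k)"
proof (induction k)
  case 0
  then show ?case by (simp add: bounded_clinear_def id_def bounded_linear_ident)
next
  case (Suc k)
  then show ?case using bounded_clinear_compose[OF R_bounded[OF l0] Suc] by (simp add: comp_def)
qed

lemma dom_csubspace: "csubspace (dom k)"
  unfolding csubspace_def dom_def
proof (intro conjI ballI allI; (elim rangeE)?)
  show "0 \<in> range (R l0 ^^ k)"
    using bounded_clinear_0[OF R_power_bounded, of k] by (metis rangeI)
  show "x + y \<in> range (R l0 ^^ k)" if "x = (R l0 ^^ k) a" "y = (R l0 ^^ k) b" for x y a b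
    using bounded_clinear_add[OF R_power_bounded, of k a b] that by (metis rangeI)
  show "c *\<^sub>C x \<in> range (R l0 ^^ k)" if "x = (R l0 ^^ k) a" for c x a
    using bounded_clinear_scaleC[OF R_power_bounded, of k c a] that by (metis rangeI)
qed

lemma dom_SucI: "y \<in> dom k \<Longrightarrow> R l0 y \<in> dom (Suc k)"
  by (auto simp: dom_def)

lemma dom_SucE:
  assumes "u \<in> dom (Suc k)"
  obtains y where "y \<in> dom k" "u = R l0 y"
  using assms by (auto simp: dom_def)

lemma dom_Suc_subset: "dom (Suc k) \<subseteq> dom k"
  unfolding dom_def funpow_Suc_right by auto

lemma dom_antimono: "k \<le> j \<Longrightarrow> dom j \<subseteq> dom k"
  by (rule lift_Suc_antimono_le[of dom]) (rule dom_Suc_subset)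

lemma dom_Suc_D1: "dom (Suc k) \<subseteq> D1"
  using R_in[OF l0] by (auto elim: dom_SucE)

lemma dom_R: "l > \<omega>0 \<Longrightarrow> u \<in> dom k \<Longrightarrow> R l u \<in> dom k"
  by (auto simp: dom_def R_power_commute)

lemma dom_A1:
  assumes "u \<in> dom (Suc k)"
  shows "A1 u \<in> dom k"
proof -
  obtain y where y: "y \<in> dom k" "u = R l0 y" using assms by (rule dom_SucE)
  then show ?thesis
    using csubspace_diff[OF dom_csubspace csubspace_scaleR[OF dom_csubspace]] dom_R[OF l0 y(1)]
    by (simp add: A1_R[OF l0])
qed

lemma dom_A1_power: "u \<in> dom (k + i) \<Longrightarrow> (A1 ^^ i) u \<in> dom k"
  by (induction i arbitrary: k) (auto simp: dom_A1)

text \<open>\<open>R l0\<close> is continuous and its range contains \<open>D1\<close>, so the image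
  of the dense set \<open>dom k\<close> approximates every element of the dense set
  \<open>D1\<close>.\<close>

lemma dense_dom: "closure (dom k) = UNIV"
proof (induction k)
  case 0
  then show ?case by (simp add: dom_def)
next
  case (Suc k)
  have "D1 \<subseteq> R l0 ` UNIV"
    using R_left[OF l0] by (metis image_iff subsetI UNIV_I)
  also have "\<dots> = R l0 ` closure (dom k)" using Suc by simp
  also have "\<dots> \<subseteq> closure (R l0 ` dom k)"
    using bounded_clinear_linear[OF R_bounded[OF l0]]
    by (intro image_closure_subset closure_subset closed_closure linear_continuous_on)
  also have "R l0 ` dom k \<subseteq> dom (Suc k)" using dom_SucI by blast
  finally have "closure D1 \<subseteq> closure (dom (Suc k))"
    by (simp add: closure_minimal closure_mono)
  then show ?case using dense by auto
qed

text \<open>The backward Euler step \<open>(I - h A1)^-1\<close>; for \<open>h < h0\<close> the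
  point \<open>1 / h\<close> lies beyond \<open>\<omega>0\<close>.\<close>

definition F :: "real \<Rightarrow> 'y \<Rightarrow> 'y" where "F h u = (1 / h) *\<^sub>R R (1 / h) u"

definition h0 :: real where "h0 = 1 / l0"

lemma h0: "h0 > 0"
  using l0 omega0 by (simp add: h0_def)

lemma inverse_step: "0 < h \<Longrightarrow> h < h0 \<Longrightarrow> 1 / h > \<omega>0"
proof -
  assume h: "0 < h" "h < h0"
  then have "1 / h > 1 / h0" by (intro divide_strict_left_mono) auto
  then show "1 / h > \<omega>0" using l0 by (simp add: h0_def)
qed

lemma F_dom: "0 < h \<Longrightarrow> h < h0 \<Longrightarrow> u \<in> dom k \<Longrightarrow> (F h ^^ j) u \<in> dom k"
  by (induction j) (auto simp: F_def inverse_step intro!: csubspace_scaleR[OF dom_csubspace] dom_R)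

lemma A1_F: "0 < h \<Longrightarrow> h < h0 \<Longrightarrow> A1 (F h u) = (1 / h) *\<^sub>R (F h u - u)"
  using R_in[OF inverse_step] by (simp add: F_def clinear_on_scaleR[OF A1] A1_R inverse_step scaleR_diff_right)

lemma F_in_D1: "0 < h \<Longrightarrow> h < h0 \<Longrightarrow> F h u \<in> D1"
  unfolding F_def by (intro csubspace_scaleR[OF clinear_on_csubspace[OF A1]] R_in inverse_step)

lemma A1_F_commute: "0 < h \<Longrightarrow> h < h0 \<Longrightarrow> u \<in> D1 \<Longrightarrow> A1 ((F h ^^ j) u) = (F h ^^ j) (A1 u)"
proof (induction j)
  case (Suc j)
  have "(F h ^^ j) u \<in> D1" using F_in_D1 Suc.prems by (cases j) auto
  then have "A1 (F h ((F h ^^ j) u)) = F h (A1 ((F h ^^ j) u))"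
    using Suc.prems R_in[OF inverse_step]
    by (simp add: F_def clinear_on_scaleR[OF A1] A1_R_commute inverse_step)
  then show ?case using Suc by simp
qed simp

lemma F_R_commute: "0 < h \<Longrightarrow> h < h0 \<Longrightarrow> (F h ^^ j) (R l0 u) = R l0 ((F h ^^ j) u)"
  by (induction j) (simp_all add: F_def inverse_step R_commute[OF l0] R_scaleR l0)

end

section \<open>Semigroups extending an operator on the domain of a power\<close>

text \<open>The generator of \<open>G\<close>, a semigroup on a space \<open>V\<close> continuously embedded into \<open>'x\<close>, is only known
  to extend \<open>A1\<close> on the domain of some power of \<open>A1\<close>. By the exponential formula,
  \<open>G t (J u)\<close> is a limit of resolvent powers of \<open>A1\<close>, hence stays in the range of \<open>J\<close> and
  commutes with the resolvents of \<open>A1\<close>.\<close>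

locale core_semigroup = resolvent_family D1 A1 R \<omega>0 + quasi_contractive_semigroup V q G \<omega>
  for D1 :: "'y::complex_banach set" and A1 R \<omega>0 and V :: "'x::complex_banach set" and q G \<omega> +
  fixes J :: "'y \<Rightarrow> 'x" and pr :: "'x \<Rightarrow> 'y" and m :: nat and K :: real
  assumes J: "bounded_clinear J" and pr: "bounded_clinear pr" and pr_J [simp]: "\<And>u. pr (J u) = u"
    and embedding: "\<And>x. x \<in> V \<Longrightarrow> norm x \<le> K * q x"
    and core_in: "\<And>u. u \<in> dom m \<Longrightarrow> J u \<in> V"
    and core_gen: "\<And>u. u \<in> dom (Suc m) \<Longrightarrow> generator_limit q G (J u) (J (A1 u))"
begin

lemma core_subset: "u \<in> dom (Suc m) \<Longrightarrow> J u \<in> V" "u \<in> dom (Suc (Suc m)) \<Longrightarrow> J u \<in> V"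
  "u \<in> dom (Suc (Suc (Suc m))) \<Longrightarrow> J u \<in> V"
  using core_in dom_Suc_subset by blast+

text \<open>The generator is known to act as \<open>A1\<close> only on \<open>dom (Suc m)\<close>,
  and the error estimate involves \<open>u\<close>, \<open>A1 u\<close> and
  \<open>A1 (A1 u)\<close>. All three must lie there, which puts \<open>u\<close> three levels above
  \<open>m\<close>.\<close>

lemma exponential_formula_core:
  assumes u: "u \<in> dom (Suc (Suc (Suc m)))" and t: "t > 0"
  shows "(\<lambda>n. q (J ((F (t / real n) ^^ n) u) - G t (J u))) \<longlonglongrightarrow> 0"
proof -
  define FJ where "FJ h x = J (F h (pr x))" for h x
  have FJ: "(FJ h ^^ j) (J v) = J ((F h ^^ j) v)" for h j v
    by (induction j) (simp_all add: FJ_def)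
  have A1u: "A1 u \<in> dom (Suc (Suc m))" "A1 (A1 u) \<in> dom (Suc m)"
    using u by (simp_all add: dom_A1)
  have u': "u \<in> dom (Suc (Suc m))" "u \<in> dom (Suc m)" "A1 u \<in> dom (Suc m)"
    using u A1u dom_Suc_subset by blast+
  have uD1: "u \<in> D1" "A1 u \<in> D1" using u' dom_Suc_D1 by blast+
  have "(\<lambda>n. q ((FJ (t / real n) ^^ n) (J u) - G t (J u))) \<longlonglongrightarrow> 0"
  proof (rule exponential_formula[where C = "J ` dom (Suc m)" and hmax = h0 and a = "J (A1 u)"
        and b = "J (A1 (A1 u))", OF _ h0 _ _ _ _ _ _ _ t])
    show "J ` dom (Suc m) \<subseteq> V" using core_subset by auto
    fix h :: real assume h: "0 < h" "h < h0"
    show "FJ h v \<in> J ` dom (Suc m) \<and> generator_limit q G (FJ h v) ((1 / h) *\<^sub>R (FJ h v - v))"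
      if v: "v \<in> J ` dom (Suc m)" for v
    proof -
      obtain w where w: "w \<in> dom (Suc m)" "v = J w" using v by blast
      have Fw: "F h w \<in> dom (Suc m)" using F_dom[OF h w(1), of 1] by simp
      have "J (A1 (F h w)) = (1 / h) *\<^sub>R (FJ h v - v)"
        by (simp add: A1_F[OF h] FJ_def w bounded_clinear_diff[OF J] bounded_clinear_scaleR[OF J])
      then show ?thesis using core_gen[OF Fw] Fw by (simp add: FJ_def w)
    qed
    fix j
    show "(FJ h ^^ Suc j) (J u) = (FJ h ^^ j) (J u) + h *\<^sub>R (FJ h ^^ Suc j) (J (A1 u))"
    proof -
      have "A1 ((F h ^^ Suc j) u) = (F h ^^ Suc j) (A1 u)" by (rule A1_F_commute[OF h uD1(1)])
      then have "(F h ^^ Suc j) (A1 u) = (1 / h) *\<^sub>R ((F h ^^ Suc j) u - (F h ^^ j) u)"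
        using A1_F[OF h, of "(F h ^^ j) u"] by simp
      then have "(F h ^^ Suc j) u = (F h ^^ j) u + h *\<^sub>R (F h ^^ Suc j) (A1 u)" using h by simp
      then show ?thesis
        unfolding FJ by (metis bounded_clinear_add[OF J] bounded_clinear_scaleR[OF J])
    qed
    show "generator_limit q G ((FJ h ^^ j) (J u)) ((FJ h ^^ j) (J (A1 u)))"
      using core_gen[OF F_dom[OF h u'(2)]] by (simp add: FJ A1_F_commute[OF h uD1(1)])
    show "generator_limit q G ((FJ h ^^ j) (J (A1 u))) ((FJ h ^^ j) (J (A1 (A1 u))))"
      using core_gen[OF F_dom[OF h u'(3)]] by (simp add: FJ A1_F_commute[OF h uD1(2)])
  qed (use u' A1u in auto)
  then show ?thesis by (simp add: FJ)
qed

text \<open>The semigroup \<open>G\<close> compressed to \<open>'y\<close>. The composition law of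
  \<open>G\<close> does not carry over at once: \<open>J (pr x)\<close> may differ from
  \<open>x\<close> on \<open>V\<close>, and \<open>T t u\<close> is not known to stay in
  \<open>dom m\<close>.\<close>

definition T :: "real \<Rightarrow> 'y \<Rightarrow> 'y" where "T t u = pr (G t (J u))"

lemma T_0: "u \<in> dom m \<Longrightarrow> T 0 u = u"
  using core_in by (simp add: T_def G_0)

lemma approximation_in_dom:
  assumes "t > 0"
  shows "\<forall>\<^sub>F n in sequentially. \<forall>u k. u \<in> dom k \<longrightarrow> (F (t / real n) ^^ n) u \<in> dom k"
proof -
  have "\<forall>\<^sub>F n in sequentially. t / real n < h0"
    using order_tendstoD(2)[OF lim_const_over_n h0] .
  then show ?thesis using eventually_gt_at_top[of 0]
    by eventually_elim (use assms F_dom in simp)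
qed

lemma pr_bound:
  obtains c where "c > 0" "\<And>x. x \<in> V \<Longrightarrow> norm (pr x) \<le> c * q x"
proof -
  obtain b where b: "b > 0" "\<And>x. norm (pr x) \<le> norm x * b"
    using bounded_linear.pos_bounded[OF bounded_clinear_linear[OF pr]] by blast
  have "norm (pr x) \<le> b * (\<bar>K\<bar> + 1) * q x" if "x \<in> V" for x
  proof -
    have "norm x \<le> (\<bar>K\<bar> + 1) * q x"
      using embedding[OF that] mult_right_mono[of K "\<bar>K\<bar> + 1" "q x"] q_nonneg[OF that]
        abs_ge_self[of K] by linarith
    then have "b * norm x \<le> b * ((\<bar>K\<bar> + 1) * q x)" using b by (intro mult_left_mono) auto
    then show ?thesis using b(2)[of x] by (simp add: mult_ac)
  qed
  then show thesis using b(1) by (intro that[of "b * (\<bar>K\<bar> + 1)"]) auto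
qed

lemma T_approximation:
  assumes u: "u \<in> dom (Suc (Suc (Suc m)))" and t: "t > 0"
  shows "(\<lambda>n. (F (t / real n) ^^ n) u) \<longlonglongrightarrow> T t u"
proof -
  obtain b where b: "b > 0" "\<And>x. x \<in> V \<Longrightarrow> norm (pr x) \<le> b * q x" using pr_bound by blast
  show ?thesis
  proof (rule Lim_null[THEN iffD2], rule Lim_null_comparison)
    show "(\<lambda>n. b * q (J ((F (t / real n) ^^ n) u) - G t (J u))) \<longlonglongrightarrow> 0"
      using tendsto_mult_left[OF exponential_formula_core[OF assms], of b] by simp
    show "\<forall>\<^sub>F n in sequentially. norm ((F (t / real n) ^^ n) u - T t u) \<le>
        b * q (J ((F (t / real n) ^^ n) u) - G t (J u))"
      using approximation_in_dom[OF t]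
    proof eventually_elim
      fix n assume "\<forall>u k. u \<in> dom k \<longrightarrow> (F (t / real n) ^^ n) u \<in> dom k"
      with u t have "J ((F (t / real n) ^^ n) u) - G t (J u) \<in> V"
        by (intro V_diff G_in core_subset(3)) auto
      from b(2)[OF this] show "norm ((F (t / real n) ^^ n) u - T t u) \<le>
          b * q (J ((F (t / real n) ^^ n) u) - G t (J u))"
        by (simp add: T_def bounded_clinear_diff[OF pr])
    qed
  qed
qed

text \<open>The Euler steps commute with \<open>R l0\<close>, and \<open>R l0\<close> is continuous,
  so the commutation passes to the limit.\<close>

lemma T_R_commute:
  assumes u: "u \<in> dom (Suc (Suc (Suc m)))" and t: "t \<ge> 0"
  shows "T t (R l0 u) = R l0 (T t u)"
proof (cases "t = 0")
  case True
  have "u \<in> dom m" "R l0 u \<in> dom m"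
    using u dom_R[OF l0] dom_Suc_subset by blast+
  then show ?thesis using True by (simp add: T_0)
next
  case False
  with t have t: "t > 0" by simp
  have "\<forall>\<^sub>F n in sequentially. t / real n < h0 \<and> n > 0"
    using order_tendstoD(2)[OF lim_const_over_n h0] eventually_gt_at_top[of 0]
    by (rule eventually_conj)
  then have "\<forall>\<^sub>F n in sequentially. R l0 ((F (t / real n) ^^ n) u) = (F (t / real n) ^^ n) (R l0 u)"
    by eventually_elim (use t in \<open>simp add: F_R_commute\<close>)
  moreover have "(\<lambda>n. R l0 ((F (t / real n) ^^ n) u)) \<longlonglongrightarrow> R l0 (T t u)"
    by (rule bounded_linear.tendsto[OF bounded_clinear_linear[OF R_bounded[OF l0]] T_approximation[OF u t]])
  ultimately have "(\<lambda>n. (F (t / real n) ^^ n) (R l0 u)) \<longlonglongrightarrow> R l0 (T t u)"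
    by (rule Lim_transform_eventually[rotated])
  then show ?thesis
    using T_approximation[OF dom_R[OF l0 u] t] by (rule LIMSEQ_unique[rotated])
qed

lemma T_clinear:
  assumes t: "t \<ge> 0"
  shows "clinear_on (dom (m + k)) (T t)"
proof -
  have sub: "J u \<in> V" if "u \<in> dom (m + k)" for u
    using that core_in dom_antimono[of m "m + k"] by auto
  show ?thesis
    unfolding clinear_on_def
    using sub by (auto simp: dom_csubspace T_def bounded_clinear_add[OF J]
        bounded_clinear_scaleC[OF J] G_add[OF t] clinear_on_scaleC[OF G_clinear[OF t]]
        bounded_clinear_add[OF pr] bounded_clinear_scaleC[OF pr])
qed

text \<open>The fourth level of the domain is spent here: \<open>u = R l0 y\<close> with
  \<open>y\<close> three levels above \<open>m\<close>, so \<open>T t u = R l0 (T t y)\<close> lies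
  in \<open>D1\<close>, and the formula for \<open>A1\<close> after \<open>R l0\<close> gives the
  commutation.\<close>

lemma T_domain:
  assumes u: "u \<in> dom (m + 4)" and t: "t \<ge> 0"
  shows "T t u \<in> D1" "A1 (T t u) = T t (A1 u)"
proof -
  have "u \<in> dom (Suc (m + 3))" using u by (simp add: numeral_eq_Suc)
  then obtain y where y: "y \<in> dom (m + 3)" "u = R l0 y" by (rule dom_SucE)
  have y': "y \<in> dom (Suc (Suc (Suc m)))" using y(1) by (simp add: numeral_eq_Suc)
  have Tu: "T t u = R l0 (T t y)" using T_R_commute[OF y' t] y(2) by simp
  then show "T t u \<in> D1" using R_in[OF l0] by simp
  have "A1 (T t u) = l0 *\<^sub>R T t u - T t y" by (simp add: Tu A1_R[OF l0])
  also have "\<dots> = T t (l0 *\<^sub>R u - y)"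
    using y dom_R[OF l0 y(1)]
    by (simp add: clinear_on_diff[OF T_clinear[OF t, of 3]] clinear_on_scaleR[OF T_clinear[OF t, of 3]]
        csubspace_scaleR[OF dom_csubspace])
  also have "l0 *\<^sub>R u - y = A1 u" by (simp add: y A1_R[OF l0])
  finally show "A1 (T t u) = T t (A1 u)" .
qed

lemma T_lipschitz:
  assumes u: "u \<in> dom (m + 4)"
  obtains c where "c \<ge> 0"
    "\<And>s t. s \<in> {0..\<tau>} \<Longrightarrow> t \<in> {0..\<tau>} \<Longrightarrow>
      norm (T t u - T s u - (t - s) *\<^sub>R T s (A1 u)) \<le> c * (t - s)\<^sup>2"
    "\<And>s t. s \<in> {0..\<tau>} \<Longrightarrow> t \<in> {0..\<tau>} \<Longrightarrow> norm (T t (A1 u) - T s (A1 u)) \<le> c * \<bar>t - s\<bar>"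
proof -
  obtain b where b: "b > 0" "\<And>x. x \<in> V \<Longrightarrow> norm (pr x) \<le> b * q x" using pr_bound by blast
  have u4: "u \<in> dom (Suc (Suc (Suc (Suc m))))" using u by (simp add: numeral_eq_Suc)
  have doms: "u \<in> dom (Suc m)" "A1 u \<in> dom (Suc m)" "A1 (A1 u) \<in> dom (Suc m)"
    using u4 dom_A1 dom_Suc_subset by blast+
  define x y z where "x = J u" and "y = J (A1 u)" and "z = J (A1 (A1 u))"
  have Vs: "x \<in> V" "y \<in> V" "z \<in> V" using doms core_subset by (simp_all add: x_def y_def z_def)
  have gen: "generator_limit q G x y" "generator_limit q G y z"
    using core_gen doms by (simp_all add: x_def y_def z_def)
  define c where "c = b * (6 * exp (2 * \<omega> * \<tau>) * q z)"
  have c: "c \<ge> 0" using b Vs by (simp add: c_def q_nonneg)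
  have T: "T t u = pr (G t x)" "T t (A1 u) = pr (G t y)" for t by (simp_all add: T_def x_def y_def)
  show thesis
  proof (rule that[of c])
    show "c \<ge> 0" by (rule c)
    fix s t assume st: "s \<in> {0..\<tau>}" "t \<in> {0..\<tau>}"
    have "norm (pr (G t y - G s y)) \<le> b * q (G t y - G s y)"
      using st Vs by (intro b V_diff G_in) auto
    also have "\<dots> \<le> b * (\<bar>t - s\<bar> * (3 * exp (2 * \<omega> * \<tau>) * q z))"
      using st b by (intro mult_left_mono orbit_lipschitz[OF gen(2) Vs(2,3)]) auto
    also have "\<dots> \<le> c * \<bar>t - s\<bar>"
      using mult_right_mono[OF c, of "\<bar>t - s\<bar>"] by (simp add: c_def algebra_simps)
    finally show "norm (T t (A1 u) - T s (A1 u)) \<le> c * \<bar>t - s\<bar>"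
      by (simp add: T bounded_clinear_diff[OF pr])
    have "norm (pr (G t x - G s x - (t - s) *\<^sub>R G s y)) \<le> b * q (G t x - G s x - (t - s) *\<^sub>R G s y)"
      using st Vs by (intro b V_diff V_scaleR G_in) auto
    also have "\<dots> \<le> b * ((t - s)\<^sup>2 * (6 * exp (2 * \<omega> * \<tau>) * q z))"
      using st b by (intro mult_left_mono orbit_taylor[OF gen(1) Vs(1) gen(2) Vs(2,3)]) auto
    also have "\<dots> = c * (t - s)\<^sup>2" by (simp add: c_def algebra_simps)
    finally show "norm (T t u - T s u - (t - s) *\<^sub>R T s (A1 u)) \<le> c * (t - s)\<^sup>2"
      by (simp add: T bounded_clinear_diff[OF pr] bounded_clinear_scaleR[OF pr])
  qed
qed

lemma T_has_derivative:
  assumes u: "u \<in> dom (m + 4)" and s: "s \<in> {0..\<tau>}"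
  shows "((\<lambda>t. T t u) has_vector_derivative T s (A1 u)) (at s within {0..\<tau>})"
proof -
  obtain c where c: "c \<ge> 0" "\<And>s t. s \<in> {0..\<tau>} \<Longrightarrow> t \<in> {0..\<tau>} \<Longrightarrow>
      norm (T t u - T s u - (t - s) *\<^sub>R T s (A1 u)) \<le> c * (t - s)\<^sup>2"
    using T_lipschitz[OF u, of \<tau>] by metis
  show ?thesis
    unfolding has_vector_derivative_def has_derivative_within_alt
  proof (intro conjI allI impI bounded_linear_scaleR_left)
    fix e :: real assume e: "e > 0"
    show "\<exists>d>0. \<forall>t\<in>{0..\<tau>}. norm (t - s) < d \<longrightarrow>
        norm (T t u - T s u - (t - s) *\<^sub>R T s (A1 u)) \<le> e * norm (t - s)"
    \<comment> \<open>At this distance the quadratic error is below \<open>e\<close> times the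
      distance; \<open>c + 1\<close> avoids a division by 0.\<close>
    proof (intro exI[of _ "e / (c + 1)"] conjI ballI impI)
      fix t assume t: "t \<in> {0..\<tau>}" "norm (t - s) < e / (c + 1)"
      have "norm (T t u - T s u - (t - s) *\<^sub>R T s (A1 u)) \<le> c * (t - s)\<^sup>2" by (rule c(2)[OF s t(1)])
      also have "\<dots> = (c * norm (t - s)) * norm (t - s)" by (simp add: power2_eq_square flip: abs_mult)
      also have "c * norm (t - s) \<le> (c + 1) * (e / (c + 1))"
        using t c e by (intro mult_mono) auto
      also have "\<dots> = e" using c by simp
      finally show "norm (T t u - T s u - (t - s) *\<^sub>R T s (A1 u)) \<le> e * norm (t - s)"
        by (simp add: mult_right_mono)
    qed (use c e in auto)
  qed
qed

lemma T_A1_continuous: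
  assumes u: "u \<in> dom (m + 4)"
  shows "continuous_on {0..\<tau>} (\<lambda>t. T t (A1 u))"
proof -
  obtain c where "c \<ge> 0" "\<And>s t. s \<in> {0..\<tau>} \<Longrightarrow> t \<in> {0..\<tau>} \<Longrightarrow>
      norm (T t (A1 u) - T s (A1 u)) \<le> c * \<bar>t - s\<bar>"
    using T_lipschitz[OF u, of \<tau>] by metis
  then have "c-lipschitz_on {0..\<tau>} (\<lambda>t. T t (A1 u))"
    by (intro lipschitz_onI) (auto simp: dist_norm)
  then show ?thesis by (rule lipschitz_on_continuous_on)
qed

end

lemma banach_on_UNIV: "banach_on UNIV (norm :: 'a::complex_banach \<Rightarrow> real)"
  unfolding banach_on_def
proof (intro conjI allI impI ballI)
  fix u :: "nat \<Rightarrow> 'a"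
  assume "(\<forall>n. u n \<in> UNIV) \<and> (\<forall>e>0. \<exists>M. \<forall>m\<ge>M. \<forall>n\<ge>M. norm (u m - u n) < e)"
  then have "Cauchy u" by (simp add: Cauchy_def dist_norm)
  then obtain l where "u \<longlonglongrightarrow> l" using Cauchy_convergent_iff convergent_def by blast
  then have "(\<lambda>n. norm (u n - l)) \<longlonglongrightarrow> 0" by (simp add: tendsto_norm_zero_iff LIM_zero_iff)
  then show "\<exists>l\<in>UNIV. (\<lambda>n. norm (u n - l)) \<longlonglongrightarrow> 0" by blast
qed (simp_all add: csubspace_def norm_triangle_ineq norm_scaleC)

context core_semigroup
begin

text \<open>The bound for \<open>T s\<close> cannot be applied to \<open>T t u\<close>, which is not
  known to lie in \<open>dom (m + 4)\<close>. It is applied to the Euler approximations of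
  \<open>T t u\<close>, which do lie there, and \<open>G s\<close> carries their convergence in
  \<open>q\<close> over to \<open>T (s + t) u\<close>.\<close>

lemma T_composition_bound:
  assumes s: "s \<ge> 0" and t: "t \<ge> 0" and a: "\<And>u. u \<in> dom (m + 4) \<Longrightarrow> norm (T s u) \<le> a * norm u"
    and u: "u \<in> dom (m + 4)"
  shows "norm (T (s + t) u) \<le> a * norm (T t u)"
    and "t > 0 \<Longrightarrow> (\<lambda>n. T s ((F (t / real n) ^^ n) u)) \<longlonglongrightarrow> T (s + t) u"
proof -
  have u3: "u \<in> dom (Suc (Suc (Suc m)))" and um: "J u \<in> V" "u \<in> dom m"
    using u dom_antimono[of "m + 3" "m + 4"] dom_antimono[of m "m + 4"] core_in
    by (auto simp: numeral_eq_Suc)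
  obtain b where b: "b > 0" "\<And>x. x \<in> V \<Longrightarrow> norm (pr x) \<le> b * q x" using pr_bound by blast
  show lim: "(\<lambda>n. T s ((F (t / real n) ^^ n) u)) \<longlonglongrightarrow> T (s + t) u" if t: "t > 0"
  proof (rule Lim_null[THEN iffD2], rule Lim_null_comparison)
    show "(\<lambda>n. b * (exp (\<omega> * s) * q (J ((F (t / real n) ^^ n) u) - G t (J u)))) \<longlonglongrightarrow> 0"
      using tendsto_mult_left[OF tendsto_mult_left[OF exponential_formula_core[OF u3 t]],
          of b "exp (\<omega> * s)"] by simp
    show "\<forall>\<^sub>F n in sequentially. norm (T s ((F (t / real n) ^^ n) u) - T (s + t) u) \<le>
        b * (exp (\<omega> * s) * q (J ((F (t / real n) ^^ n) u) - G t (J u)))"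
      using approximation_in_dom[OF t]
    proof eventually_elim
      fix n assume "\<forall>u k. u \<in> dom k \<longrightarrow> (F (t / real n) ^^ n) u \<in> dom k"
      with um have v: "J ((F (t / real n) ^^ n) u) \<in> V" by (intro core_in) blast
      let ?v = "J ((F (t / real n) ^^ n) u)"
      have "T s ((F (t / real n) ^^ n) u) - T (s + t) u = pr (G s (?v - G t (J u)))"
        using s t um v by (simp add: T_def G_plus G_diff V_intros bounded_clinear_diff[OF pr])
      then have "norm (T s ((F (t / real n) ^^ n) u) - T (s + t) u) \<le> b * q (G s (?v - G t (J u)))"
        using b(2)[of "G s (?v - G t (J u))"] s t um v by (simp add: V_intros)
      also have "\<dots> \<le> b * (exp (\<omega> * s) * q (?v - G t (J u)))"
        using s t um v b(1) by (intro mult_left_mono q_G) (auto simp: V_intros)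
      finally show "norm (T s ((F (t / real n) ^^ n) u) - T (s + t) u) \<le>
          b * (exp (\<omega> * s) * q (?v - G t (J u)))" .
    qed
  qed
  show "norm (T (s + t) u) \<le> a * norm (T t u)"
  proof (cases "t = 0")
    case True
    then show ?thesis using a[OF u] um by (simp add: T_0)
  next
    case False
    with t have t: "t > 0" by simp
    show ?thesis
    proof (rule tendsto_le[OF sequentially_bot])
      show "(\<lambda>n. norm (T s ((F (t / real n) ^^ n) u))) \<longlonglongrightarrow> norm (T (s + t) u)"
        by (intro tendsto_intros lim t)
      show "(\<lambda>n. a * norm ((F (t / real n) ^^ n) u)) \<longlonglongrightarrow> a * norm (T t u)"
        by (intro tendsto_intros T_approximation u3 t)
      show "\<forall>\<^sub>F n in sequentially. norm (T s ((F (t / real n) ^^ n) u)) \<le>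
          a * norm ((F (t / real n) ^^ n) u)"
        using approximation_in_dom[OF t] by eventually_elim (use a u in blast)
    qed
  qed
qed

text \<open>Time \<open>t\<close> is split into \<open>n\<close> steps of length at most
  \<open>\<tau>\<close>, and the composition bound multiplies the constants.\<close>

lemma T_bound_all_times:
  assumes \<tau>: "\<tau> > 0" and c: "c \<ge> 0"
    and bound: "\<And>u t. u \<in> dom (m + 4) \<Longrightarrow> 0 \<le> t \<Longrightarrow> t \<le> \<tau> \<Longrightarrow> norm (T t u) \<le> c * norm u"
    and t: "t \<ge> 0"
  shows "\<exists>a\<ge>0. \<forall>u\<in>dom (m + 4). norm (T t u) \<le> a * norm u"
proof -
  obtain n :: nat where n: "real n > t / \<tau>" using reals_Archimedean2 by blast
  moreover have "t / \<tau> \<ge> 0" using t \<tau> by simp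
  ultimately have n0: "n > 0" by (cases n) auto
  define s where "s = t / real n"
  have s: "0 \<le> s" "s \<le> \<tau>" using n n0 t \<tau> by (simp_all add: s_def field_simps)
  have "\<exists>a\<ge>0. \<forall>u\<in>dom (m + 4). norm (T (real k * s) u) \<le> a * norm u" for k
  proof (induction k)
    case 0
    then show ?case using bound[of _ 0] \<tau> c by auto
  next
    case (Suc k)
    then obtain a where a: "a \<ge> 0" "\<And>u. u \<in> dom (m + 4) \<Longrightarrow> norm (T (real k * s) u) \<le> a * norm u"
      by blast
    have "norm (T (real (Suc k) * s) u) \<le> a * c * norm u" if u: "u \<in> dom (m + 4)" for u
    proof -
      have "real (Suc k) * s = real k * s + s" by (simp add: algebra_simps)
      then have "norm (T (real (Suc k) * s) u) \<le> a * norm (T s u)"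
        using T_composition_bound(1)[OF _ s(1) a(2) u] s by simp
      also have "\<dots> \<le> a * (c * norm u)" using a(1) bound[OF u s] by (rule mult_left_mono[rotated])
      finally show ?thesis by (simp add: mult.assoc)
    qed
    then show ?case using a(1) c by (intro exI[of _ "a * c"]) auto
  qed
  from this[of n] n0 show ?thesis by (simp add: s_def)
qed

text \<open>That the generator of the extended semigroup \<open>W\<close> is exactly
  \<open>A1\<close> takes two inclusions. It extends \<open>A1\<close> because images of
  \<open>dom (m + 4)\<close> under \<open>R l0\<close> approximate each \<open>u\<close> in
  \<open>D1\<close> together with \<open>A1 u\<close>. It is not larger, since \<open>l - A1\<close>
  is onto while \<open>l\<close> minus a generator is injective for large \<open>l\<close>.\<close>

theorem generates_of_bounded_core:
  assumes \<tau>: "\<tau> > 0" and c: "c \<ge> 0"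
    and bound: "\<And>u t. u \<in> dom (m + 4) \<Longrightarrow> 0 \<le> t \<Longrightarrow> t \<le> \<tau> \<Longrightarrow> norm (T t u) \<le> c * norm u"
  shows "generates_C0_semigroup UNIV norm D1 A1"
proof -
  \<comment> \<open>Beyond \<open>\<tau>\<close> any bound will do; up to \<open>\<tau>\<close> the
    common constant \<open>c\<close> is recorded, for the continuity at 0.\<close>
  have "\<exists>g. bounded_clinear g \<and> (\<forall>u\<in>dom (m + 4). g u = T t u) \<and>
      (t \<le> \<tau> \<longrightarrow> (\<forall>x. norm (g x) \<le> c * norm x))" if t: "t \<ge> 0" for t
  proof -
    obtain a where a: "a \<ge> 0" "\<And>u. u \<in> dom (m + 4) \<Longrightarrow> norm (T t u) \<le> a * norm u"
      "t \<le> \<tau> \<longrightarrow> a = c"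
      using T_bound_all_times[OF \<tau> c bound t] bound[OF _ t] c by (cases "t \<le> \<tau>") auto
    from extension_from_dense_subspace[OF T_clinear[OF t] dense_dom a(2,1)] a(3)
    show ?thesis by metis
  qed
  then have "\<exists>W. \<forall>t\<ge>0. bounded_clinear (W t) \<and> (\<forall>u\<in>dom (m + 4). W t u = T t u) \<and>
      (t \<le> \<tau> \<longrightarrow> (\<forall>x. norm (W t x) \<le> c * norm x))"
    by metis
  then obtain W where "\<forall>t\<ge>0. bounded_clinear (W t) \<and> (\<forall>u\<in>dom (m + 4). W t u = T t u) \<and>
      (t \<le> \<tau> \<longrightarrow> (\<forall>x. norm (W t x) \<le> c * norm x))" by (rule exE)
  then have W: "t \<ge> 0 \<Longrightarrow> bounded_clinear (W t)"
    and W_T: "t \<ge> 0 \<Longrightarrow> u \<in> dom (m + 4) \<Longrightarrow> W t u = T t u"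
    and W_bound: "t \<ge> 0 \<Longrightarrow> t \<le> \<tau> \<Longrightarrow> norm (W t x) \<le> c * norm x" for t u x
    by blast+
  note dense4 = dense_dom[of "m + 4"]
  have dom_m: "u \<in> dom m" "u \<in> dom (Suc m)" if "u \<in> dom (m + 4)" for u
    using that dom_antimono[of m "m + 4"] dom_antimono[of "Suc m" "m + 4"] by auto
  obtain b where b: "b > 0" "\<And>x. x \<in> V \<Longrightarrow> norm (pr x) \<le> b * q x" using pr_bound by blast
  have W_0: "W 0 x = x" for x
    using bounded_clinear_eq_on_dense[OF W _ dense4, of 0 "\<lambda>x. x" x] W_T T_0 dom_m
    by (simp add: bounded_clinear_def bounded_linear_ident)
  \<comment> \<open>\<open>W s\<close> is continuous and agrees with \<open>T s\<close> on the Euler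
    approximations of \<open>T t u\<close>, so both limits can be compared on the dense set.\<close>
  have W_plus: "W (s + t) x = W s (W t x)" if s: "s \<ge> 0" and t: "t \<ge> 0" for s t x
  proof (rule bounded_clinear_eq_on_dense[where f = "W (s + t)" and g = "\<lambda>x. W s (W t x)",
        OF _ _ dense4])
    show "bounded_clinear (W (s + t))" "bounded_clinear (\<lambda>x. W s (W t x))"
      using s t by (auto intro: W bounded_clinear_compose)
    fix u assume u: "u \<in> dom (m + 4)"
    show "W (s + t) u = W s (W t u)"
    proof (cases "t = 0")
      case True
      then show ?thesis by (simp add: W_0)
    next
      case False
      with t have t0: "t > 0" by simp
      have u3: "u \<in> dom (Suc (Suc (Suc m)))"
        using u dom_antimono[of "m + 3" "m + 4"] by (auto simp: numeral_eq_Suc)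
      obtain a where a: "\<And>u. u \<in> dom (m + 4) \<Longrightarrow> norm (T s u) \<le> a * norm u"
        using T_bound_all_times[OF \<tau> c bound s] by blast
      have "(\<lambda>n. W s ((F (t / real n) ^^ n) u)) \<longlonglongrightarrow> W s (T t u)"
        by (rule bounded_linear.tendsto[OF bounded_clinear_linear[OF W[OF s]] T_approximation[OF u3 t0]])
      moreover have "\<forall>\<^sub>F n in sequentially.
          W s ((F (t / real n) ^^ n) u) = T s ((F (t / real n) ^^ n) u)"
        using approximation_in_dom[OF t0] by eventually_elim (use u W_T[OF s] in blast)
      ultimately have "(\<lambda>n. T s ((F (t / real n) ^^ n) u)) \<longlonglongrightarrow> W s (T t u)"
        by (rule Lim_transform_eventually)
      then have "T (s + t) u = W s (T t u)"
        using T_composition_bound(2)[OF s t a u t0] LIMSEQ_unique by blast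
      then show ?thesis using W_T[OF _ u] s t by simp
    qed
  qed
  have q_cont: "((\<lambda>h. q (G h (J u) - J u)) \<longlongrightarrow> 0) (at_right 0)" if u: "u \<in> dom (m + 4)" for u
  proof (rule Lim_null_comparison)
    have "A1 u \<in> dom m" using u dom_antimono[of "Suc m" "m + 4"] dom_A1 by auto
    then have "q (G h (J u) - J u) \<le> h * (3 * exp (\<omega> * h) * q (J (A1 u)))" if "h \<ge> 0" for h
      using core_gen core_in dom_m[OF u] that by (intro increment_estimate) auto
    moreover have "0 \<le> q (G h (J u) - J u)" if "h \<ge> 0" for h
      using core_in dom_m[OF u] that by (intro q_nonneg) (simp add: V_intros)
    ultimately show "\<forall>\<^sub>F h in at_right 0. norm (q (G h (J u) - J u)) \<le>
        h * (3 * exp (\<omega> * h) * q (J (A1 u)))"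
      unfolding eventually_at_filter by (intro always_eventually) auto
    have "((\<lambda>h. h * (3 * exp (\<omega> * h) * q (J (A1 u)))) \<longlongrightarrow> 0 * (3 * exp (\<omega> * 0) * q (J (A1 u))))
        (at_right 0)"
      by (intro tendsto_intros)
    then show "((\<lambda>h. h * (3 * exp (\<omega> * h) * q (J (A1 u)))) \<longlongrightarrow> 0) (at_right 0)" by simp
  qed
  \<comment> \<open>Replacing \<open>x\<close> by a nearby core element \<open>u\<close> costs
    \<open>c + 1\<close> times their distance, and \<open>W t u - u\<close> tends to 0 because it is
    the projection of an orbit increment that is small in \<open>q\<close>.\<close>
  have W_cont: "((\<lambda>t. norm (W t x - x)) \<longlongrightarrow> 0) (at_right 0)" for x
  proof (rule tendstoI)
    fix e :: real assume e: "e > 0"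
    then have e': "e / (2 * (c + 1)) > 0" using c by simp
    then obtain u where u: "u \<in> dom (m + 4)" "norm (u - x) < e / (2 * (c + 1))"
      using dense4 closure_approachable[of x "dom (m + 4)"] by (auto simp: dist_norm)
    have "\<forall>\<^sub>F t in at_right 0. q (G t (J u) - J u) < e / (2 * b)"
      using order_tendstoD(2)[OF q_cont[OF u(1)]] e b by simp
    moreover have "\<forall>\<^sub>F t in at_right (0::real). 0 < t \<and> t < \<tau>"
      using \<tau> by (auto simp: eventually_at_right_field)
    ultimately show "\<forall>\<^sub>F t in at_right 0. dist (norm (W t x - x)) 0 < e"
    proof eventually_elim
      fix t assume 1: "q (G t (J u) - J u) < e / (2 * b)" and t: "0 < t \<and> t < \<tau>"
      have "W t u - u = pr (G t (J u) - J u)"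
        using W_T[OF _ u(1), of t] t by (simp add: T_def bounded_clinear_diff[OF pr])
      then have "norm (W t u - u) \<le> b * q (G t (J u) - J u)"
        using b(2)[of "G t (J u) - J u"] core_in dom_m[OF u(1)] t by (simp add: V_intros)
      also have "\<dots> < b * (e / (2 * b))" using 1 b by (intro mult_strict_left_mono) auto
      finally have 2: "norm (W t u - u) < e / 2" using b by simp
      have "W t x - x = W t (x - u) + (W t u - u) + (u - x)"
        using W[of t] t by (simp add: bounded_clinear_diff)
      then have "norm (W t x - x) \<le> norm (W t (x - u)) + norm (W t u - u) + norm (u - x)"
        by (simp only:) (intro norm_triangle_le add_right_mono norm_triangle_ineq)
      also have "norm (W t (x - u)) \<le> c * norm (u - x)"
        using W_bound[of t "x - u"] t by (simp add: norm_minus_commute)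
      also have "c * norm (u - x) + norm (W t u - u) + norm (u - x) =
          (c + 1) * norm (u - x) + norm (W t u - u)" by (simp add: algebra_simps)
      also have "\<dots> < (c + 1) * (e / (2 * (c + 1))) + e / 2"
        using u(2) 2 c by (intro add_strict_mono mult_strict_left_mono) auto
      also have "\<dots> = e" using c by (simp add: divide_simps) (simp add: algebra_simps)
      finally show "dist (norm (W t x - x)) 0 < e" by simp
    qed
  qed
  have sg: "C0_semigroup UNIV norm W"
    unfolding C0_semigroup_def
  proof (intro conjI allI impI ballI)
    fix t :: real assume t: "t \<ge> 0"
    show "clinear_on UNIV (W t)"
      using W[OF t] by (simp add: clinear_on_def csubspace_def bounded_clinear_add bounded_clinear_scaleC)
    show "\<exists>K. \<forall>x\<in>UNIV. norm (W t x) \<le> K * norm x"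
      using bounded_linear.bounded[OF bounded_clinear_linear[OF W[OF t]]] by (simp add: mult.commute)
  qed (use W_0 W_plus W_cont in auto)
  \<comment> \<open>\<open>W\<close> is renormed in turn, now on the whole space, to have closedness
    and dissipativity of its generator at hand.\<close>
  obtain q' \<omega>' M' where qc: "quasi_contractive_semigroup UNIV q' W \<omega>'"
    and q': "\<And>x. norm x \<le> q' x" "\<And>x. q' x \<le> M' * norm x"
    and gl: "\<And>x y. generator_limit q' W x y \<longleftrightarrow> generator_limit norm W x y"
    and q'_cont: "\<And>x. ((\<lambda>t. q' (W t x - x)) \<longlongrightarrow> 0) (at_right 0)"
    using C0_semigroup_renorming[OF banach_on_UNIV sg] by (metis UNIV_I)
  interpret W: quasi_contractive_semigroup UNIV q' W \<omega>' by (rule qc)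
  have gen_core: "generator_limit norm W u (A1 u)" if u: "u \<in> dom (m + 4)" for u
    unfolding generator_limit_def
  proof (rule Lim_null_comparison)
    have A1u: "A1 u \<in> dom m" using dom_m[OF u] dom_A1 by blast
    show "((\<lambda>h. b * q ((1 / h) *\<^sub>R (G h (J u) - J u) - J (A1 u))) \<longlongrightarrow> 0) (at_right 0)"
      using tendsto_mult_left[OF core_gen[OF dom_m(2)[OF u], unfolded generator_limit_def], of b]
      by simp
    show "\<forall>\<^sub>F h in at_right 0. norm (norm ((1 / h) *\<^sub>R (W h u - u) - A1 u)) \<le>
        b * q ((1 / h) *\<^sub>R (G h (J u) - J u) - J (A1 u))"
      unfolding eventually_at_filter
    proof (intro always_eventually allI impI)
      fix h :: real assume "h \<in> {0<..}"
      then have h: "h \<ge> 0" by simp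
      have "(1 / h) *\<^sub>R (W h u - u) - A1 u = pr ((1 / h) *\<^sub>R (G h (J u) - J u) - J (A1 u))"
        using W_T[OF h u] by (simp add: T_def bounded_clinear_diff[OF pr] bounded_clinear_scaleR[OF pr])
      then show "norm (norm ((1 / h) *\<^sub>R (W h u - u) - A1 u)) \<le>
          b * q ((1 / h) *\<^sub>R (G h (J u) - J u) - J (A1 u))"
        using b(2)[of "(1 / h) *\<^sub>R (G h (J u) - J u) - J (A1 u)"] h core_in dom_m[OF u] A1u
        by (simp add: V_intros)
    qed
  qed
  \<comment> \<open>Core elements \<open>v n\<close> that approximate \<open>y = l0 u - A1 u\<close>
    make \<open>R l0 (v n)\<close> converge to \<open>u\<close> in the graph norm of
    \<open>A1\<close>, and the generator is closed.\<close>
  have gen: "generator_limit norm W u (A1 u)" if u: "u \<in> D1" for u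
  proof -
    define y where "y = l0 *\<^sub>R u - A1 u"
    have "y \<in> closure (dom (m + 4))" using dense4 by simp
    then obtain v where v: "\<And>n. v n \<in> dom (m + 4)" "v \<longlonglongrightarrow> y" unfolding closure_sequential by blast
    have u_eq: "u = R l0 y" using R_left[OF l0 u] by (simp add: y_def)
    have lim1: "(\<lambda>n. R l0 (v n)) \<longlonglongrightarrow> u"
      unfolding u_eq by (rule bounded_linear.tendsto[OF bounded_clinear_linear[OF R_bounded[OF l0]] v(2)])
    have "(\<lambda>n. l0 *\<^sub>R R l0 (v n) - v n) \<longlonglongrightarrow> l0 *\<^sub>R u - y"
      by (intro tendsto_intros lim1 v)
    then have lim2: "(\<lambda>n. A1 (R l0 (v n))) \<longlonglongrightarrow> A1 u" by (simp add: A1_R[OF l0] y_def)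
    have q'_lim: "(\<lambda>n. q' (f n - x)) \<longlonglongrightarrow> 0" if "f \<longlonglongrightarrow> x" for f x
    proof (rule Lim_null_comparison)
      show "(\<lambda>n. M' * norm (f n - x)) \<longlonglongrightarrow> 0"
        using tendsto_mult_left[OF tendsto_norm_zero[OF LIM_zero[OF that]], of M'] by simp
      show "\<forall>\<^sub>F n in sequentially. norm (q' (f n - x)) \<le> M' * norm (f n - x)"
        using q' W.q_nonneg by simp
    qed
    have "generator_limit q' W u (A1 u)"
      using gen_core[OF dom_R[OF l0 v(1)]]
      by (intro W.generator_limit_closed[OF _ _ q'_lim[OF lim1] _ _ q'_lim[OF lim2] _ q'_cont])
        (simp_all add: gl)
    then show ?thesis by (simp add: gl)
  qed
  \<comment> \<open>Solve \<open>l x' - A1 x' = l x - y\<close> in \<open>D1\<close>; then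
    \<open>x - x'\<close> lies in the kernel of \<open>l\<close> minus the generator and vanishes by
    dissipativity.\<close>
  have "x \<in> D1" if xy: "generator_limit norm W x y" for x y
  proof -
    define l where "l = max \<omega>0 \<omega>' + 1"
    have l: "l > \<omega>0" "l > \<omega>'" "l \<ge> 0" using omega0 by (auto simp: l_def)
    define x' where "x' = R l (l *\<^sub>R x - y)"
    have x': "x' \<in> D1" "l *\<^sub>R x' - A1 x' = l *\<^sub>R x - y"
      using R_in[OF l(1)] R_right[OF l(1)] by (simp_all add: x'_def)
    have "generator_limit norm W (x - x') (y - A1 x')"
      unfolding generator_limit_def
    proof (rule Lim_null_comparison)
      show "((\<lambda>h. norm ((1 / h) *\<^sub>R (W h x - x) - y) + norm ((1 / h) *\<^sub>R (W h x' - x') - A1 x'))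
          \<longlongrightarrow> 0) (at_right 0)"
        using tendsto_add[OF xy[unfolded generator_limit_def]
            gen[OF x'(1), unfolded generator_limit_def]] by simp
      show "\<forall>\<^sub>F h in at_right 0. norm (norm ((1 / h) *\<^sub>R (W h (x - x') - (x - x')) - (y - A1 x')))
          \<le> norm ((1 / h) *\<^sub>R (W h x - x) - y) + norm ((1 / h) *\<^sub>R (W h x' - x') - A1 x')"
        unfolding eventually_at_filter
      proof (intro always_eventually allI impI)
        fix h :: real assume "h \<in> {0<..}"
        then have W_diff: "W h (x - x') = W h x - W h x'" by (simp add: bounded_clinear_diff[OF W])
        have eq: "(1 / h) *\<^sub>R (W h (x - x') - (x - x')) - (y - A1 x') =
            ((1 / h) *\<^sub>R (W h x - x) - y) - ((1 / h) *\<^sub>R (W h x' - x') - A1 x')"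
          unfolding W_diff by (simp add: algebra_simps)
        show "norm (norm ((1 / h) *\<^sub>R (W h (x - x') - (x - x')) - (y - A1 x')))
          \<le> norm ((1 / h) *\<^sub>R (W h x - x) - y) + norm ((1 / h) *\<^sub>R (W h x' - x') - A1 x')"
          unfolding eq by (simp add: norm_triangle_ineq4)
      qed
    qed
    then have "(l - \<omega>') * q' (x - x') \<le> q' (l *\<^sub>R (x - x') - (y - A1 x'))"
      using l by (intro W.generator_dissipative) (simp_all add: gl)
    also have "l *\<^sub>R (x - x') - (y - A1 x') = 0" using x'(2) by (simp add: algebra_simps)
    also have "q' 0 = 0" by (rule W.q_0)
    finally have "q' (x - x') \<le> 0" using l by (simp add: mult_le_0_iff)
    then have "norm (x - x') \<le> 0" using q'(1)[of "x - x'"] by linarith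
    then show ?thesis using x'(1) by simp
  qed
  then show ?thesis
    unfolding generates_C0_semigroup_def
    using sg gen by (intro exI[of _ W]) auto
qed

end

section \<open>The operator in the Weierstrass form is a generator\<close>

lemma bounded_clinear_fst: "bounded_clinear fst" and bounded_clinear_snd: "bounded_clinear snd"
  by (simp_all add: bounded_clinear_def bounded_linear_fst bounded_linear_snd scaleC_prod_def)

lemma scaleC_0_right: "c *\<^sub>C (0 :: 'a::complex_vector) = 0"
  using scaleC_add_right[of c "0 :: 'a" 0] by simp

lemma bounded_clinear_Pair_0: "bounded_clinear (\<lambda>u. (u, 0))"
  by (simp add: bounded_clinear_def bounded_linear_Pair bounded_linear_ident bounded_linear_zero
      scaleC_prod_def scaleC_0_right)

lemma bounded_clinear_bound:
  assumes "bounded_clinear f"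
  obtains K where "K > 0" "\<And>x. norm (f x) \<le> K * norm x"
  using bounded_linear.pos_bounded[OF bounded_clinear_linear[OF assms]] by (metis mult.commute)

context weierstrass_pencil
begin

text \<open>The first diagonal block of the resolvent in Weierstrass coordinates, that is, the
  inverse of \<open>l - A1\<close>.\<close>

definition A1_resolvent :: "real \<Rightarrow> 'y1 \<Rightarrow> 'y1" where
  "A1_resolvent l u = fst (P (resolvent E D A (complex_of_real l) (inv Q (u, 0))))"

lemma resolvent_family_A1:
  assumes res: "\<And>l. l > \<omega>0 \<Longrightarrow> complex_of_real l \<in> resolvent_set E D A" and "\<omega>0 \<ge> 0"
    and dense: "closure D = UNIV"
  shows "resolvent_family D1 A1 A1_resolvent \<omega>0"
proof
  fix l assume l: "l > \<omega>0"
  note r = res[OF l]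
  show "A1_resolvent l y \<in> D1" for y
    using resolvent_in[OF r] by (simp add: A1_resolvent_def in_D_iff)
  show "l *\<^sub>R A1_resolvent l y - A1 (A1_resolvent l y) = y" for y
  proof -
    let ?x = "resolvent E D A (complex_of_real l) (inv Q (y, 0))"
    have "Q (l *\<^sub>R E ?x - A ?x) = (y, 0)"
      using resolvent_eq[OF r] by (simp add: scaleC_of_real)
    then have "fst (l *\<^sub>R Q (E ?x) - Q (A ?x)) = y"
      by (simp add: bounded_clinear_diff[OF bounded_Q] bounded_clinear_scaleR[OF bounded_Q])
    then show ?thesis by (simp add: Q_E Q_A[OF resolvent_in[OF r]] A1_resolvent_def)
  qed
  show "A1_resolvent l (l *\<^sub>R u - A1 u) = u" if u: "u \<in> D1" for u
  proof -
    have "l *\<^sub>R E (inv P (u, 0)) - A (inv P (u, 0)) = inv Q (l *\<^sub>R (u, N 0) - (A1 u, 0))"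
      by (simp only: E_invP A_invP[OF u] bounded_clinear_diff[OF bounded_invQ]
          bounded_clinear_scaleR[OF bounded_invQ])
    then have "inv P (u, 0) = resolvent E D A (complex_of_real l) (inv Q (l *\<^sub>R u - A1 u, 0))"
      using u by (intro resolvent_unique[OF r]) (simp_all add: scaleC_of_real N_0)
    then have "A1_resolvent l (l *\<^sub>R u - A1 u) = fst (P (inv P (u, 0)))"
      unfolding A1_resolvent_def by simp
    then show ?thesis by simp
  qed
  show "bounded_clinear (A1_resolvent l)"
    unfolding A1_resolvent_def
    by (intro bounded_clinear_compose[OF bounded_clinear_fst] bounded_clinear_compose[OF bounded_P]
        bounded_clinear_compose[OF resolvent_bounded[OF r]] bounded_clinear_compose[OF bounded_invQ]
        bounded_clinear_Pair_0)
next
  show "closure D1 = UNIV"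
  proof (intro equalityI subsetI UNIV_I)
    fix u :: 'y1
    \<comment> \<open>Approximations of \<open>inv P (u, 0)\<close> in \<open>D\<close> project to
      approximations of \<open>u\<close> in \<open>D1\<close>.\<close>
    have "inv P (u, 0) \<in> closure D" using dense by simp
    then obtain x where x: "\<And>n. x n \<in> D" "x \<longlonglongrightarrow> inv P (u, 0)" unfolding closure_sequential by blast
    have "(\<lambda>n. fst (P (x n))) \<longlonglongrightarrow> fst (P (inv P (u, 0)))"
      by (intro tendsto_fst bounded_linear.tendsto[OF bounded_clinear_linear[OF bounded_P]] x)
    then show "u \<in> closure D1"
      using x(1) unfolding closure_sequential in_D_iff by (metis P_invP fst_conv)
  qed
qed (use A1 \<open>\<omega>0 \<ge> 0\<close> in auto)

text \<open>On \<open>(J u, J (A1 u), ...)\<close> the differentiation property yields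
  \<open>S (J u) = J (A1 u)\<close>, so that \<open>J\<close> fits the locale
  \<open>core_semigroup\<close>. The perturbation bound for the perturbation 0 supplies the estimate
  on \<open>{0..T}\<close> that \<open>generates_of_bounded_core\<close> asks for.\<close>

theorem A1_generates:
  assumes T: "T > 0" and dense_D: "closure D = UNIV"
    and res: "\<And>l. l > \<omega>0 \<Longrightarrow> complex_of_real l \<in> resolvent_set E D A" and \<omega>0: "\<omega>0 \<ge> 0"
    and diff: "differentiation_property E D A \<mu>" and pert: "perturbation_bound T E D A p"
  shows "generates_C0_semigroup UNIV norm D1 A1"
proof -
  interpret resolvent_family D1 A1 A1_resolvent \<omega>0
    by (rule resolvent_family_A1[OF res \<omega>0 dense_D])
  obtain V nV DS S where ban: "banach_on V nV" and emb: "densely_embedded V nV"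
    and gen: "generates_C0_semigroup V nV DS S"
    and ker: "\<And>x. x \<in> ker_deriv_array E D A \<mu> \<Longrightarrow> x 0 \<in> DS \<and> x 1 = S (x 0)"
    using diff unfolding differentiation_property_def by blast
  obtain G where sg: "C0_semigroup V nV G" and DS: "DS \<subseteq> V"
    and S: "\<And>x. x \<in> DS \<Longrightarrow> S x \<in> V" "\<And>x. x \<in> DS \<Longrightarrow> generator_limit nV G x (S x)"
    using gen unfolding generates_C0_semigroup_def by blast
  obtain K where K: "\<And>x. x \<in> V \<Longrightarrow> norm x \<le> K * nV x"
    using emb unfolding densely_embedded_def by blast
  obtain q \<omega> M where qc: "quasi_contractive_semigroup V q G \<omega>"
    and nq: "\<And>x. x \<in> V \<Longrightarrow> nV x \<le> q x" and "\<And>x. x \<in> V \<Longrightarrow> q x \<le> M * nV x" "M \<ge> 1"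
    and gl: "\<And>x y. x \<in> V \<Longrightarrow> y \<in> V \<Longrightarrow> generator_limit q G x y \<longleftrightarrow> generator_limit nV G x y"
    and "\<And>x. x \<in> V \<Longrightarrow> ((\<lambda>t. q (G t x - x)) \<longlongrightarrow> 0) (at_right 0)"
    by (rule C0_semigroup_renorming[OF ban sg]) (rule that, assumption+)
  define J where "J u = inv P (u, 0)" for u :: 'y1
  \<comment> \<open>The array requires the entries 0 to \<open>\<mu>\<close> to lie in
    \<open>D\<close>, hence \<open>u\<close> must allow \<open>\<mu> + 1\<close> applications of
    \<open>A1\<close>.\<close>
  have J_DS: "J u \<in> DS \<and> J (A1 u) = S (J u)" if u: "u \<in> dom (Suc \<mu>)" for u
  proof -
    define x where "x i = J ((A1 ^^ i) u)" for i
    have xi: "(A1 ^^ i) u \<in> D1" if i: "i \<le> \<mu>" for i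
    proof -
      have "u \<in> dom (Suc (\<mu> - i) + i)" using u i by simp
      then have "(A1 ^^ i) u \<in> dom (Suc (\<mu> - i))" by (rule dom_A1_power)
      then show ?thesis using dom_Suc_D1 by blast
    qed
    have "x \<in> ker_deriv_array E D A \<mu>"
      using xi by (auto simp: ker_deriv_array_def x_def J_def A_invP E_invP N_0)
    from ker[OF this] show ?thesis by (simp add: x_def)
  qed
  interpret core_semigroup D1 A1 A1_resolvent \<omega>0 V q G \<omega> J "\<lambda>x. fst (P x)" "Suc \<mu>" "\<bar>K\<bar>"
  proof (intro core_semigroup.intro core_semigroup_axioms.intro qc)
    show "resolvent_family D1 A1 A1_resolvent \<omega>0" by (rule resolvent_family_A1[OF res \<omega>0 dense_D])
    show "bounded_clinear J"
      unfolding J_def by (rule bounded_clinear_compose[OF bounded_invP bounded_clinear_Pair_0])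
    show "bounded_clinear (\<lambda>x. fst (P x))"
      by (rule bounded_clinear_compose[OF bounded_clinear_fst bounded_P])
    show "fst (P (J u)) = u" for u by (simp add: J_def)
    show "norm x \<le> \<bar>K\<bar> * q x" if x: "x \<in> V" for x
    proof -
      have "norm x \<le> K * nV x" by (rule K[OF x])
      also have "\<dots> \<le> \<bar>K\<bar> * nV x" using banach_on_nonneg[OF ban x] by (intro mult_right_mono) auto
      also have "\<dots> \<le> \<bar>K\<bar> * q x" using nq[OF x] by (intro mult_left_mono) auto
      finally show ?thesis .
    qed
    show "J u \<in> V" if "u \<in> dom (Suc \<mu>)" for u using J_DS[OF that] DS by blast
    show "generator_limit q G (J u) (J (A1 u))" if "u \<in> dom (Suc (Suc \<mu>))" for u
    proof -
      have u: "u \<in> dom (Suc \<mu>)" using that dom_Suc_subset by blast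
      have "J u \<in> V" "J (A1 u) \<in> V" "generator_limit nV G (J u) (J (A1 u))"
        using J_DS[OF u] S DS by auto
      then show ?thesis by (simp add: gl)
    qed
  qed
  obtain c where c: "c > 0" and
    bound: "\<And>x \<delta> t. C_k_on T (p - 1) \<delta> \<Longrightarrow> classical_solution T E D A \<delta> x \<Longrightarrow> t \<in> {0..T} \<Longrightarrow>
      norm (x t) \<le> c * (norm (x 0) +
        (if p = 0 then integral {0..T} (\<lambda>s. norm (\<delta> s))
         else (\<Sum>i<p. SUP s\<in>{0..T}. norm (iter_deriv T i \<delta> s))))"
    using pert unfolding perturbation_bound_def by blast
  obtain KP where KP: "KP > 0" "\<And>x. norm (fst (P x)) \<le> KP * norm x"
    using bounded_clinear_bound[OF pr] by blast
  obtain KJ where KJ: "KJ > 0" "\<And>u. norm (J u) \<le> KJ * norm u"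
    using bounded_clinear_bound[OF J] by blast
  \<comment> \<open>The constant \<open>T\<close> of the locale, which is hidden here by the end
    time \<open>T\<close>.\<close>
  let ?G = "core_semigroup.T G J (\<lambda>x. fst (P x))"
  have T_bound: "norm (?G t u) \<le> KP * c * KJ * norm u"
    if u: "u \<in> dom (Suc \<mu> + 4)" and t: "0 \<le> t" "t \<le> T" for u t
  proof -
    define x where "x t = J (?G t u)" for t
    define z where "z = (\<lambda>i::nat. \<lambda>t::real. 0 :: 'z)"
    have z: "(z i has_vector_derivative z (Suc i) t) (at t within {0..T})" for i t
      by (simp add: z_def)
    have iter0: "iter_deriv T i (\<lambda>_. 0 :: 'z) t = 0" if "t \<in> {0..T}" for i t
      using iter_deriv_eqI[where g = z and f = "\<lambda>_. 0" and k = i and i = i and t = t, OF T z] that by (simp add: z_def)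
    have Ck: "C_k_on T (p - 1) (\<lambda>_. 0 :: 'z)"
      by (rule C_k_onI[where g = z, OF T z]) (auto simp: z_def)
    have Ax: "A (x t) + 0 = inv Q (?G t (A1 u), 0)" if "t \<ge> 0" for t
      using T_domain[OF u that] by (simp add: x_def J_def A_invP)
    have lin: "bounded_linear (\<lambda>u. inv Q (u, 0))"
      by (rule bounded_clinear_linear[OF bounded_clinear_compose[OF bounded_invQ bounded_clinear_Pair_0]])
    have sol: "classical_solution T E D A (\<lambda>_. 0) x"
    proof (rule classical_solutionI[OF T])
      fix t assume t: "t \<in> {0..T}"
      then show "x t \<in> D" using T_domain(1)[OF u] by (simp add: x_def J_def)
      have "((\<lambda>s. inv Q (?G s u, 0)) has_vector_derivative inv Q (?G t (A1 u), 0))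
          (at t within {0..T})"
        by (rule bounded_linear.has_vector_derivative[OF lin T_has_derivative[OF u t]])
      then show "((\<lambda>s. E (x s)) has_vector_derivative A (x t) + 0) (at t within {0..T})"
        using t by (simp only: Ax atLeastAtMost_iff) (simp add: x_def J_def E_invP N_0)
    next
      have "continuous_on {0..T} (\<lambda>t. inv Q (?G t (A1 u), 0))"
        by (rule bounded_linear.continuous_on[OF lin T_A1_continuous[OF u]])
      then show "continuous_on {0..T} (\<lambda>t. A (x t) + 0)"
        using continuous_on_cong[of "{0..T}" "{0..T}" "\<lambda>t. A (x t) + 0"
            "\<lambda>t. inv Q (?G t (A1 u), 0)"] Ax by simp
    qed
    \<comment> \<open>With perturbation 0 the right-hand side reduces to the initial value for every
      \<open>p\<close>, be it an integral or a sum of suprema.\<close>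
    have "(SUP s\<in>{0..T}. norm (iter_deriv T i (\<lambda>_. 0 :: 'z) s)) = (SUP s\<in>{0..T}. 0 :: real)" for i
      using iter0 by (intro SUP_cong) auto
    then have "(SUP s\<in>{0..T}. norm (iter_deriv T i (\<lambda>_. 0 :: 'z) s)) = 0" for i
      using T by simp
    then have "norm (x t) \<le> c * norm (x 0)"
      using bound[OF Ck sol, of t] t by (simp split: if_splits)
    also have "x 0 = J u"
      using T_0[of u] u dom_antimono[of "Suc \<mu>" "Suc \<mu> + 4"] by (auto simp: x_def)
    also have "c * norm (J u) \<le> c * (KJ * norm u)" using KJ c by (intro mult_left_mono) auto
    finally have "KP * norm (x t) \<le> KP * (c * (KJ * norm u))"
      using KP by (intro mult_left_mono) auto
    moreover have "?G t u = fst (P (x t))" by (simp add: x_def J_def)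
    ultimately show ?thesis using KP(2)[of "x t"] by (simp add: mult.assoc)
  qed
  show ?thesis
    using KP(1) KJ(1) c T_bound by (intro generates_of_bounded_core[OF T, of "KP * c * KJ"]) auto
qed

section \<open>The differentiation index is at most the nilpotency index\<close>

text \<open>The whole space serves as \<open>V\<close>, with \<open>G\<close> on the first
  coordinate and the identity on the second, so that the generator acts as \<open>A1\<close> and 0.
  A kernel element of the array has \<open>v 1 = (N ^^ \<nu>) (v (Suc \<nu>)) = 0\<close>; therefore
  \<open>x 1\<close> has the coordinates \<open>A1 (u 0)\<close> and 0.\<close>

lemma generates_imp_differentiation:
  assumes gen: "generates_C0_semigroup UNIV norm D1 A1"
  shows "differentiation_property E D A \<nu>"
proof -
  obtain G where sg: "C0_semigroup UNIV norm G"
    and D1: "D1 = {x. \<exists>y. generator_limit norm G x y}"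
    and lim: "\<And>x. x \<in> D1 \<Longrightarrow> generator_limit norm G x (A1 x)"
    using gen unfolding generates_C0_semigroup_def by auto
  define H where "H t x = inv P (G t (fst (P x)), snd (P x))" for t x
  note lin = C0_semigroup_clinear[OF sg]
  have G_bounded: "bounded_clinear (G t)" if t: "t \<ge> 0" for t
  proof -
    obtain K where "\<And>x. norm (G t x) \<le> K * norm x" using C0_semigroup_bound[OF sg t] by auto
    then have "bounded_linear (G t)"
      using clinear_on_add[OF lin[OF t]] clinear_on_scaleR[OF lin[OF t]]
      by (intro bounded_linear_intro[of _ K]) (auto simp: mult.commute)
    then show ?thesis using clinear_on_scaleC[OF lin[OF t]] by (simp add: bounded_clinear_def)
  qed
  have H_bounded: "bounded_clinear (H t)" if t: "t \<ge> 0" for t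
    unfolding H_def
  proof (rule bounded_clinear_compose[OF bounded_invP])
    have 1: "bounded_clinear (\<lambda>x. G t (fst (P x)))"
      by (intro bounded_clinear_compose[OF G_bounded[OF t]]
          bounded_clinear_compose[OF bounded_clinear_fst bounded_P])
    have 2: "bounded_clinear (\<lambda>x. snd (P x))"
      by (intro bounded_clinear_compose[OF bounded_clinear_snd bounded_P])
    show "bounded_clinear (\<lambda>x. (G t (fst (P x)), snd (P x)))"
      using bounded_linear_Pair[OF bounded_clinear_linear[OF 1] bounded_clinear_linear[OF 2]]
      by (simp add: bounded_clinear_def scaleC_prod_def bounded_clinear_scaleC[OF bounded_P]
          bounded_clinear_scaleC[OF G_bounded[OF t]])
  qed
  have sgH: "C0_semigroup UNIV norm H"
    unfolding C0_semigroup_def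
  proof (intro conjI allI impI ballI)
    fix t :: real assume t: "t \<ge> 0"
    show "clinear_on UNIV (H t)"
      using H_bounded[OF t]
      by (simp add: clinear_on_def csubspace_def bounded_clinear_add bounded_clinear_scaleC)
    show "\<exists>K. \<forall>x\<in>UNIV. norm (H t x) \<le> K * norm x"
      using bounded_clinear_bound[OF H_bounded[OF t]] by metis
  next
    show "H 0 x = x" for x by (simp add: H_def C0_semigroup_0[OF sg])
    show "H (s + t) x = H s (H t x)" if "s \<ge> 0" "t \<ge> 0" for s t x
      using that by (simp add: H_def C0_semigroup_add[OF sg])
    fix x
    have "((\<lambda>t. G t (fst (P x))) \<longlongrightarrow> fst (P x)) (at_right 0)"
      using C0_semigroup_lim[OF sg, of "fst (P x)"] by (simp add: tendsto_norm_zero_iff LIM_zero_iff)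
    then have "((\<lambda>t. H t x) \<longlongrightarrow> inv P (fst (P x), snd (P x))) (at_right 0)"
      unfolding H_def
      by (intro bounded_linear.tendsto[OF bounded_clinear_linear[OF bounded_invP]] tendsto_intros)
    then show "((\<lambda>t. norm (H t x - x)) \<longlongrightarrow> 0) (at_right 0)"
      by (simp add: tendsto_norm_zero_iff LIM_zero_iff)
  qed auto
  \<comment> \<open>In the second coordinate the error of the difference quotient is the constant
    \<open>- snd (P y)\<close>, which has to vanish.\<close>
  have gen_iff: "generator_limit norm H x y \<longleftrightarrow>
      generator_limit norm G (fst (P x)) (fst (P y)) \<and> snd (P y) = 0" for x y
  proof -
    define d where "d h = (1 / h) *\<^sub>R (H h x - x) - y" for h
    define d1 where "d1 h = (1 / h) *\<^sub>R (G h (fst (P x)) - fst (P x)) - fst (P y)" for h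
    have Pd: "P (d h) = (d1 h, - snd (P y))" for h
      by (simp add: d_def d1_def H_def bounded_clinear_diff[OF bounded_P]
          bounded_clinear_scaleR[OF bounded_P] prod_eq_iff)
    have "(d \<longlongrightarrow> 0) (at_right 0) \<longleftrightarrow> ((\<lambda>h. P (d h)) \<longlongrightarrow> 0) (at_right 0)"
    proof
      assume "(d \<longlongrightarrow> 0) (at_right 0)"
      from bounded_linear.tendsto[OF bounded_clinear_linear[OF bounded_P] this]
      show "((\<lambda>h. P (d h)) \<longlongrightarrow> 0) (at_right 0)" by (simp add: bounded_clinear_0[OF bounded_P])
    next
      assume "((\<lambda>h. P (d h)) \<longlongrightarrow> 0) (at_right 0)"
      from bounded_linear.tendsto[OF bounded_clinear_linear[OF bounded_invP] this]
      show "(d \<longlongrightarrow> 0) (at_right 0)" by (simp add: bounded_clinear_0[OF bounded_invP])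
    qed
    also have "\<dots> \<longleftrightarrow> (d1 \<longlongrightarrow> 0) (at_right 0) \<and> snd (P y) = 0"
    proof
      assume "((\<lambda>h. P (d h)) \<longlongrightarrow> 0) (at_right 0)"
      from tendsto_fst[OF this] tendsto_snd[OF this]
      show "(d1 \<longlongrightarrow> 0) (at_right 0) \<and> snd (P y) = 0" by (simp add: Pd tendsto_const_iff)
    next
      assume "(d1 \<longlongrightarrow> 0) (at_right 0) \<and> snd (P y) = 0"
      then have "((\<lambda>h. (d1 h, - snd (P y))) \<longlongrightarrow> (0, - snd (P y))) (at_right 0)"
        by (intro tendsto_intros) auto
      then show "((\<lambda>h. P (d h)) \<longlongrightarrow> 0) (at_right 0)"
        using \<open>_ \<and> snd (P y) = 0\<close> by (simp add: Pd zero_prod_def)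
    qed
    finally show ?thesis
      by (simp add: generator_limit_def tendsto_norm_zero_iff d_def[abs_def] d1_def[abs_def])
  qed
  define DS where "DS = {x. fst (P x) \<in> D1}"
  define S where "S x = inv P (A1 (fst (P x)), 0)" for x
  have "generates_C0_semigroup UNIV norm DS S"
    unfolding generates_C0_semigroup_def
  proof (intro exI[of _ H] conjI sgH ballI)
    show "DS = {x \<in> UNIV. \<exists>y\<in>UNIV. generator_limit norm H x y}"
    proof (intro equalityI subsetI; clarsimp)
      fix x assume "x \<in> DS"
      then show "\<exists>y. generator_limit norm H x y"
        using lim by (intro exI[of _ "S x"]) (simp add: gen_iff DS_def S_def)
    next
      fix x y assume "generator_limit norm H x y"
      then show "x \<in> DS" by (auto simp: gen_iff DS_def D1)
    qed
    show "generator_limit norm H x (S x)" if "x \<in> DS" for x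
      using that lim by (simp add: gen_iff DS_def S_def)
  qed auto
  moreover have "\<forall>x\<in>ker_deriv_array E D A \<nu>. x 0 \<in> DS \<and> x 1 = S (x 0)"
  proof
    fix x assume x: "x \<in> ker_deriv_array E D A \<nu>"
    define u v where "u k = fst (P (x k))" and "v k = snd (P (x k))" for k
    have xD: "x i \<in> D" and xE: "Q (A (x i)) = Q (E (x (Suc i)))" if "i \<le> \<nu>" for i
      using x that by (auto simp: ker_deriv_array_def)
    have uv: "u i \<in> D1" "u (Suc i) = A1 (u i)" "v i = N (v (Suc i))" if "i \<le> \<nu>" for i
      using xD[OF that] xE[OF that] by (simp_all add: Q_A Q_E u_def v_def in_D_iff)
    have "v 1 = (N ^^ k) (v (Suc k))" if "k \<le> \<nu>" for k
      using that
    proof (induction k)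
      case (Suc k)
      then show ?case using uv(3)[of "Suc k"] by (simp add: funpow_swap1)
    qed simp
    from this[of \<nu>] have "v 1 = 0" by (simp add: N_power_nilpotent)
    have "x 1 = inv P (u 1, v 1)" by (simp add: u_def v_def)
    with \<open>v 1 = 0\<close> uv(1,2)[of 0] show "x 0 \<in> DS \<and> x 1 = S (x 0)" by (simp add: DS_def S_def u_def)
  qed
  moreover have "densely_embedded UNIV (norm :: 'x \<Rightarrow> real)"
    unfolding densely_embedded_def by (intro conjI closure_UNIV exI[of _ 1]) simp
  ultimately show ?thesis
    unfolding differentiation_property_def
    by (intro exI[of _ UNIV] exI[of _ norm] exI[of _ DS] exI[of _ S] conjI banach_on_UNIV)
qed

end

section \<open>The perturbation index is at most the nilpotency index\<close>

lemma has_vector_derivative_right: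
  assumes "(f has_vector_derivative d) (at t within {0..b})" "0 \<le> t" "t < b" "e > 0"
  shows "\<forall>\<^sub>F s in at_right t. norm (f s - f t - (s - t) *\<^sub>R d) \<le> e * (s - t)"
proof -
  obtain r where r: "r > 0"
    "\<And>s. s \<in> {0..b} \<Longrightarrow> norm (s - t) < r \<Longrightarrow> norm (f s - f t - (s - t) *\<^sub>R d) \<le> e * norm (s - t)"
    using assms(1,4) unfolding has_vector_derivative_def has_derivative_within_alt by blast
  have "norm (f s - f t - (s - t) *\<^sub>R d) \<le> e * (s - t)" if "t < s" "s < min b (t + r)" for s
    using r(2)[of s] that assms by simp
  then show ?thesis
    using assms r(1) by (auto simp: eventually_at_right_field intro!: exI[of _ "min b (t + r)"])
qed

text \<open>The bound given by Duhamel's formula, without integrating the semigroup: over a short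
  step \<open>u\<close> differs from \<open>G h (u s) + h f s\<close> by \<open>o(h)\<close>, hence
  \<open>exp (- \<omega> * s) * q (u s)\<close> grows no faster than \<open>M\<close> times the
  integral of \<open>norm (f s)\<close>.\<close>

lemma inhomogeneous_estimate:
  fixes S :: "'y::complex_banach \<Rightarrow> 'y"
  assumes gen: "generates_C0_semigroup UNIV norm DS S" and T: "T > 0"
  obtains c where "c > 0" "\<And>u f t. continuous_on {0..T} f \<Longrightarrow> (\<And>s. s \<in> {0..T} \<Longrightarrow> u s \<in> DS) \<Longrightarrow>
    (\<And>s. s \<in> {0..T} \<Longrightarrow> (u has_vector_derivative S (u s) + f s) (at s within {0..T})) \<Longrightarrow>
    t \<in> {0..T} \<Longrightarrow> norm (u t) \<le> c * (norm (u 0) + integral {0..T} (\<lambda>s. norm (f s)))"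
proof -
  obtain G where sg: "C0_semigroup UNIV norm G"
    and lim: "\<And>x. x \<in> DS \<Longrightarrow> generator_limit norm G x (S x)"
    using gen unfolding generates_C0_semigroup_def by blast
  obtain q \<omega> M where qc: "quasi_contractive_semigroup UNIV q G \<omega>"
    and nq: "\<And>x. norm x \<le> q x" and qn: "\<And>x. q x \<le> M * norm x" and M: "M \<ge> 1"
    and gl: "\<And>x y. generator_limit q G x y \<longleftrightarrow> generator_limit norm G x y"
    using C0_semigroup_renorming[OF banach_on_UNIV sg] by (metis UNIV_I)
  interpret quasi_contractive_semigroup UNIV q G \<omega> by (rule qc)
  have "norm (u t) \<le> exp (\<omega> * T) * M * (norm (u 0) + integral {0..T} (\<lambda>s. norm (f s)))"
    if f: "continuous_on {0..T} f" and uD: "\<And>s. s \<in> {0..T} \<Longrightarrow> u s \<in> DS"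
      and u: "\<And>s. s \<in> {0..T} \<Longrightarrow> (u has_vector_derivative S (u s) + f s) (at s within {0..T})"
      and t: "t \<in> {0..T}" for u f t
  proof -
    define I where "I s = integral {0..s} (\<lambda>r. norm (f r))" for s
    have nf: "continuous_on {0..T} (\<lambda>r. norm (f r))" using f by (intro continuous_intros)
    have I: "(I has_vector_derivative norm (f s)) (at s within {0..T})" if "s \<in> {0..T}" for s
      unfolding I_def by (rule integral_has_vector_derivative[OF nf that])
    have I_cont: "continuous_on {0..T} I" using I by (rule continuous_on_vector_derivative)
    have u_cont: "continuous_on {0..T} u" using u by (rule continuous_on_vector_derivative)
    have q_lip: "\<bar>q x - q y\<bar> \<le> M * norm (x - y)" for x y
      using q_add[of "x - y" y] q_add[of "y - x" x] qn[of "x - y"] qn[of "y - x"]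
      by (simp add: norm_minus_commute)
    have "M-lipschitz_on UNIV q"
      using q_lip M by (intro lipschitz_onI) (auto simp: dist_norm)
    then have "continuous_on UNIV q" by (rule lipschitz_on_continuous_on)
    then have qu_cont: "continuous_on {0..T} (\<lambda>s. q (u s))"
      using continuous_on_compose2[OF _ u_cont] by blast
    have I_nonneg: "0 \<le> I t"
      unfolding I_def using t
      by (intro integral_nonneg integrable_continuous_interval continuous_on_subset[OF nf]) auto
    define g where "g s = exp (- \<omega> * s) * q (u s) - M * I s" for s
    have "g t \<le> g 0"
    proof (rule dini_mono[of 0 t g])
      show "continuous_on {0..t} g"
        unfolding g_def using t
        by (intro continuous_intros continuous_on_subset[OF qu_cont] continuous_on_subset[OF I_cont])
          auto
    next
      fix s e :: real assume s: "0 \<le> s" "s < t" and e: "e > 0"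
      then have sT: "s \<in> {0..T}" "s < T" using t by auto
      \<comment> \<open>Three errors arise in a step: that of the solution times \<open>M\<close>,
        that of the semigroup orbit, and that of the integral times \<open>M\<close>.\<close>
      define e' where "e' = e / (2 * M + 1)"
      have e': "e' > 0" using e M by (simp add: e'_def)
      have 1: "\<forall>\<^sub>F r in at_right s. norm (u r - u s - (r - s) *\<^sub>R (S (u s) + f s)) \<le> e' * (r - s)"
        using has_vector_derivative_right[OF u[OF sT(1)] s(1) sT(2) e'] .
      have 2: "\<forall>\<^sub>F r in at_right s. norm (I r - I s - (r - s) *\<^sub>R norm (f s)) \<le> e' * (r - s)"
        using has_vector_derivative_right[OF I[OF sT(1)] s(1) sT(2) e'] .
      have "generator_limit q G (u s) (S (u s))" using lim[OF uD[OF sT(1)]] by (simp add: gl)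
      then have "\<forall>\<^sub>F h in at_right 0. q ((1 / h) *\<^sub>R (G h (u s) - u s) - S (u s)) < e'"
        unfolding generator_limit_def using e' by (rule order_tendstoD)
      then have 3: "\<forall>\<^sub>F r in at_right s.
          q ((1 / (r - s)) *\<^sub>R (G (r - s) (u s) - u s) - S (u s)) < e'"
        by (subst eventually_at_right_to_0) simp
      have 4: "\<forall>\<^sub>F r in at_right s. s < r" by (simp add: eventually_at_right_less)
      show "\<forall>\<^sub>F r in at_right s. g r \<le> g s + e * (r - s)"
        using 1 2 3 4
      proof eventually_elim
        fix r
        assume 1: "norm (u r - u s - (r - s) *\<^sub>R (S (u s) + f s)) \<le> e' * (r - s)"
          and 2: "norm (I r - I s - (r - s) *\<^sub>R norm (f s)) \<le> e' * (r - s)"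
          and 3: "q ((1 / (r - s)) *\<^sub>R (G (r - s) (u s) - u s) - S (u s)) < e'" and r: "s < r"
        define h where "h = r - s"
        have h: "h > 0" using r by (simp add: h_def)
        \<comment> \<open>\<open>d1\<close> and \<open>d2\<close> are the remainders of the solution
          and of the semigroup orbit; the terms \<open>h S (u s)\<close> cancel in their
          difference.\<close>
        define d1 where "d1 = u r - u s - h *\<^sub>R (S (u s) + f s)"
        define d2 where "d2 = G h (u s) - u s - h *\<^sub>R S (u s)"
        have "d2 = h *\<^sub>R ((1 / h) *\<^sub>R (G h (u s) - u s) - S (u s))"
          using h by (simp add: d2_def scaleR_diff_right)
        then have "q d2 = h * q ((1 / h) *\<^sub>R (G h (u s) - u s) - S (u s))"
          using h by (simp only: q_scaleR[OF UNIV_I] abs_of_pos)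
        then have q2: "q d2 \<le> h * e'" using 3 h by (simp add: h_def)
        have "norm d1 \<le> h * e'" using 1 by (simp add: d1_def h_def mult.commute)
        then have "M * norm d1 \<le> M * (h * e')" using M by (intro mult_left_mono) auto
        then have q1: "q d1 \<le> M * (h * e')" using qn[of d1] by linarith
        have "u r = G h (u s) + (h *\<^sub>R f s + (d1 - d2))"
          by (simp add: d1_def d2_def algebra_simps)
        then have "q (u r) \<le> q (G h (u s)) + q (h *\<^sub>R f s + (d1 - d2))"
          using q_add[of "G h (u s)" "h *\<^sub>R f s + (d1 - d2)"] by simp
        also have "q (G h (u s)) \<le> exp (\<omega> * h) * q (u s)" using h by (intro q_G) auto
        also have "q (h *\<^sub>R f s + (d1 - d2)) \<le> h * (M * norm (f s)) + M * (h * e') + h * e'"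
        proof -
          have "q (h *\<^sub>R f s + (d1 - d2)) \<le> q (h *\<^sub>R f s) + (q d1 + q d2)"
            using q_add[of "h *\<^sub>R f s" "d1 - d2"] q_diff[of d1 d2] by simp
          moreover have "q (h *\<^sub>R f s) \<le> h * (M * norm (f s))"
            using h qn[of "f s"] by (simp add: q_scaleR mult_left_mono)
          ultimately show ?thesis using q1 q2 by linarith
        qed
        finally have "exp (- \<omega> * r) * q (u r) \<le>
            exp (- \<omega> * r) * (exp (\<omega> * h) * q (u s) +
              (h * (M * norm (f s)) + M * (h * e') + h * e'))"
          by (intro mult_left_mono) auto
        also have "\<dots> = exp (- \<omega> * r) * exp (\<omega> * h) * q (u s) +
            exp (- \<omega> * r) * (h * (M * norm (f s)) + M * (h * e') + h * e')"
          by (simp add: distrib_left mult.assoc)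
        also have "exp (- \<omega> * r) * exp (\<omega> * h) = exp (- \<omega> * s)"
          by (simp add: h_def mult_exp_exp algebra_simps)
        also have "exp (- \<omega> * r) * (h * (M * norm (f s)) + M * (h * e') + h * e') \<le>
            1 * (h * (M * norm (f s)) + M * (h * e') + h * e')"
          using omega r s h e' M by (intro mult_right_mono) auto
        finally have 5: "exp (- \<omega> * r) * q (u r) \<le>
            exp (- \<omega> * s) * q (u s) + (h * (M * norm (f s)) + M * (h * e') + h * e')" by simp
        have "h * norm (f s) - (I r - I s) \<le> e' * h"
          using 2 by (simp add: h_def abs_le_iff)
        then have "M * (h * norm (f s) - (I r - I s)) \<le> M * (e' * h)"
          using M by (intro mult_left_mono) auto
        then have "g r \<le> g s + (2 * M + 1) * e' * h"
          using 5 by (simp add: g_def algebra_simps)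
        also have "(2 * M + 1) * e' = e" using M by (simp add: e'_def)
        finally show "g r \<le> g s + e * (r - s)" by (simp add: h_def)
      qed
    qed (use t in simp)
    then have "exp (- \<omega> * t) * q (u t) \<le> q (u 0) + M * I t" by (simp add: g_def I_def)
    then have "exp (\<omega> * t) * (exp (- \<omega> * t) * q (u t)) \<le> exp (\<omega> * t) * (q (u 0) + M * I t)"
      by (intro mult_left_mono) auto
    then have "q (u t) \<le> exp (\<omega> * t) * (q (u 0) + M * I t)"
      by (simp add: mult_exp_exp flip: mult.assoc)
    also have "\<dots> \<le> exp (\<omega> * T) * (M * norm (u 0) + M * I T)"
    proof (intro mult_mono add_mono mult_left_mono)
      show "I t \<le> I T"
        unfolding I_def using t nf
        by (intro integral_subset_le integrable_continuous_interval continuous_on_subset[OF nf]) auto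
      show "0 \<le> q (u 0) + M * I t" using q_nonneg[of "u 0"] M I_nonneg by simp
    qed (use t omega M qn I_nonneg in \<open>auto simp: mult_left_mono\<close>)
    finally show ?thesis using nq[of "u t"] by (simp add: I_def algebra_simps)
  qed
  then show thesis using M by (intro that[of "exp (\<omega> * T) * M"]) auto
qed

context weierstrass_pencil
begin

text \<open>Differentiating \<open>N v\<close> repeatedly: \<open>v\<close> is determined by \<open>\<delta>\<close> and its derivatives.\<close>

lemma nilpotent_component:
  assumes T: "T > 0" and \<delta>: "C_k_on T (\<nu> - 1) \<delta>" and sol: "classical_solution T E D A \<delta> x"
    and t: "t \<in> {0..T}"
  shows "snd (P (x t)) = - (\<Sum>i<\<nu>. (N ^^ i) (snd (Q (iter_deriv T i \<delta> t))))"
proof -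
  define L where "L i z = (N ^^ i) (snd (Q z))" for i z
  define v where "v t = snd (P (x t))" for t
  have blN: "bounded_linear (N ^^ k)" for k
    by (rule bounded_linear_funpow[OF bounded_clinear_linear[OF N]])
  have blL: "bounded_linear (L i)" for i
    unfolding L_def
    by (intro bounded_linear_compose[OF blN] bounded_linear_compose[OF bounded_linear_snd]
        bounded_clinear_linear[OF bounded_Q])
  \<comment> \<open>Downward induction from \<open>N ^^ \<nu> = 0\<close>: the equation
    \<open>(N v)' = v + g\<close>, multiplied by \<open>N ^^ k\<close>, expresses
    \<open>(N ^^ k) v\<close> through the derivative of \<open>(N ^^ Suc k) v\<close>. Each step
    costs one derivative of \<open>\<delta>\<close>, and \<open>j = \<nu>\<close> reaches
    \<open>v\<close> itself.\<close>
  have "(N ^^ (\<nu> - j)) (v t) = - (\<Sum>i<j. L (\<nu> - j + i) (iter_deriv T i \<delta> t))"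
    if "j \<le> \<nu>" "t \<in> {0..T}" for j t
    using that
  proof (induction j arbitrary: t)
    case 0
    then show ?case by (simp add: N_power_nilpotent)
  next
    case (Suc j)
    define k where "k = \<nu> - Suc j"
    have k: "\<nu> - j = Suc k" using Suc.prems by (simp add: k_def)
    have der1: "((\<lambda>s. (N ^^ Suc k) (v s)) has_vector_derivative
        (N ^^ k) (v t) + L k (\<delta> t)) (at t within {0..T})"
    proof -
      have "((\<lambda>s. L k (E (x s))) has_vector_derivative L k (A (x t) + \<delta> t)) (at t within {0..T})"
        by (rule bounded_linear.has_vector_derivative[OF blL
              classical_solution_deriv[OF sol Suc.prems(2)]])
      moreover have "L k (E (x s)) = (N ^^ Suc k) (v s)" for s
        by (simp add: L_def Q_E v_def funpow_swap1)
      moreover have "L k (A (x t)) = (N ^^ k) (v t)"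
        by (simp add: L_def Q_A[OF classical_solution_in[OF sol Suc.prems(2)]] v_def)
      ultimately show ?thesis using linear_add[OF bounded_linear.linear[OF blL]] by simp
    qed
    have der2: "((\<lambda>s. - (\<Sum>i<j. L (Suc k + i) (iter_deriv T i \<delta> s))) has_vector_derivative
        - (\<Sum>i<j. L (Suc k + i) (iter_deriv T (Suc i) \<delta> t))) (at t within {0..T})"
    proof (intro has_vector_derivative_minus has_vector_derivative_sum
        bounded_linear.has_vector_derivative[OF blL] C_k_on_deriv[OF \<delta>] Suc.prems)
      \<comment> \<open>From \<open>i < j\<close> and \<open>Suc j \<le> \<nu>\<close> the order of
        differentiation stays within the available smoothness \<open>\<nu> - 1\<close>.\<close>
      fix i assume "i \<in> {..<j}"
      then show "i < \<nu> - 1" using Suc.prems by simp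
    qed
    have "(N ^^ k) (v t) + L k (\<delta> t) =
        vector_derivative (\<lambda>s. (N ^^ Suc k) (v s)) (at t within {0..T})"
      using vector_derivative_within_interval[OF T Suc.prems(2) der1] by simp
    also have "\<dots> = - (\<Sum>i<j. L (Suc k + i) (iter_deriv T (Suc i) \<delta> t))"
      using Suc.IH Suc.prems(1) k by (intro vector_derivative_within_interval[OF T Suc.prems(2) der2]) simp
    finally have "(N ^^ k) (v t) =
        - (\<Sum>i<j. L (Suc k + i) (iter_deriv T (Suc i) \<delta> t)) - L k (\<delta> t)"
      by (simp only: eq_diff_eq)
    also have "\<dots> = - (L k (\<delta> t) + (\<Sum>i<j. L (Suc k + i) (iter_deriv T (Suc i) \<delta> t)))"
      by simp
    also have "L k (\<delta> t) + (\<Sum>i<j. L (Suc k + i) (iter_deriv T (Suc i) \<delta> t)) =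
        (\<Sum>i<Suc j. L (k + i) (iter_deriv T i \<delta> t))"
      by (subst sum.lessThan_Suc_shift) (simp add: iter_deriv_0)
    finally show ?case by (simp add: k_def)
  qed
  from this[of \<nu> t] t show ?thesis by (simp add: v_def L_def)
qed

text \<open>The coordinates are estimated separately: the inhomogeneous estimate for
  \<open>A1\<close> takes the integral of \<open>\<delta>\<close>, and the explicit formula for the
  nilpotent coordinate takes the derivatives up to order \<open>\<nu> - 1\<close>.\<close>

lemma generates_imp_perturbation:
  assumes T: "T > 0" and gen: "generates_C0_semigroup UNIV norm D1 A1"
  shows "perturbation_bound T E D A \<nu>"
proof -
  obtain c where c: "c > 0" and est: "\<And>u f t. continuous_on {0..T} f \<Longrightarrow>
    (\<And>s. s \<in> {0..T} \<Longrightarrow> u s \<in> D1) \<Longrightarrow>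
    (\<And>s. s \<in> {0..T} \<Longrightarrow> (u has_vector_derivative A1 (u s) + f s) (at s within {0..T})) \<Longrightarrow>
    t \<in> {0..T} \<Longrightarrow> norm (u t) \<le> c * (norm (u 0) + integral {0..T} (\<lambda>s. norm (f s)))"
    using inhomogeneous_estimate[OF gen T] by metis
  have fP: "bounded_clinear (\<lambda>x. fst (P x))" and fQ: "bounded_clinear (\<lambda>z. fst (Q z))"
    by (rule bounded_clinear_compose[OF bounded_clinear_fst bounded_P],
        rule bounded_clinear_compose[OF bounded_clinear_fst bounded_Q])
  obtain k1 where k1: "k1 > 0" "\<And>x. norm (fst (P x)) \<le> k1 * norm x"
    using bounded_clinear_bound[OF fP] by blast
  obtain k2 where k2: "k2 > 0" "\<And>z. norm (fst (Q z)) \<le> k2 * norm z"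
    using bounded_clinear_bound[OF fQ] by blast
  obtain k3 where k3: "k3 > 0" "\<And>y. norm (inv P y) \<le> k3 * norm y"
    using bounded_clinear_bound[OF bounded_invP] by blast
  define L where "L i z = (N ^^ i) (snd (Q z))" for i z
  have blL: "bounded_linear (L i)" for i
    unfolding L_def
    by (intro bounded_linear_compose[OF bounded_linear_funpow[OF bounded_clinear_linear[OF N]]]
        bounded_linear_compose[OF bounded_linear_snd] bounded_clinear_linear[OF bounded_Q])
  define b where "b = (\<Sum>i<\<nu>. onorm (L i))"
  have b: "b \<ge> 0" unfolding b_def by (intro sum_nonneg onorm_pos_le blL)
  define C where "C = k3 * (c * (k1 + k2 * (T + 1)) + b)"
  have C: "C > 0"
    unfolding C_def using c k1 k2 k3 T b by (intro mult_pos_pos add_pos_nonneg) auto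
  have "norm (x t) \<le> C * (norm (x 0) +
        (if \<nu> = 0 then integral {0..T} (\<lambda>s. norm (\<delta> s))
         else (\<Sum>i<\<nu>. SUP s\<in>{0..T}. norm (iter_deriv T i \<delta> s))))"
    if Ck: "C_k_on T (\<nu> - 1) \<delta>" and sol: "classical_solution T E D A \<delta> x" and t: "t \<in> {0..T}"
    for x \<delta> t
  proof -
    define B where "B = (if \<nu> = 0 then integral {0..T} (\<lambda>s. norm (\<delta> s))
         else (\<Sum>i<\<nu>. SUP s\<in>{0..T}. norm (iter_deriv T i \<delta> s)))"
    have \<delta>_cont: "continuous_on {0..T} \<delta>"
      using C_k_on_continuous[OF Ck, of 0] by (simp add: iter_deriv_0)
    have norm_le_SUP: "norm (iter_deriv T i \<delta> s) \<le> (SUP s\<in>{0..T}. norm (iter_deriv T i \<delta> s))"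
      if "i < \<nu>" "s \<in> {0..T}" for i s
    proof (rule cSUP_upper[OF that(2)])
      have "compact ((\<lambda>s. norm (iter_deriv T i \<delta> s)) ` {0..T})"
        using that(1) by (intro compact_continuous_image continuous_intros C_k_on_continuous[OF Ck]) auto
      then show "bdd_above ((\<lambda>s. norm (iter_deriv T i \<delta> s)) ` {0..T})"
        by (intro bounded_imp_bdd_above compact_imp_bounded)
    qed
    have SUP_nonneg: "0 \<le> (SUP s\<in>{0..T}. norm (iter_deriv T i \<delta> s))" if "i < \<nu>" for i
      using order_trans[OF norm_ge_zero norm_le_SUP[OF that t]] .
    have SUP_le: "(SUP s\<in>{0..T}. norm (iter_deriv T i \<delta> s)) \<le> B" if "i < \<nu>" for i
      using that SUP_nonneg unfolding B_def by (auto intro!: member_le_sum)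
    have int: "(\<lambda>s. norm (\<delta> s)) integrable_on {0..T}"
      by (intro integrable_continuous_interval continuous_intros \<delta>_cont)
    have int_nonneg: "0 \<le> integral {0..T} (\<lambda>s. norm (\<delta> s))"
      by (rule integral_nonneg[OF int]) simp
    have B: "B \<ge> 0"
      using int_nonneg SUP_nonneg by (auto simp: B_def intro!: sum_nonneg)
    \<comment> \<open>For \<open>\<nu> = 0\<close> the bound \<open>B\<close> is the integral
      itself; otherwise it dominates the supremum of \<open>norm (\<delta> s)\<close>, which is the
      term \<open>i = 0\<close>. The factor \<open>T + 1\<close> serves both cases.\<close>
    have int_le: "integral {0..T} (\<lambda>s. norm (\<delta> s)) \<le> (T + 1) * B"
    proof (cases "\<nu> = 0")
      case True
      then show ?thesis using mult_right_mono[of 1 "T + 1" B] T B by (simp add: B_def)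
    next
      case False
      have "norm (\<delta> s) \<le> B" if "s \<in> {0..T}" for s
        using norm_le_SUP[OF _ that, of 0] SUP_le[of 0] False by (simp add: iter_deriv_0)
      then have "integral {0..T} (\<lambda>s. norm (\<delta> s)) \<le> integral {0..T} (\<lambda>_. B)"
        by (intro integral_le int) auto
      also have "\<dots> = T * B" using T by simp
      also have "\<dots> \<le> (T + 1) * B" using B by (intro mult_right_mono) auto
      finally show ?thesis .
    qed
    define u where "u s = fst (P (x s))" for s
    have "norm (u t) \<le> c * (norm (u 0) + integral {0..T} (\<lambda>s. norm (fst (Q (\<delta> s)))))"
    proof (rule est[OF _ _ _ t])
      show "continuous_on {0..T} (\<lambda>s. fst (Q (\<delta> s)))"
        by (rule bounded_linear.continuous_on[OF bounded_clinear_linear[OF fQ] \<delta>_cont])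
      fix s assume s: "s \<in> {0..T}"
      note xD = classical_solution_in[OF sol s]
      then show "u s \<in> D1" by (simp add: u_def in_D_iff)
      have "((\<lambda>s. fst (Q (E (x s)))) has_vector_derivative fst (Q (A (x s) + \<delta> s))) (at s within {0..T})"
        by (rule bounded_linear.has_vector_derivative[OF bounded_clinear_linear[OF fQ]
              classical_solution_deriv[OF sol s]])
      then show "(u has_vector_derivative A1 (u s) + fst (Q (\<delta> s))) (at s within {0..T})"
        by (simp add: Q_E u_def[abs_def] bounded_clinear_add[OF bounded_Q] Q_A[OF xD])
    qed
    also have "integral {0..T} (\<lambda>s. norm (fst (Q (\<delta> s)))) \<le> integral {0..T} (\<lambda>s. k2 * norm (\<delta> s))"
      using k2(2)
      by (intro integral_le integrable_continuous_interval continuous_intros \<delta>_cont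
          bounded_linear.continuous_on[OF bounded_clinear_linear[OF fQ]]) auto
    also have "\<dots> = k2 * integral {0..T} (\<lambda>s. norm (\<delta> s))" by simp
    also have "\<dots> \<le> k2 * ((T + 1) * B)" using int_le k2(1) by (intro mult_left_mono) auto
    also have "norm (u 0) \<le> k1 * norm (x 0)" using k1(2) by (simp add: u_def)
    finally have u: "norm (u t) \<le> c * (k1 * norm (x 0) + k2 * ((T + 1) * B))"
      using c by simp
    have "norm (snd (P (x t))) \<le> (\<Sum>i<\<nu>. onorm (L i) * B)"
      unfolding nilpotent_component[OF T Ck sol t] norm_minus_cancel
    proof (rule sum_norm_le)
      fix i assume i: "i \<in> {..<\<nu>}"
      have "norm (L i (iter_deriv T i \<delta> t)) \<le> onorm (L i) * norm (iter_deriv T i \<delta> t)"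
        by (rule onorm[OF blL])
      also have "\<dots> \<le> onorm (L i) * B"
        using norm_le_SUP[OF _ t, of i] SUP_le[of i] i
        by (intro mult_left_mono onorm_pos_le blL) auto
      finally show "norm ((N ^^ i) (snd (Q (iter_deriv T i \<delta> t)))) \<le> onorm (L i) * B"
        by (simp add: L_def)
    qed
    also have "\<dots> = b * B" by (simp add: b_def sum_distrib_right)
    finally have v: "norm (snd (P (x t))) \<le> b * B" .
    have "norm (x t) = norm (inv P (P (x t)))" by simp
    also have "\<dots> \<le> k3 * norm (P (x t))" by (rule k3(2))
    also have "norm (P (x t)) \<le> norm (u t) + norm (snd (P (x t)))"
      using norm_Pair_le[of "fst (P (x t))" "snd (P (x t))"] by (simp add: u_def)
    also have "\<dots> \<le> c * (k1 * norm (x 0) + k2 * ((T + 1) * B)) + b * B"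
      by (rule add_mono[OF u v])
    also have "\<dots> \<le> (c * (k1 + k2 * (T + 1)) + b) * (norm (x 0) + B)"
    proof -
      have "0 \<le> c * (k1 * B) + c * (k2 * ((T + 1) * norm (x 0))) + b * norm (x 0)"
        using c k1 k2 T b B by simp
      then show ?thesis by (simp add: algebra_simps)
    qed
    finally have "norm (x t) \<le> k3 * ((c * (k1 + k2 * (T + 1)) + b) * (norm (x 0) + B))"
      using k3(1) by simp
    then show ?thesis by (simp add: C_def B_def mult.assoc)
  qed
  then show ?thesis unfolding perturbation_bound_def using C by blast
qed

end

theorem mainTheorem1:
  fixes E :: "'x::complex_banach \<Rightarrow> 'z::complex_banach"
    and D :: "'x set" and A :: "'x \<Rightarrow> 'z"
    and N :: "'y2::complex_hilbert \<Rightarrow> 'y2"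
    and D1 :: "'y1::complex_hilbert set" and A1 :: "'y1 \<Rightarrow> 'y1"
    and T :: real
    and p_res p_chain p_rad p_nilp p_diff p_pert :: nat
  assumes "bounded_clinear E"
    and "clinear_on D A" and "closed_operator D A" and "closure D = UNIV"
    and "resolvent_set E D A \<noteq> {}"
    and "T > 0"
    and "resolvent_index E D A p_res"
    and "chain_index E D A p_chain"
    and "radiality_index E D A p_rad"
    and "nilpotency_index_via E D A N D1 A1 p_nilp"
    and "differentiation_index E D A p_diff"
    and "perturbation_index T E D A p_pert"
  shows "(p_rad + 1 \<ge> p_res \<and> p_res \<ge> p_nilp \<and> p_nilp = p_diff \<and> p_diff = p_chain)
    \<and> (generates_C0_semigroup UNIV norm D1 A1 \<longrightarrow>
        p_rad + 1 \<ge> p_res \<and> p_res \<ge> p_nilp \<and> p_nilp = p_diff \<and> p_diff = p_chain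
        \<and> p_chain = p_pert)"
proof -
  obtain P Q where "weierstrass_pencil E D A N D1 A1 P Q p_nilp"
    using assms(10)
    unfolding nilpotency_index_via_def weierstrass_form_def equivalent_pencils_def
      weierstrass_pencil_def by blast
  then interpret weierstrass_pencil E D A N D1 A1 P Q p_nilp .
  have res: "is_smallest (resolvent_growth E D A) p_res"
    and diff: "is_smallest (differentiation_property E D A) p_diff"
    and pert: "is_smallest (perturbation_bound T E D A) p_pert"
    using assms(7,11,12)
    by (simp_all add: resolvent_index_iff differentiation_index_iff perturbation_index_iff)
  have growth: "resolvent_growth E D A p_res" and dp: "differentiation_property E D A p_diff"
    and pb: "perturbation_bound T E D A p_pert"
    using res diff pert by (simp_all add: is_smallest_def)
  obtain \<omega> C where \<omega>: "\<omega> \<ge> 1" "C > 0"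
    and rs: "\<And>l. l > \<omega> \<Longrightarrow> complex_of_real l \<in> resolvent_set E D A"
    and "\<And>l z. l > \<omega> \<Longrightarrow> norm (resolvent E D A (complex_of_real l) z) \<le> C * (l ^ p_res / l) * norm z"
    using resolvent_growthD[OF growth] by blast
  have gen: "generates_C0_semigroup UNIV norm D1 A1"
    using A1_generates[OF \<open>T > 0\<close> \<open>closure D = UNIV\<close> rs _ dp pb] \<omega> by simp
  have "p_res \<le> p_rad + 1"
    using is_smallest_le[OF res radiality_imp_resolvent_growth[OF assms(1,9)]] .
  moreover have "p_nilp \<le> p_res" by (rule nilpotency_le_resolvent_growth[OF growth])
  moreover have "p_nilp = p_diff"
    using nilpotency_le_differentiation[OF dp] is_smallest_le[OF diff generates_imp_differentiation[OF gen]]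
    by simp
  moreover have "p_chain = p_nilp" by (rule chain_index_eq[OF assms(8)])
  moreover have "p_pert \<le> p_nilp"
    using is_smallest_le[OF pert generates_imp_perturbation[OF \<open>T > 0\<close> gen]] .
  \<comment> \<open>This closes the circle
    \<open>p_nilp \<le> p_res \<le> p_pert \<le> p_nilp\<close>, which yields the equality with
    \<open>p_pert\<close>.\<close>
  moreover have "p_res \<le> p_pert"
    using is_smallest_le[OF res perturbation_imp_resolvent_growth[OF \<open>T > 0\<close> assms(1,2) rs pb]] .
  ultimately show ?thesis by simp
qed

end
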